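(* Let $m=m(n)$ be a sequence of nonnegative integers such that there is a constant $C>0$ with $m\le n/2+Cn^{2/3}$ for all $n$, let $P=P(n,m)$ be a graph chosen uniformly at random from $\mathcal P(n,m)$, and let $\varepsilon>0$. Then with high probability $$\lfloor \nu(n,2m)-\varepsilon\rfloor\le \Delta(P)\le \lfloor \nu(n,2m)+\varepsilon\rfloor .$$ In particular, with high probability $\Delta(P)\in\{D,D+1\}$, where $D=D(n):=\lfloor \nu(n,2m)-1/3\rfloor$.
   Context: $\mathcal P(n,m)$ denotes the class of all simple vertex-labelled planar graphs on vertex set $[n]=\{1,\dots,n\}$ with exactly $m$ edges. $\Delta(H)$ is the maximum degree of a graph $H$. "With high probability" (whp) means with probability tending to $1$ as $n\to\infty$. $\log$ is the natural logarithm. For $n,k\in\mathbb N$, $\nu(n,k)$ denotes the unique positive zero of $f_{n,k}(x)=x\log k+x-(x+1/2)\log x-(x-1)\log n$. *)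

theory Defs
  imports "HOL-Probability.Probability"
begin

text \<open>A simple graph on the vertex set \<open>V\<close> is given by its set of edges, each a two-element
  subset of \<open>V\<close>.\<close>

definition simple_graph :: "'a set \<Rightarrow> 'a set set \<Rightarrow> bool" where
  "simple_graph V E \<longleftrightarrow> (\<forall>e\<in>E. e \<subseteq> V \<and> card e = 2)"

definition degree :: "'a set set \<Rightarrow> 'a \<Rightarrow> nat" where
  "degree E v = card {e \<in> E. v \<in> e}"

definition max_degree :: "'a set \<Rightarrow> 'a set set \<Rightarrow> nat" where
  "max_degree V E = Max (degree E ` V)"

text \<open>A plane drawing places the vertices at distinct points \<open>p v\<close> and draws each edge \<open>e\<close> as a
  simple arc \<open>\<gamma> e\<close> joining its endpoints; an arc avoids all other vertices, and two arcs meet at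
  most in common endpoints.\<close>

definition plane_drawing ::
    "'a set \<Rightarrow> 'a set set \<Rightarrow> ('a \<Rightarrow> real ^ 2) \<Rightarrow> ('a set \<Rightarrow> real \<Rightarrow> real ^ 2) \<Rightarrow> bool" where
  "plane_drawing V E p \<gamma> \<longleftrightarrow>
     inj_on p V \<and>
     (\<forall>e\<in>E. arc (\<gamma> e) \<and> {pathstart (\<gamma> e), pathfinish (\<gamma> e)} = p ` e \<and>
             path_image (\<gamma> e) \<inter> p ` V = p ` e) \<and>
     (\<forall>e\<in>E. \<forall>e'\<in>E. e \<noteq> e' \<longrightarrow>
             path_image (\<gamma> e) \<inter> path_image (\<gamma> e') \<subseteq> p ` (e \<inter> e'))"

definition planar :: "'a set \<Rightarrow> 'a set set \<Rightarrow> bool" where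
  "planar V E \<longleftrightarrow> (\<exists>p \<gamma>. plane_drawing V E p \<gamma>)"

definition planar_graphs :: "nat \<Rightarrow> nat \<Rightarrow> nat set set set" where
  "planar_graphs n m = {E. simple_graph {1..n} E \<and> card E = m \<and> planar {1..n} E}"

lemma finite_planar_graphs: "finite (planar_graphs n m)"
proof (rule finite_subset)
  show "planar_graphs n m \<subseteq> Pow (Pow {1..n})"
    by (auto simp: planar_graphs_def simple_graph_def)
qed simp

definition nu_fun :: "nat \<Rightarrow> nat \<Rightarrow> real \<Rightarrow> real" where
  "nu_fun n k x = x * ln (real k) + x - (x + 1/2) * ln x - (x - 1) * ln (real n)"

text \<open>For \<open>n, k \<ge> 1\<close> the positive zero exists and is unique. For \<open>k = 0\<close> the term \<open>log k\<close> is
  \<open>-\<infinity>\<close>; the value \<open>0\<close> chosen there is the limit of the positive zero as a real \<open>k\<close> tends to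
  \<open>0\<close> from above. This keeps \<open>ln 0 = 0\<close> from entering the definition.\<close>

definition nu :: "nat \<Rightarrow> nat \<Rightarrow> real" where
  "nu n k = (if k = 0 then 0 else (THE x. x > 0 \<and> nu_fun n k x = 0))"

end

theory Submission
  imports Defs "HOL-Real_Asymp.Real_Asymp"
begin

text \<open>
  All graphs with \<open>m\<close> edges are compared with the planar ones. Since \<open>m \<le> n/2 + O(n^(2/3))\<close>, a positive
  fraction of all graphs are pseudoforests (every component has at most one cycle), and these are
  outerplanar. So an event of vanishing probability for the uniform random graph also has vanishing
  probability for the random planar graph, and it suffices to locate the maximum degree of the former
  by the first and second moment methods: \<open>exp (nu_fun n (2 * m) d)\<close> is, up to a constant factor, the
  expected number of vertices of degree \<open>d\<close>, and it drops from large to small within distance \<open>\<epsilon>\<close> of \<open>nu\<close>.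

  Planarity passes to subgraphs, so only \<open>m = n/2 + D n^(2/3)\<close> with \<open>D\<close> large has to be considered
  for the pseudoforests. With \<open>t = n - m\<close>, a pseudoforest consists of \<open>t\<close> trees and a part of some
  size \<open>j\<close> with unicyclic components. The number of the latter is of order \<open>j! e^j j^(-3/4)\<close>; the
  number of forests is \<open>(N! e^N / t!)\<close> times the coefficient of \<open>X^N\<close> in the \<open>t\<close>-th power of a series
  with total mass \<open>1/2\<close> and mean \<open>2\<close>. Chebyshev's inequality for the series truncated at \<open>n^(2/3)\<close> shows
  that a constant proportion of the mass of this power lies at \<open>N = n - j\<close> with \<open>j\<close> of order \<open>n^(2/3)\<close>.
  Summing over \<open>j\<close> gives \<open>n! e^n n^(-1/2) 2^(-t) / t!\<close>, which by Stirling's formula is of the order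
  of the number of all graphs.
\<close>

section \<open>Outerplanar drawings\<close>

text \<open>Planar graphs only have to be counted from below and up to a constant, so injections
  replace exact enumeration, and planarity enters only through chords of a parabola, where crossing
  is a matter of the order of endpoints. The constants \<open>1/2\<close> and \<open>2\<close> come
  from the tree function \<open>T\<close> with \<open>T(1/e) = 1\<close>: unrooted trees have the
  series \<open>T - T^2/2\<close>, of mass \<open>1 - 1/2\<close>, and their size-weighted sum is 1.
  The weights decay like \<open>k^(-5/2)\<close>, so the variance is infinite. With
  \<open>x = n^(1/3)\<close>, cutting at \<open>x^2\<close> balances three errors: the second moment
  left is of order \<open>x\<close>, which spreads the total size of about \<open>x^3 / 2\<close>
  trees by order \<open>x^2\<close>; the mean of that total moves by order \<open>x^2\<close>; and
  the mass lost is of order \<open>x^(-3)\<close> per tree, a constant factor in all. For the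
  degrees, pair probabilities are needed up to a factor \<open>1 + o(1)\<close>. This requires
  \<open>d^2 / m\<close> to be small, although \<open>m\<close> has no lower bound: it holds because
  a lower end \<open>d\<close> of at least 2 already forces \<open>m\<close> to be of order at least
  \<open>sqrt n\<close>.\<close>

definition noncrossing :: "('a \<Rightarrow> real) \<Rightarrow> 'a set set \<Rightarrow> bool" where
  "noncrossing \<pi> E \<longleftrightarrow>
     (\<forall>a b c d. {a, b} \<in> E \<longrightarrow> {c, d} \<in> E \<longrightarrow> \<not> (\<pi> a < \<pi> c \<and> \<pi> c < \<pi> b \<and> \<pi> b < \<pi> d))"

text \<open>\<open>\<pi>\<close> is the abscissa of a vertex on a parabola. As a parabola is
  strictly convex, only the order of the vertices matters for crossings of chords.\<close>

definition convex_drawable :: "'a set \<Rightarrow> 'a set set \<Rightarrow> bool" where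
  "convex_drawable V E \<longleftrightarrow> (\<exists>\<pi>. inj_on \<pi> V \<and> noncrossing \<pi> E)"

definition parabola :: "real \<Rightarrow> real ^ 2" where
  "parabola s = vector [s, s\<^sup>2]"

lemma parabola_inject: "parabola s = parabola t \<longleftrightarrow> s = t"
  by (metis parabola_def vector_2(1))

text \<open>Over the abscissa \<open>u\<close> the chord lies \<open>(u - s) * (t - u)\<close> above
  the parabola. This height decides how chords meet the parabola and each other.\<close>

lemma closed_segment_parabola:
  assumes "s < t" "z \<in> closed_segment (parabola s) (parabola t)"
  obtains u where "s \<le> u" "u \<le> t" "z = vector [u, u\<^sup>2 + (u - s) * (t - u)]"
proof -
  obtain l where l: "0 \<le> l" "l \<le> 1" "z = (1 - l) *\<^sub>R parabola s + l *\<^sub>R parabola t"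
    using assms(2) by (auto simp: closed_segment_def)
  define u where "u = (1 - l) * s + l * t"
  have u': "u = s + l * (t - s)" "u = t - (1 - l) * (t - s)" by (simp_all add: u_def algebra_simps)
  have "s \<le> u" using u'(1) l assms(1) by simp
  moreover have "u \<le> t" using u'(2) l assms(1) by simp
  moreover have "z = vector [u, u\<^sup>2 + (u - s) * (t - u)]"
  proof -
    have "(1 - l) * s\<^sup>2 + l * t\<^sup>2 = u\<^sup>2 + (u - s) * (t - u)"
      unfolding u_def by (simp add: power2_eq_square algebra_simps)
    then show ?thesis by (simp add: vec_eq_iff forall_2 l(3) parabola_def u_def)
  qed
  ultimately show ?thesis using that by blast
qed

lemma chord_inter_parabola:
  assumes "s < t" "parabola u \<in> closed_segment (parabola s) (parabola t)"
  shows "u = s \<or> u = t"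
  using closed_segment_parabola[OF assms]
  by (metis parabola_def vector_2 add_cancel_left_right mult_eq_0_iff eq_iff_diff_eq_0)

text \<open>Intervals that do not interleave overlap at most in an endpoint, share an end, or are
  strictly nested. In the nested case the inner chord is strictly lower, so only common endpoints
  can be met.\<close>

lemma noncrossing_chords_inter:
  assumes st: "s < t" "s' < t'" and ne: "(s, t) \<noteq> (s', t')"
    and nc: "\<not> (s < s' \<and> s' < t \<and> t < t')" "\<not> (s' < s \<and> s < t' \<and> t' < t)"
    and z: "z \<in> closed_segment (parabola s) (parabola t)" "z \<in> closed_segment (parabola s') (parabola t')"
  shows "\<exists>u. u \<in> {s, t} \<and> u \<in> {s', t'} \<and> z = parabola u"
proof -
  obtain u where u: "s \<le> u" "u \<le> t" "z = vector [u, u\<^sup>2 + (u - s) * (t - u)]"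
    using closed_segment_parabola[OF st(1) z(1)] .
  obtain u' where u': "s' \<le> u'" "u' \<le> t'" "z = vector [u', u'\<^sup>2 + (u' - s') * (t' - u')]"
    using closed_segment_parabola[OF st(2) z(2)] .
  have "u' = u" using u(3) u'(3) by (metis vector_2(1))
  then have eq: "(u - s) * (t - u) = (u - s') * (t' - u)"
    using u(3) u'(3) by (metis vector_2(2) add_left_cancel)
  have nested: False if "s < s'" "t' < t" "s' \<le> u" "u \<le> t'"
    "(u - s) * (t - u) = (u - s') * (t' - u)" for s t s' t' u :: real
  proof -
    have "(u - s') * (t' - u) \<le> (u - s') * (t - u)" using that by (intro mult_left_mono) auto
    also have "\<dots> < (u - s) * (t - u)" using that by (intro mult_strict_right_mono) auto
    finally show False using that by simp
  qed
  have end_eq: "z = parabola u" if "u = s \<or> u = t"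
    using that u(3) by (auto simp: parabola_def)
  have in1: "u = s \<or> u = t" and in2: "u = s' \<or> u = t'"
  proof -
    consider "s = s'" | "t = t'" | "s < s'" "t \<le> s'" | "s' < s" "t' \<le> s"
      | "s < s'" "t' < t" | "s' < s" "t < t'"
      using nc by linarith
    then have "(u = s \<or> u = t) \<and> (u = s' \<or> u = t')"
    proof cases
      case 1
      then have "(u - s) * (t - t') = 0" using eq by (simp add: algebra_simps)
      then show ?thesis using ne 1 by auto
    next
      case 2
      then have "(s' - s) * (t - u) = 0" using eq by (simp add: algebra_simps)
      then show ?thesis using ne 2 by auto
    next
      case 3
      then show ?thesis using u u' \<open>u' = u\<close> by auto
    next
      case 4
      then show ?thesis using u u' \<open>u' = u\<close> by auto
    next
      case 5
      then show ?thesis using nested[of s s' t' t u] eq u u' \<open>u' = u\<close> by auto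
    next
      case 6
      then show ?thesis using nested[of s' s t t' u] eq u u' \<open>u' = u\<close> by auto
    qed
    then show "u = s \<or> u = t" "u = s' \<or> u = t'" by auto
  qed
  then show ?thesis using end_eq by blast
qed

text \<open>Edges become straight chords, so the conditions on vertices and on pairs of edges are
  exactly the two lemmas about chords.\<close>

lemma convex_drawable_planar:
  assumes "convex_drawable V E" "simple_graph V E"
  shows "planar V E"
proof -
  obtain \<pi> where \<pi>: "inj_on \<pi> V" "noncrossing \<pi> E"
    using assms(1) by (auto simp: convex_drawable_def)
  have "\<exists>a b. e = {a, b} \<and> a \<in> V \<and> b \<in> V \<and> \<pi> a < \<pi> b" if e: "e \<in> E" for e
  proof -
    obtain a b where ab: "e = {a, b}" "a \<noteq> b"
    proof -
      have "card e = 2" using assms(2) e by (auto simp: simple_graph_def)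
      then show thesis using that card_2_iff[of e] by blast
    qed
    then have V: "a \<in> V" "b \<in> V" using assms(2) that by (auto simp: simple_graph_def)
    then have "\<pi> a \<noteq> \<pi> b" using \<pi>(1) ab by (auto dest: inj_onD)
    then show ?thesis using ab V by (metis insert_commute linorder_neqE_linordered_idom)
  qed
  then obtain l r where lr: "\<And>e. e \<in> E \<Longrightarrow> e = {l e, r e} \<and> l e \<in> V \<and> r e \<in> V \<and> \<pi> (l e) < \<pi> (r e)"
    by metis
  define p where "p = parabola \<circ> \<pi>"
  define \<gamma> where "\<gamma> e = linepath (p (l e)) (p (r e))" for e
  have img: "path_image (\<gamma> e) = closed_segment (parabola (\<pi> (l e))) (parabola (\<pi> (r e)))" for e
    by (simp add: \<gamma>_def p_def)
  have "plane_drawing V E p \<gamma>"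
    unfolding plane_drawing_def
  proof (intro conjI ballI impI)
    show "inj_on p V" using \<pi>(1) by (auto simp: p_def inj_on_def parabola_inject)
  next
    fix e assume e: "e \<in> E"
    have "p (l e) \<noteq> p (r e)" using lr[OF e] by (auto simp: p_def parabola_inject)
    then show "arc (\<gamma> e)" by (simp add: \<gamma>_def arc_linepath)
    have pe: "p ` e = {p (l e), p (r e)}" using lr[OF e] by (metis image_empty image_insert)
    then show "{pathstart (\<gamma> e), pathfinish (\<gamma> e)} = p ` e" by (simp add: \<gamma>_def)
    show "path_image (\<gamma> e) \<inter> p ` V = p ` e"
    proof
      show "path_image (\<gamma> e) \<inter> p ` V \<subseteq> p ` e"
      proof
        fix z assume "z \<in> path_image (\<gamma> e) \<inter> p ` V"
        then obtain v where "z = parabola (\<pi> v)"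
          "parabola (\<pi> v) \<in> closed_segment (parabola (\<pi> (l e))) (parabola (\<pi> (r e)))"
          unfolding img by (auto simp: p_def)
        moreover from this have "\<pi> v = \<pi> (l e) \<or> \<pi> v = \<pi> (r e)"
          using lr[OF e] by (intro chord_inter_parabola) auto
        ultimately show "z \<in> p ` e" unfolding pe by (auto simp: p_def)
      qed
      show "p ` e \<subseteq> path_image (\<gamma> e) \<inter> p ` V"
        unfolding pe img using lr[OF e] by (auto simp: p_def)
    qed
  next
    fix e e' assume e: "e \<in> E" and e': "e' \<in> E" and ne: "e \<noteq> e'"
    show "path_image (\<gamma> e) \<inter> path_image (\<gamma> e') \<subseteq> p ` (e \<inter> e')"
    proof
      fix z assume z: "z \<in> path_image (\<gamma> e) \<inter> path_image (\<gamma> e')"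
      have "\<exists>u. u \<in> {\<pi> (l e), \<pi> (r e)} \<and> u \<in> {\<pi> (l e'), \<pi> (r e')} \<and> z = parabola u"
      proof (rule noncrossing_chords_inter)
        show "(\<pi> (l e), \<pi> (r e)) \<noteq> (\<pi> (l e'), \<pi> (r e'))"
          using lr[OF e] lr[OF e'] ne \<pi>(1) by (metis inj_onD prod.inject)
        have "{l e, r e} \<in> E" "{l e', r e'} \<in> E" using e e' lr by metis+
        then show "\<not> (\<pi> (l e) < \<pi> (l e') \<and> \<pi> (l e') < \<pi> (r e) \<and> \<pi> (r e) < \<pi> (r e'))"
          "\<not> (\<pi> (l e') < \<pi> (l e) \<and> \<pi> (l e) < \<pi> (r e') \<and> \<pi> (r e') < \<pi> (r e))"
          using \<pi>(2) unfolding noncrossing_def by blast+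
      qed (use lr[OF e] lr[OF e'] z in \<open>auto simp: img\<close>)
      then obtain u where u: "u \<in> {\<pi> (l e), \<pi> (r e)}" "u \<in> {\<pi> (l e'), \<pi> (r e')}" "z = parabola u"
        by blast
      obtain v where v: "v \<in> {l e, r e}" "u = \<pi> v" using u(1) by auto
      obtain v' where v': "v' \<in> {l e', r e'}" "u = \<pi> v'" using u(2) by auto
      have "v = v'" using v v' lr[OF e] lr[OF e'] \<pi>(1) by (metis inj_onD insertE singletonD)
      then have "v \<in> e \<inter> e'" using v v' lr[OF e] lr[OF e'] by auto
      then show "z \<in> p ` (e \<inter> e')" using u(3) v(2) by (auto simp: p_def)
    qed
  qed
  then show ?thesis unfolding planar_def by blast
qed

section \<open>Inserting a vertex into a convex drawing\<close>

lemma finite_gap_above: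
  fixes y :: real
  assumes "finite A"
  obtains p where "y < p" "\<And>a. a \<in> A \<Longrightarrow> a \<le> y \<or> p < a"
proof -
  have "\<exists>p>y. \<forall>a\<in>A. a \<le> y \<or> p < a"
    using assms
  proof (induction A rule: finite_induct)
    case empty
    then show ?case by (auto intro: gt_ex)
  next
    case (insert a A)
    then obtain p where p: "y < p" "\<forall>a\<in>A. a \<le> y \<or> p < a" by blast
    define q where "q = (if a \<le> y then p else min p ((y + a) / 2))"
    have "y < q" "q \<le> p" using p(1) by (auto simp: q_def)
    moreover have "a \<le> y \<or> q < a" by (simp add: q_def min_def)
    ultimately have "y < q" "q \<le> p" "a \<le> y \<or> q < a" by auto
    then show ?case using p(2) by (intro exI[of _ q]) force
  qed
  then show ?thesis using that by blast
qed

lemma finite_gap_below: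
  fixes y :: real
  assumes "finite A"
  obtains p where "p < y" "\<And>a. a \<in> A \<Longrightarrow> a < p \<or> y \<le> a"
proof -
  obtain q where q: "- y < q" "\<And>a. a \<in> uminus ` A \<Longrightarrow> a \<le> - y \<or> q < a"
    using finite_gap_above[of "uminus ` A" "- y"] assms by blast
  show ?thesis
  proof (rule that[of "- q"])
    show "- q < y" using q(1) by simp
    fix a assume "a \<in> A"
    then show "a < - q \<or> y \<le> a" using q(2)[of "- a"] by auto
  qed
qed

lemma convex_drawable_isolated:
  assumes "finite V" "simple_graph V E" "convex_drawable V E" "x \<notin> V"
  shows "convex_drawable (insert x V) E"
proof -
  obtain \<pi> where \<pi>: "inj_on \<pi> V" "noncrossing \<pi> E"
    using assms(3) by (auto simp: convex_drawable_def)
  have "infinite (UNIV :: real set)" by (rule infinite_UNIV_char_0)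
  then obtain p where p: "p \<notin> \<pi> ` V" using assms(1) ex_new_if_finite[of "\<pi> ` V"] by blast
  define \<pi>' where "\<pi>' = \<pi>(x := p)"
  have "inj_on \<pi>' (insert x V)"
    using \<pi>(1) p assms(4) by (auto simp: \<pi>'_def inj_on_def)
  moreover have "noncrossing \<pi>' E"
    unfolding noncrossing_def
  proof (intro allI impI)
    fix a b c d assume e: "{a, b} \<in> E" "{c, d} \<in> E"
    then have "a \<noteq> x" "b \<noteq> x" "c \<noteq> x" "d \<noteq> x" using assms(2,4) by (auto simp: simple_graph_def)
    then show "\<not> (\<pi>' a < \<pi>' c \<and> \<pi>' c < \<pi>' b \<and> \<pi>' b < \<pi>' d)"
      using \<pi>(2) e unfolding noncrossing_def \<pi>'_def by auto
  qed
  ultimately show ?thesis by (auto simp: convex_drawable_def)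
qed

text \<open>Placing \<open>x\<close> directly to the right of \<open>v\<close>, with no vertex
  between them, gives a chord that spans nothing and so crosses nothing.\<close>

lemma convex_drawable_leaf:
  assumes "finite V" "simple_graph V E" "convex_drawable V E" "x \<notin> V" "v \<in> V"
  shows "convex_drawable (insert x V) (insert {x, v} E)"
proof -
  obtain \<pi> where \<pi>: "inj_on \<pi> V" "noncrossing \<pi> E"
    using assms(3) by (auto simp: convex_drawable_def)
  obtain p where p: "\<pi> v < p" "\<And>a. a \<in> \<pi> ` V \<Longrightarrow> a \<le> \<pi> v \<or> p < a"
    using finite_gap_above[of "\<pi> ` V" "\<pi> v"] assms(1) by blast
  define \<pi>' where "\<pi>' = \<pi>(x := p)"
  have gap: "\<not> (\<pi>' v < \<pi>' u \<and> \<pi>' u < \<pi>' x)" "\<not> (\<pi>' x < \<pi>' u \<and> \<pi>' u < \<pi>' v)" if "u \<in> insert x V" for u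
  proof -
    have "u = x \<or> u \<in> V \<and> u \<noteq> x \<and> (\<pi> u \<le> \<pi> v \<or> p < \<pi> u)" using that p(2)[of "\<pi> u"] assms(4) by auto
    moreover have "v \<noteq> x" using assms(4,5) by auto
    ultimately show "\<not> (\<pi>' v < \<pi>' u \<and> \<pi>' u < \<pi>' x)" "\<not> (\<pi>' x < \<pi>' u \<and> \<pi>' u < \<pi>' v)"
      using p(1) by (auto simp: \<pi>'_def)
  qed
  have "p \<notin> \<pi> ` V" using p by fastforce
  then have "inj_on \<pi>' (insert x V)"
    using \<pi>(1) assms(4) by (auto simp: \<pi>'_def inj_on_def)
  moreover have "noncrossing \<pi>' (insert {x, v} E)"
    unfolding noncrossing_def
  proof (intro allI impI notI)
    fix a b c d
    assume e: "{a, b} \<in> insert {x, v} E" "{c, d} \<in> insert {x, v} E"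
      and cr: "\<pi>' a < \<pi>' c \<and> \<pi>' c < \<pi>' b \<and> \<pi>' b < \<pi>' d"
    have V: "a \<in> insert x V" "b \<in> insert x V" "c \<in> insert x V" "d \<in> insert x V"
      using e assms(2,5) by (auto simp: simple_graph_def doubleton_eq_iff)
    show False
    proof (cases "{a, b} = {x, v} \<or> {c, d} = {x, v}")
      case True
      then show False using gap V cr by (auto simp: doubleton_eq_iff)
    next
      case False
      then have E: "{a, b} \<in> E" "{c, d} \<in> E" using e by auto
      then have "a \<noteq> x" "b \<noteq> x" "c \<noteq> x" "d \<noteq> x" using assms(2,4) by (auto simp: simple_graph_def)
      then show False using \<pi>(2) E cr unfolding noncrossing_def \<pi>'_def by auto
    qed
  qed
  ultimately show ?thesis by (auto simp: convex_drawable_def)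
qed

text \<open>These are the disjoint unions of cycles. The condition on \<open>card E\<close> supplies
  the number of edges that can be subdivided in \<open>cycle_graphs_insert\<close>.\<close>

definition two_regular :: "'a set \<Rightarrow> 'a set set \<Rightarrow> bool" where
  "two_regular V E \<longleftrightarrow> simple_graph V E \<and> card E = card V \<and> (\<forall>v\<in>V. card {e \<in> E. v \<in> e} = 2)"

lemma two_regular_neighbours:
  assumes "two_regular V E" "a \<in> V" "{a, b} \<in> E" "{a, c} \<in> E" "{a, d} \<in> E"
  shows "b = c \<or> b = d \<or> c = d"
proof (rule ccontr)
  assume "\<not> (b = c \<or> b = d \<or> c = d)"
  then have "{a, b} \<noteq> {a, c}" "{a, b} \<noteq> {a, d}" "{a, c} \<noteq> {a, d}"
    by (simp_all add: doubleton_eq_iff)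
  then have "card {{a, b}, {a, c}, {a, d}} = 3" by simp
  moreover have "card {e \<in> E. a \<in> e} = 2" using assms by (simp add: two_regular_def)
  moreover from this have "finite {e \<in> E. a \<in> e}" by (intro card_ge_0_finite) simp
  then have "card {{a, b}, {a, c}, {a, d}} \<le> card {e \<in> E. a \<in> e}"
    using assms by (intro card_mono) auto
  ultimately show False by simp
qed

text \<open>If \<open>x\<close> is placed next to \<open>a\<close>, its chord to \<open>a\<close>
  spans nothing and its chord to \<open>b\<close> nearly repeats the deleted chord
  \<open>ab\<close>; only other edges at \<open>a\<close> can interfere. Two-regularity leaves a
  single such edge, and its other end decides on which side of \<open>a\<close> the vertex
  \<open>x\<close> goes.\<close>

lemma convex_drawable_subdivide:
  assumes "finite V" "two_regular V E" "convex_drawable V E" "x \<notin> V" "e \<in> E"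
  shows "convex_drawable (insert x V) (E - {e} \<union> (\<lambda>v. {x, v}) ` e)"
proof -
  obtain \<pi> where \<pi>: "inj_on \<pi> V" "noncrossing \<pi> E"
    using assms(3) by (auto simp: convex_drawable_def)
  have sg: "simple_graph V E" using assms(2) by (simp add: two_regular_def)
  obtain a b where ab: "e = {a, b}" "\<pi> a < \<pi> b" "a \<in> V" "b \<in> V"
  proof -
    obtain a b where "e = {a, b}" "a \<noteq> b" "a \<in> V" "b \<in> V"
    proof -
      have "card e = 2" "e \<subseteq> V" using sg assms(5) by (auto simp: simple_graph_def)
      then show thesis using that card_2_iff[of e] by blast
    qed
    moreover from this have "\<pi> a \<noteq> \<pi> b" using \<pi>(1) by (auto dest: inj_onD)
    ultimately show thesis using that[of a b] that[of b a] by (simp add: insert_commute) linarith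
  qed
  have abE: "{a, b} \<in> E" using assms(5) ab by simp
  have ncE: "\<not> (\<pi> c < \<pi> f \<and> \<pi> f < \<pi> d \<and> \<pi> d < \<pi> g)" if "{c, d} \<in> E" "{f, g} \<in> E" for c d f g
    using \<pi>(2) that unfolding noncrossing_def by blast
  \<comment> \<open>\<open>Q1\<close> protects the new chord from \<open>x\<close> to
    \<open>a\<close>, and \<open>Q2\<close> the one from \<open>x\<close> to
    \<open>b\<close>.\<close>
  define Q1 where "Q1 p \<longleftrightarrow> (\<forall>u\<in>V. \<not> (\<pi> a < \<pi> u \<and> \<pi> u < p) \<and> \<not> (p < \<pi> u \<and> \<pi> u < \<pi> a))" for p
  define Q2 where "Q2 p \<longleftrightarrow> (\<forall>c d. {c, d} \<in> E - {e} \<longrightarrow>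
      \<not> (p < \<pi> c \<and> \<pi> c < \<pi> b \<and> \<pi> b < \<pi> d) \<and> \<not> (\<pi> c < p \<and> p < \<pi> d \<and> \<pi> d < \<pi> b))" for p
  have "\<exists>p. p \<notin> \<pi> ` V \<and> p < \<pi> b \<and> Q1 p \<and> Q2 p"
  \<comment> \<open>If the second neighbour \<open>d\<close> of \<open>a\<close> lies between
    \<open>a\<close> and \<open>b\<close>, a point right of \<open>a\<close> would give
    \<open>a < x < d < b\<close> and a crossing of \<open>ad\<close> with \<open>xb\<close>, so
    \<open>x\<close> goes to the left. Otherwise the right side is safe: \<open>d\<close> lies left
    of \<open>a\<close>, or beyond \<open>b\<close> with \<open>ad\<close> enclosing
    \<open>xb\<close>.\<close>
  proof (cases "\<exists>d. {a, d} \<in> E \<and> \<pi> a < \<pi> d \<and> \<pi> d < \<pi> b")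
    case False
    obtain p where p: "\<pi> a < p" "\<And>u. u \<in> \<pi> ` V \<Longrightarrow> u \<le> \<pi> a \<or> p < u"
      using finite_gap_above[of "\<pi> ` V" "\<pi> a"] assms(1) by blast
    have gap: "\<pi> u \<le> \<pi> a \<or> p < \<pi> u" if "u \<in> V" for u using p(2) that by auto
    have "p \<notin> \<pi> ` V" using p by fastforce
    moreover have "p < \<pi> b" using gap[OF ab(4)] ab(2) by auto
    moreover have "\<not> (\<pi> a < \<pi> u \<and> \<pi> u < p) \<and> \<not> (p < \<pi> u \<and> \<pi> u < \<pi> a)" if "u \<in> V" for u
      using gap[OF that] p(1) by auto
    moreover have "\<not> (p < \<pi> c \<and> \<pi> c < \<pi> b \<and> \<pi> b < \<pi> d) \<and> \<not> (\<pi> c < p \<and> p < \<pi> d \<and> \<pi> d < \<pi> b)"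
      if cd: "{c, d} \<in> E - {e}" for c d
    proof
      have V: "c \<in> V" "d \<in> V" using cd sg by (auto simp: simple_graph_def)
      show "\<not> (p < \<pi> c \<and> \<pi> c < \<pi> b \<and> \<pi> b < \<pi> d)"
        using ncE[OF abE, of c d] cd p(1) by auto
      show "\<not> (\<pi> c < p \<and> p < \<pi> d \<and> \<pi> d < \<pi> b)"
      proof
        assume h: "\<pi> c < p \<and> p < \<pi> d \<and> \<pi> d < \<pi> b"
        then have "\<pi> c \<le> \<pi> a" using gap[OF V(1)] by auto
        then consider "\<pi> c < \<pi> a" | "c = a" using V ab(3) inj_onD[OF \<pi>(1)] by fastforce
        then show False
        proof cases
          case 1
          then show False using ncE[OF _ abE, of c d] cd h p(1) by auto
        next
          case 2
          then show False using False cd h p(1) by auto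
        qed
      qed
    qed
    ultimately show ?thesis unfolding Q1_def Q2_def by (intro exI[of _ p]) auto
  next
    case True
    then obtain d where d: "{a, d} \<in> E" "\<pi> a < \<pi> d" "\<pi> d < \<pi> b" by blast
    obtain p where p: "p < \<pi> a" "\<And>u. u \<in> \<pi> ` V \<Longrightarrow> u < p \<or> \<pi> a \<le> u"
      using finite_gap_below[of "\<pi> ` V" "\<pi> a"] assms(1) by blast
    have gap: "\<pi> u < p \<or> \<pi> a \<le> \<pi> u" if "u \<in> V" for u using p(2) that by auto
    have nb: "u = b \<or> u = d" if "{a, u} \<in> E" for u
      using two_regular_neighbours[OF assms(2) ab(3) abE d(1) that] d by auto
    have "p \<notin> \<pi> ` V" using p by fastforce
    moreover have "p < \<pi> b" using p(1) ab(2) by auto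
    moreover have "\<not> (\<pi> a < \<pi> u \<and> \<pi> u < p) \<and> \<not> (p < \<pi> u \<and> \<pi> u < \<pi> a)" if "u \<in> V" for u
      using gap[OF that] p(1) by auto
    moreover have "\<not> (p < \<pi> c \<and> \<pi> c < \<pi> b \<and> \<pi> b < \<pi> f) \<and> \<not> (\<pi> c < p \<and> p < \<pi> f \<and> \<pi> f < \<pi> b)"
      if cf: "{c, f} \<in> E - {e}" for c f
    proof
      have V: "c \<in> V" "f \<in> V" using cf sg by (auto simp: simple_graph_def)
      show "\<not> (p < \<pi> c \<and> \<pi> c < \<pi> b \<and> \<pi> b < \<pi> f)"
      proof
        assume h: "p < \<pi> c \<and> \<pi> c < \<pi> b \<and> \<pi> b < \<pi> f"
        then have "\<pi> a \<le> \<pi> c" using gap[OF V(1)] by auto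
        then consider "\<pi> a < \<pi> c" | "c = a" using V ab(3) inj_onD[OF \<pi>(1)] by fastforce
        then show False
        proof cases
          case 1
          then show False using ncE[OF abE, of c f] cf h by auto
        next
          case 2
          then show False using nb[of f] cf h d by auto
        qed
      qed
      show "\<not> (\<pi> c < p \<and> p < \<pi> f \<and> \<pi> f < \<pi> b)"
      proof
        assume h: "\<pi> c < p \<and> p < \<pi> f \<and> \<pi> f < \<pi> b"
        then have "\<pi> a \<le> \<pi> f" using gap[OF V(2)] by auto
        then consider "\<pi> a < \<pi> f" | "f = a" using V ab(3) inj_onD[OF \<pi>(1)] by fastforce
        then show False
        proof cases
          case 1
          moreover have "\<pi> c < \<pi> a" using h p(1) by auto
          ultimately show False using ncE[OF _ abE, of c f] cf h by auto
        next
          case 2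
          then have "{a, c} \<in> E" using cf by (auto simp: insert_commute)
          then show False using nb[of c] h d p(1) by auto
        qed
      qed
    qed
    ultimately show ?thesis unfolding Q1_def Q2_def by (intro exI[of _ p]) auto
  qed
  then obtain p where p: "p \<notin> \<pi> ` V" "p < \<pi> b" and Q: "Q1 p" "Q2 p" by blast
  have near: "\<not> (\<pi> a < \<pi> u \<and> \<pi> u < p) \<and> \<not> (p < \<pi> u \<and> \<pi> u < \<pi> a)" if "u \<in> V" for u
    using Q(1) that unfolding Q1_def by blast
  have nc: "\<not> (p < \<pi> c \<and> \<pi> c < \<pi> b \<and> \<pi> b < \<pi> d) \<and> \<not> (\<pi> c < p \<and> p < \<pi> d \<and> \<pi> d < \<pi> b)"
    if "{c, d} \<in> E - {e}" for c d
    using Q(2) that unfolding Q2_def by blast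
  define \<pi>' where "\<pi>' = \<pi>(x := p)"
  have \<pi>'V: "\<pi>' u = \<pi> u" if "u \<in> V" for u using that assms(4) by (auto simp: \<pi>'_def)
  have \<pi>'x: "\<pi>' x = p" by (simp add: \<pi>'_def)
  have "inj_on \<pi>' (insert x V)"
    using \<pi>(1) p(1) assms(4) by (auto simp: \<pi>'_def inj_on_def)
  moreover have "noncrossing \<pi>' (E - {e} \<union> (\<lambda>v. {x, v}) ` e)"
    unfolding noncrossing_def
  proof (intro allI impI notI)
    fix c d f g
    assume E: "{c, d} \<in> E - {e} \<union> (\<lambda>v. {x, v}) ` e" "{f, g} \<in> E - {e} \<union> (\<lambda>v. {x, v}) ` e"
      and cr: "\<pi>' c < \<pi>' f \<and> \<pi>' f < \<pi>' d \<and> \<pi>' d < \<pi>' g"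
    have old: "u \<in> V \<and> w \<in> V" if "{u, w} \<in> E - {e}" for u w
      using that sg by (auto simp: simple_graph_def)
    have img: "(\<lambda>v. {x, v}) ` e = {{x, a}, {x, b}}" using ab(1) by simp
    have cases: "{c, d} \<in> E - {e} \<or> {c, d} = {x, a} \<or> {c, d} = {x, b}"
      "{f, g} \<in> E - {e} \<or> {f, g} = {x, a} \<or> {f, g} = {x, b}"
      using E unfolding img by blast+
    have mem: "u \<in> insert x V \<and> w \<in> insert x V"
      if "{u, w} \<in> E - {e} \<or> {u, w} = {x, a} \<or> {u, w} = {x, b}" for u w
      using that
    proof (elim disjE)
      assume "{u, w} \<in> E - {e}"
      then show ?thesis using old by blast
    qed (use ab(3,4) in \<open>auto simp: doubleton_eq_iff\<close>)
    have V: "d \<in> insert x V" "f \<in> insert x V" using mem[OF cases(1)] mem[OF cases(2)] by auto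
    have gap: "\<not> (\<pi>' a < \<pi>' u \<and> \<pi>' u < \<pi>' x)" "\<not> (\<pi>' x < \<pi>' u \<and> \<pi>' u < \<pi>' a)" if "u \<in> insert x V" for u
    proof -
      have "u = x \<or> u \<in> V" using that by blast
      then show "\<not> (\<pi>' a < \<pi>' u \<and> \<pi>' u < \<pi>' x)" "\<not> (\<pi>' x < \<pi>' u \<and> \<pi>' u < \<pi>' a)"
        using near[of u] ab(3) by (auto simp: \<pi>'V \<pi>'x)
    qed
    have xa: "{c, d} \<noteq> {x, a}" "{f, g} \<noteq> {x, a}"
    proof -
      show "{c, d} \<noteq> {x, a}"
      proof
        assume "{c, d} = {x, a}"
        then have "(c = x \<and> d = a) \<or> (c = a \<and> d = x)" by (simp add: doubleton_eq_iff)
        then show False using gap[OF V(2)] cr by auto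
      qed
      show "{f, g} \<noteq> {x, a}"
      proof
        assume "{f, g} = {x, a}"
        then have "(f = x \<and> g = a) \<or> (f = a \<and> g = x)" by (simp add: doubleton_eq_iff)
        then show False using gap[OF V(1)] cr by auto
      qed
    qed
    have d1: "{c, d} \<in> E - {e} \<or> {c, d} = {x, b}" using cases(1) xa(1) by (elim disjE) simp_all
    have d2: "{f, g} \<in> E - {e} \<or> {f, g} = {x, b}" using cases(2) xa(2) by (elim disjE) simp_all
    from d1 show False
    proof
      assume cd: "{c, d} \<in> E - {e}"
      from d2 show False
      proof
        assume fg: "{f, g} \<in> E - {e}"
        then show False using ncE[of c d f g] cr old[OF cd] old[OF fg] cd by (auto simp: \<pi>'V)
      next
        assume "{f, g} = {x, b}"
        then have "(f = x \<and> g = b) \<or> (f = b \<and> g = x)" by (simp add: doubleton_eq_iff)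
        moreover have "\<pi>' f < \<pi>' g" "\<pi>' x < \<pi>' b" using cr p(2) ab(4) by (auto simp: \<pi>'V \<pi>'x)
        ultimately have "f = x" "g = b" by auto
        moreover have "\<pi>' c = \<pi> c" "\<pi>' d = \<pi> d" "\<pi>' b = \<pi> b" using old[OF cd] ab(4) \<pi>'V by auto
        ultimately show False using nc[OF cd] cr \<pi>'x by simp
      qed
    next
      assume cd: "{c, d} = {x, b}"
      from d2 show False
      proof
        assume fg: "{f, g} \<in> E - {e}"
        have "(c = x \<and> d = b) \<or> (c = b \<and> d = x)" using cd by (simp add: doubleton_eq_iff)
        moreover have "\<pi>' c < \<pi>' d" "\<pi>' x < \<pi>' b" using cr p(2) ab(4) by (auto simp: \<pi>'V \<pi>'x)
        ultimately have "c = x" "d = b" by auto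
        moreover have "\<pi>' f = \<pi> f" "\<pi>' g = \<pi> g" "\<pi>' b = \<pi> b" using old[OF fg] ab(4) \<pi>'V by auto
        ultimately show False using nc[OF fg] cr \<pi>'x by simp
      next
        assume "{f, g} = {x, b}"
        then have "f = c \<or> f = d" using cd by (auto simp: doubleton_eq_iff)
        then show False using cr by auto
      qed
    qed
  qed
  ultimately show ?thesis by (auto simp: convex_drawable_def)
qed

section \<open>Stirling bounds\<close>

text \<open>This is \<open>2 * ln u \<le> u - 1/u\<close> at \<open>u = sqrt (1 + 1/y)\<close>; the
  difference of the two sides has derivative \<open>(1 - 1/u)^2\<close>.\<close>

lemma ln_le_sqrt_form:
  fixes y :: real
  assumes "y \<ge> 1"
  shows "ln (1 + 1 / y) \<le> 1 / sqrt (y * (y + 1))"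
proof -
  define g where "g = (\<lambda>u::real. u - 1 / u - 2 * ln u)"
  have "g 1 \<le> g (sqrt (1 + 1 / y))"
  proof (rule DERIV_nonneg_imp_nondecreasing[of _ _ g])
    show "1 \<le> sqrt (1 + 1 / y)" using assms by simp
    fix u :: real assume "1 \<le> u"
    then have "(g has_real_derivative (1 + 1 / u^2 - 2 / u)) (at u)"
      unfolding g_def by (auto intro!: derivative_eq_intros simp: power2_eq_square field_simps)
    moreover have "1 + 1 / u^2 - 2 / u = (1 - 1/u)^2"
      using \<open>1 \<le> u\<close> by (simp add: power2_eq_square field_simps)
    ultimately show "\<exists>z. (g has_real_derivative z) (at u) \<and> 0 \<le> z" by auto
  qed
  then have "ln (1 + 1/y) \<le> sqrt (1 + 1/y) - 1 / sqrt (1 + 1/y)"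
    using assms by (simp add: g_def ln_sqrt)
  also have "\<dots> = 1 / sqrt (y * (y + 1))"
  proof -
    have "sqrt (1 + 1/y) - 1 / sqrt (1 + 1/y) = (1/y) / sqrt (1 + 1/y)"
      using assms by (simp add: diff_divide_eq_iff field_simps)
    also have "\<dots> = 1 / (y * sqrt (1 + 1/y))" using assms by simp
    also have "y * sqrt (1 + 1/y) = sqrt (y^2) * sqrt (1 + 1/y)" using assms by simp
    also have "\<dots> = sqrt (y * (y + 1))"
      using assms by (subst real_sqrt_mult[symmetric]) (simp add: power2_eq_square field_simps)
    finally show ?thesis .
  qed
  finally show ?thesis .
qed

text \<open>At \<open>y = d\<close>, the quantity minus 1 is the decrement of
  \<open>ln (d!) - (d + 1/2) ln d + d\<close> from \<open>d\<close> to \<open>d + 1\<close>. The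
  correction is written as a difference so that it telescopes.\<close>

lemma stirling_step:
  fixes y :: real
  assumes "y \<ge> 1"
  shows "1 \<le> (y + 1/2) * ln (1 + 1 / y)" "(y + 1/2) * ln (1 + 1 / y) \<le> 1 + (1 / y - 1 / (y + 1))"
proof -
  define g where "g = (\<lambda>u::real. ln (1 + u) - 2 * u / (2 + u))"
  have "g 0 \<le> g (1 / y)"
  proof (rule DERIV_nonneg_imp_nondecreasing[of _ _ g])
    show "0 \<le> 1 / y" using assms by simp
    fix u :: real assume "0 \<le> u"
    then have "(g has_real_derivative (1 / (1 + u) - 4 / (2 + u)^2)) (at u)"
      unfolding g_def by (auto intro!: derivative_eq_intros simp: power2_eq_square field_simps)
    moreover have "1 / (1 + u) - 4 / (2 + u)^2 = u^2 / ((1 + u) * (2 + u)^2)"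
      using \<open>0 \<le> u\<close> by (simp add: divide_simps) (simp add: power2_eq_square algebra_simps)
    ultimately show "\<exists>z. (g has_real_derivative z) (at u) \<and> 0 \<le> z"
      using \<open>0 \<le> u\<close> by auto
  qed
  then have "2 * (1/y) / (2 + 1/y) \<le> ln (1 + 1 / y)" by (simp add: g_def)
  also have "2 * (1/y) / (2 + 1/y) = 1 / (y + 1/2)" using assms by (simp add: divide_simps)
  finally show "1 \<le> (y + 1/2) * ln (1 + 1 / y)" using assms by (simp add: field_simps)
  have "(y + 1/2) * ln (1 + 1 / y) \<le> (y + 1/2) * (1 / sqrt (y * (y + 1)))"
    using assms ln_le_sqrt_form[OF assms] by (intro mult_left_mono) auto
  also have "\<dots> \<le> 1 + 1 / (y * (y + 1))"
  proof -
    have "(y + 1/2)^2 \<le> ((1 + 1 / (y * (y + 1))) * sqrt (y * (y + 1)))^2"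
    proof -
      define q where "q = y * (y + 1)"
      have q: "q > 0" using assms by (simp add: q_def)
      have "(y + 1/2)^2 = q + 1/4" by (simp add: q_def power2_eq_square algebra_simps)
      also have "\<dots> \<le> (1 + 1/q)^2 * q"
        using q by (simp add: power2_eq_square field_simps)
      finally show ?thesis using q by (simp add: q_def[symmetric] power_mult_distrib)
    qed
    then have "y + 1/2 \<le> (1 + 1 / (y * (y + 1))) * sqrt (y * (y + 1))"
      by (rule power2_le_imp_le) (use assms in auto)
    then show ?thesis using assms by (simp add: pos_divide_le_eq)
  qed
  also have "1 / (y * (y + 1)) = 1 / y - 1 / (y + 1)" using assms by (simp add: field_simps)
  finally show "(y + 1/2) * ln (1 + 1 / y) \<le> 1 + (1 / y - 1 / (y + 1))" .
qed

lemma ln_fact_bounds: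
  assumes "d \<ge> 1"
  shows "(real d + 1/2) * ln (real d) - real d \<le> ln (fact d)"
    and "ln (fact d) \<le> (real d + 1/2) * ln (real d) - real d + 1"
proof -
  define s where "s = (\<lambda>d::nat. ln (fact d) - (real d + 1/2) * ln (real d) + real d)"
  have step: "s d - s (Suc d) = (real d + 1/2) * ln (1 + 1 / real d) - 1" if "d \<ge> 1" for d
  proof -
    have L: "ln (1 + 1 / real d) = ln (real (Suc d)) - ln (real d)"
    proof -
      have "1 + 1 / real d = real (Suc d) / real d" using that by (simp add: field_simps)
      then show ?thesis using that by (simp add: ln_div)
    qed
    have F: "ln (fact (Suc d) :: real) = ln (real (Suc d)) + ln (fact d)"
      by (simp add: ln_mult)
    show ?thesis unfolding s_def F L by (simp add: algebra_simps)
  qed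
  \<comment> \<open>\<open>s\<close> decreases from \<open>s 1 = 1\<close>, and the invariant
    \<open>1 / d \<le> s d\<close> survives each step because the decrement is at most
    \<open>1/d - 1/(d + 1)\<close>. No limit, and hence no constant involving pi, is
    required.\<close>
  have "s d \<le> 1 \<and> 1 / real d \<le> s d" using assms
  proof (induction d rule: dec_induct)
    case base
    show ?case by (simp add: s_def)
  next
    case (step d)
    then show ?case
      using \<open>\<And>d. d \<ge> 1 \<Longrightarrow> s d - s (Suc d) = _ d\<close>[of d] stirling_step[of "real d"]
      by (auto simp: add.commute)
  qed
  moreover have "0 \<le> 1 / real d" by simp
  ultimately have "0 \<le> s d" "s d \<le> 1" by linarith+
  then show "(real d + 1/2) * ln (real d) - real d \<le> ln (fact d)"
    "ln (fact d) \<le> (real d + 1/2) * ln (real d) - real d + 1"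
    by (auto simp: s_def)
qed

lemma fact_lower_stirling:
  assumes "d \<ge> 1"
  shows "real d powr (real d + 1/2) * exp (- real d) \<le> fact d"
proof -
  have "ln (real d powr (real d + 1/2) * exp (- real d)) \<le> ln (fact d)"
    using ln_fact_bounds(1)[OF assms] assms by (simp add: ln_mult ln_powr)
  then show ?thesis using assms by (subst (asm) ln_le_cancel_iff) auto
qed

lemma fact_upper_stirling:
  assumes "d \<ge> 1"
  shows "fact d \<le> exp 1 * real d powr (real d + 1/2) * exp (- real d)"
proof -
  have "ln (fact d) \<le> ln (exp 1 * real d powr (real d + 1/2) * exp (- real d))"
    using ln_fact_bounds(2)[OF assms] assms by (simp add: ln_mult ln_powr)
  then show ?thesis using assms by (subst (asm) ln_le_cancel_iff) auto
qed

section \<open>The tree function at its singularity\<close>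

unbundle no vec_syntax
unbundle fps_syntax

text \<open>The exponential generating function of rooted labelled trees, by Cayley's formula.\<close>

definition tree_fps :: "real fps" where
  "tree_fps = Abs_fps (\<lambda>k. if k = 0 then 0 else real k ^ (k - 1) / fact k)"

text \<open>Up to the factor \<open>fact (n - 1)\<close> this is the coefficient of
  \<open>X^(n - 1)\<close> in \<open>(e^X - 1)^n\<close>, a series that starts with
  \<open>X^n\<close>.\<close>

lemma alternating_binomial_power_sum:
  assumes "n \<ge> 2"
  shows "(\<Sum>k\<le>n. real (n choose k) * (-1) ^ (n - k) * real k ^ (n - 1)) = 0"
proof -
  define e :: "real fps" where "e = fps_exp 1"
  have "(e + (-1)) ^ n $ (n - 1) = 0"
    by (rule startsby_zero_power_prefix[rule_format]) (use assms in \<open>auto simp: e_def\<close>)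
  moreover have "(e + (-1)) ^ n = (\<Sum>k\<le>n. of_nat (n choose k) * e ^ k * (-1) ^ (n - k))"
    by (rule binomial_ring)
  moreover have "(of_nat (n choose k) * e ^ k * (-1) ^ (n - k)) $ (n - 1)
      = real (n choose k) * (-1) ^ (n - k) * real k ^ (n - 1) / fact (n - 1)" for k
  proof -
    have "of_nat (n choose k) * e ^ k * (-1) ^ (n - k)
       = fps_const (real (n choose k) * (-1) ^ (n - k)) * fps_exp (real k)"
    proof -
      have "(-1 :: real fps) ^ (n - k) = fps_const ((-1) ^ (n - k))"
        by (metis fps_const_1_eq_1 fps_const_neg fps_const_power)
      then show ?thesis
        by (simp add: e_def fps_exp_power_mult fps_of_nat[symmetric] mult_ac flip: fps_const_mult)
    qed
    then show ?thesis by simp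
  qed
  ultimately have "(\<Sum>k\<le>n. real (n choose k) * (-1) ^ (n - k) * real k ^ (n - 1) / fact (n - 1)) = 0"
    by (simp add: fps_sum_nth)
  then show ?thesis by (simp flip: sum_divide_distrib)
qed

text \<open>This is the equation \<open>T e^(-T) = X\<close> in inverse form. Coefficientwise it is
  the alternating sum above divided by \<open>fact n\<close>, so Lagrange inversion is not
  invoked.\<close>

lemma tree_fps_compose: "tree_fps oo (fps_X * fps_exp (-1)) = fps_X"
proof (rule fps_ext)
  fix n
  define E :: "real fps" where "E = fps_X * fps_exp (-1)"
  have En: "E ^ i $ n = (if n < i then 0 else (-1) ^ (n - i) * real i ^ (n - i) / fact (n - i))" for i
    by (simp add: E_def power_mult_distrib fps_exp_power_mult fps_X_power_mult_nth power_minus')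
  have comp: "(tree_fps oo E) $ n
      = (\<Sum>i=0..n. tree_fps $ i * ((-1) ^ (n - i) * real i ^ (n - i) / fact (n - i)))"
    unfolding fps_compose_nth by (rule sum.cong) (auto simp: En)
  show "(tree_fps oo (fps_X * fps_exp (-1))) $ n = (fps_X :: real fps) $ n"
  proof (cases "n \<ge> 2")
    case True
    have "tree_fps $ i * ((-1) ^ (n - i) * real i ^ (n - i) / fact (n - i))
       = real (n choose i) * (-1) ^ (n - i) * real i ^ (n - 1) / fact n" if "i \<in> {0..n}" for i
    proof (cases "i = 0")
      case True
      with \<open>n \<ge> 2\<close> show ?thesis by (simp add: tree_fps_def)
    next
      case False
      with that have "n - 1 = (i - 1) + (n - i)" by auto
      then have "real i ^ (n - 1) = real i ^ (i - 1) * real i ^ (n - i)" by (metis power_add)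
      moreover have "real (n choose i) = fact n / (fact i * fact (n - i))"
        using that by (simp add: binomial_fact)
      ultimately show ?thesis using False by (simp add: tree_fps_def)
    qed
    then have "(tree_fps oo E) $ n
      = (\<Sum>i=0..n. real (n choose i) * (-1) ^ (n - i) * real i ^ (n - 1) / fact n)"
      unfolding comp by (rule sum.cong[OF refl])
    also have "\<dots> = 0"
      using alternating_binomial_power_sum[OF True] by (simp add: atMost_atLeast0 flip: sum_divide_distrib)
    finally show ?thesis using True by (simp add: E_def fps_X_def)
  next
    case False
    then consider "n = 0" | "n = 1" by linarith
    then show ?thesis
      using comp unfolding E_def[symmetric] by cases (simp_all add: tree_fps_def)
  qed
qed

text \<open>Substituting \<open>E = X e^(-X)\<close> turns \<open>T\<close> into \<open>X\<close>,
  where the equation becomes a direct computation. Composition with a nonzero series without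
  constant term is injective, so the equation can be pulled back.\<close>

lemma tree_fps_diff_eq: "fps_X * fps_deriv tree_fps * (1 - tree_fps) = tree_fps"
proof -
  define E :: "real fps" where "E = fps_X * fps_exp (-1)"
  have E0: "E $ 0 = 0" by (simp add: E_def)
  have "fps_deriv (tree_fps oo E) = (fps_deriv tree_fps oo E) * fps_deriv E"
    by (rule fps_compose_deriv[OF E0])
  then have D: "(fps_deriv tree_fps oo E) * fps_deriv E = 1"
    using tree_fps_compose by (simp add: E_def)
  have dE: "fps_deriv E = (1 - fps_X) * fps_exp (-1)"
    by (simp add: E_def algebra_simps flip: fps_const_neg)
  have "(fps_X * fps_deriv tree_fps * (1 - tree_fps) - tree_fps) oo E
     = E * (fps_deriv tree_fps oo E) * (1 - fps_X) - fps_X"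
    using tree_fps_compose E0
    by (simp add: fps_compose_sub_distrib fps_compose_mult_distrib E_def[symmetric])
  also have "\<dots> = fps_X * ((fps_deriv tree_fps oo E) * fps_deriv E) - fps_X"
    unfolding dE by (simp add: E_def mult_ac)
  also have "\<dots> = 0" by (simp add: D)
  finally have "(fps_X * fps_deriv tree_fps * (1 - tree_fps) - tree_fps) oo E = 0" .
  moreover have "E \<noteq> 0" by (simp add: E_def)
  ultimately have "fps_X * fps_deriv tree_fps * (1 - tree_fps) - tree_fps = 0"
    using fps_compose_eq_0_iff[OF E0, of "fps_X * fps_deriv tree_fps * (1 - tree_fps) - tree_fps"] by auto
  then show ?thesis by simp
qed

text \<open>Dividing \<open>tree_fps\<close> by \<open>X\<close> makes the differential equation regular at \<open>0\<close>, so that \<open>T e^(-T) = y\<close>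
  can be read off a constant function on the whole disc of convergence.\<close>

lemma tree_fps_shift_diff_eq:
  defines "G \<equiv> fps_shift 1 tree_fps"
  shows "fps_deriv G = G * G + fps_X * G * fps_deriv G" "tree_fps = fps_X * G"
proof -
  show T: "tree_fps = fps_X * G"
    unfolding G_def by (rule fps_ext) (auto simp: tree_fps_def)
  have "fps_X * (fps_X * (fps_deriv G - (G * G + fps_X * G * fps_deriv G))) = 0"
    using tree_fps_diff_eq unfolding T by (simp add: algebra_simps)
  then show "fps_deriv G = G * G + fps_X * G * fps_deriv G" by simp
qed

text \<open>Stirling's lower bound for \<open>fact k\<close> gives the decay that makes the series
  converge at the singularity \<open>exp (-1)\<close> itself.\<close>

lemma tree_term_le:
  assumes "k \<ge> 1"
  shows "tree_fps $ k * exp (- real k) \<le> real k powr (-3/2)"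
proof -
  have "real k ^ (k - 1) * exp (- real k) = real k powr (-3/2) * (real k powr (real k + 1/2) * exp (- real k))"
    using assms by (simp add: powr_add[symmetric] powr_realpow[symmetric] of_nat_diff)
  also have "\<dots> \<le> real k powr (-3/2) * fact k"
    by (intro mult_left_mono fact_lower_stirling assms) auto
  finally show ?thesis using assms by (simp add: tree_fps_def divide_le_eq)
qed

lemma tree_fps_nonneg: "tree_fps $ k \<ge> 0"
  by (simp add: tree_fps_def)

lemma summable_tree: "summable (\<lambda>k. tree_fps $ k * exp (-1) ^ k)"
proof (rule summable_comparison_test)
  show "\<exists>N. \<forall>k\<ge>N. norm (tree_fps $ k * exp (-1) ^ k) \<le> real k powr (-3/2)"
    using tree_term_le tree_fps_nonneg
    by (intro exI[of _ 1]) (auto simp: exp_of_nat_mult[symmetric])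
  show "summable (\<lambda>k. real k powr (-3/2))" by (simp add: summable_real_powr_iff)
qed

lemma tree_fps_conv_radius: "fps_conv_radius tree_fps \<ge> exp (-1)"
  unfolding fps_conv_radius_def
  using conv_radius_geI[of "fps_nth tree_fps" "exp (-1)"] summable_tree by simp

lemma eval_tree_fps:
  assumes "0 \<le> y" "y < exp (-1)"
  shows "eval_fps tree_fps y * exp (- eval_fps tree_fps y) = y"
proof -
  define G where "G = fps_shift 1 tree_fps"
  note G_eq = tree_fps_shift_diff_eq[folded G_def]
  have rG: "fps_conv_radius G \<ge> exp (-1)"
    unfolding G_def using tree_fps_conv_radius by simp
  have inr: "ereal (norm z) < fps_conv_radius G" if "\<bar>z\<bar> < exp (-1)" for z :: real
    by (rule less_le_trans[OF _ rG]) (use that in simp)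
  define g g' where "g = eval_fps G" and "g' = eval_fps (fps_deriv G)"
  have dg: "(g has_field_derivative g' z) (at z)" if "\<bar>z\<bar> < exp (-1)" for z
    unfolding g_def g'_def by (rule has_field_derivative_eval_fps) (use inr[OF that] in auto)
  have ode: "g' z = g z * g z + z * g z * g' z" if "\<bar>z\<bar> < exp (-1)" for z
  proof -
    have r: "ereal (norm z) < fps_conv_radius G" "ereal (norm z) < fps_conv_radius (fps_deriv G)"
      using inr[OF that] by (auto intro: less_le_trans fps_conv_radius_deriv)
    have "ereal (norm z) < fps_conv_radius (G * G)" "ereal (norm z) < fps_conv_radius (fps_X * G)"
      using r(1) by (auto intro!: less_le_trans[OF _ fps_conv_radius_mult])
    moreover from this have "ereal (norm z) < fps_conv_radius (fps_X * G * fps_deriv G)"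
      using r(2) by (auto intro!: less_le_trans[OF _ fps_conv_radius_mult])
    moreover have "g' z = eval_fps (G * G + fps_X * G * fps_deriv G) z"
      unfolding g'_def by (simp flip: G_eq(1))
    ultimately show ?thesis using r
      by (simp add: eval_fps_add eval_fps_mult g_def g'_def)
  qed
  \<comment> \<open>The differential equation for \<open>G\<close> says exactly that
    \<open>h\<close> has derivative zero, so \<open>h\<close> keeps the value
    \<open>h 0 = 1\<close>. Multiplied by \<open>z\<close> this reads
    \<open>T e^(-T) = z\<close>.\<close>
  define h where "h z = g z * exp (- (z * g z))" for z
  have dh: "(h has_real_derivative 0) (at z)" if "\<bar>z\<bar> < exp (-1)" for z
  proof -
    have "(h has_real_derivative (g' z * exp (- (z * g z)) + g z * (exp (- (z * g z)) * - (g z + z * g' z)))) (at z)"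
      unfolding h_def by (auto intro!: derivative_eq_intros dg[OF that])
    moreover have "g' z * exp (- (z * g z)) + g z * (exp (- (z * g z)) * - (g z + z * g' z))
       = exp (- (z * g z)) * (g' z - (g z * g z + z * g z * g' z))" by (simp add: algebra_simps)
    ultimately show ?thesis using ode[OF that] by simp
  qed
  have "h y = h 0"
  proof (cases "y = 0")
    case False
    with assms have "0 < y" by simp
    then show ?thesis
    proof (rule DERIV_isconst2)
      show "continuous_on {0..y} h"
        using assms by (auto intro!: DERIV_continuous_on[of _ _ "\<lambda>_. 0"] has_field_derivative_at_within dh)
      show "(h has_real_derivative 0) (at x)" if "0 < x" "x < y" for x
        using dh[of x] that assms by auto
    qed (use \<open>0 < y\<close> in auto)
  qed simp
  also have "h 0 = 1" by (simp add: h_def g_def eval_fps_at_0 G_def tree_fps_def)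
  finally have "h y = 1" .
  moreover have "eval_fps tree_fps y = y * g y"
    unfolding G_eq(2) g_def using inr[of y] assms by (subst eval_fps_mult) auto
  ultimately show ?thesis by (simp add: h_def)
qed

text \<open>\<open>x e^(-x)\<close> has its maximum \<open>e^(-1)\<close> at 1 only. The limit from
  below gives \<open>S \<le> 1\<close>, while \<open>S e^(-S)\<close> is at least every
  \<open>y < exp (-1)\<close>; hence \<open>S = 1\<close>.\<close>

lemma tree_sums: "(\<lambda>k. tree_fps $ k * exp (-1) ^ k) sums 1"
proof -
  define S where "S = (\<Sum>k. tree_fps $ k * exp (-1) ^ k)"
  define F where "F = eval_fps tree_fps"
  have inr: "ereal (norm z) < fps_conv_radius tree_fps" if "\<bar>z\<bar> < exp (-1)" for z :: real
    by (rule less_le_trans[OF _ tree_fps_conv_radius]) (use that in simp)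
  have sums: "(\<lambda>k. tree_fps $ k * y ^ k) sums F y" if "0 \<le> y" "y < exp (-1)" for y
    unfolding F_def using that by (intro sums_eval_fps inr) auto
  \<comment> \<open>A value of at least 1 would by continuity give a point \<open>x \<le> y\<close>
    with \<open>F x = 1\<close>, and then the functional equation would yield
    \<open>x = exp (-1)\<close>.\<close>
  have F1: "F y < 1" if y: "0 \<le> y" "y < exp (-1)" for y
  proof (rule ccontr)
    assume "\<not> F y < 1"
    moreover have "F 0 = 0" by (simp add: F_def eval_fps_at_0 tree_fps_def)
    moreover have "continuous_on {0..y} F"
    proof -
      have "ereal x < fps_conv_radius tree_fps" if "0 \<le> x" "x \<le> y" for x
        using inr[of x] that y by simp
      then show ?thesis
        unfolding F_def by (intro continuous_on_subset[OF continuous_on_eval_fps]) auto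
    qed
    ultimately obtain x where "0 \<le> x" "x \<le> y" "F x = 1"
      using IVT'[of F 0 1 y] y by auto
    then show False using eval_tree_fps[of x] y by (simp add: F_def)
  qed
  have lim: "((\<lambda>y. \<Sum>k<K. tree_fps $ k * y ^ k) \<longlongrightarrow> (\<Sum>k<K. tree_fps $ k * exp (-1) ^ k)) (at_left (exp (-1)))"
    for K by (intro tendsto_intros)
  have ev: "eventually (\<lambda>y. 0 \<le> y \<and> y < exp (-1)) (at_left (exp (-1) :: real))"
    using eventually_at_left_real[of 0 "exp (-1)"] by (auto elim!: eventually_mono)
  have "S \<le> 1" unfolding S_def
  proof (rule suminf_le_const[OF summable_tree])
    fix K
    show "(\<Sum>k<K. tree_fps $ k * exp (-1) ^ k) \<le> 1"
    proof (rule tendsto_upperbound[OF lim])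
      show "\<forall>\<^sub>F y in at_left (exp (-1)). (\<Sum>k<K. tree_fps $ k * y ^ k) \<le> 1"
        using ev
      proof eventually_elim
        case (elim y)
        have "(\<Sum>k<K. tree_fps $ k * y ^ k) \<le> F y"
          using sum_le_suminf[of "\<lambda>k. tree_fps $ k * y ^ k" "{..<K}"] sums[of y] elim tree_fps_nonneg
          by (simp add: sums_iff)
        then show ?case using F1[of y] elim by simp
      qed
    qed simp
  qed
  have "exp (-1) \<le> S * exp (- S)"
  proof (rule dense_le_bounded[of 0])
    fix y :: real assume y: "0 < y" "y < exp (-1)"
    have "F y \<le> S" unfolding S_def
      using sums[of y] summable_tree y tree_fps_nonneg
      by (intro sums_le[OF _ sums summable_sums]) (auto intro!: mult_left_mono power_mono)
    have mono: "F y * exp (- F y) \<le> S * exp (- S)"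
    proof (rule DERIV_nonneg_imp_nondecreasing[OF \<open>F y \<le> S\<close>, of "\<lambda>x. x * exp (- x)"])
      fix x assume "F y \<le> x" "x \<le> S"
      have "((\<lambda>x. x * exp (- x)) has_real_derivative (1 - x) * exp (- x)) (at x)"
        by (auto intro!: derivative_eq_intros simp: algebra_simps)
      then show "\<exists>z. ((\<lambda>x. x * exp (- x)) has_real_derivative z) (at x) \<and> 0 \<le> z"
        using \<open>x \<le> S\<close> \<open>S \<le> 1\<close> by auto
    qed
    then show "y \<le> S * exp (- S)" using eval_tree_fps[of y] y by (simp add: F_def)
  qed simp
  moreover have "S > 0"
  proof (rule ccontr)
    assume "\<not> S > 0"
    then have "S * exp (- S) \<le> 0" by (simp add: mult_nonpos_nonneg)
    with calculation show False by (smt (verit) exp_gt_zero)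
  qed
  \<comment> \<open>In logarithms the inequality reads \<open>S - 1 \<le> ln S\<close>, and the
    tangent line at 1 meets \<open>ln\<close> only there.\<close>
  ultimately have "ln (exp (-1)) \<le> ln (S * exp (- S))" by (subst ln_le_cancel_iff) auto
  then have "S - 1 \<le> ln S" using \<open>S > 0\<close> by (simp add: ln_mult)
  then have "S = 1" using ln_eq_minus_one[OF \<open>S > 0\<close>] ln_le_minus_one[OF \<open>S > 0\<close>] by simp
  then show ?thesis using summable_sums[OF summable_tree] by (simp add: S_def)
qed

text \<open>Unrooted trees, weighted by \<open>e^(-k)\<close>. The truncated exponent at \<open>k = 1\<close> is harmless, because \<open>1 ^ 0 = 1\<close>.\<close>

definition tree_weight :: "nat \<Rightarrow> real" where
  "tree_weight k = (if k = 0 then 0 else real k ^ (k - 2) * exp (- real k) / fact k)"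

lemma tree_weight_nonneg: "tree_weight k \<ge> 0"
  by (simp add: tree_weight_def)

lemma tree_weight_mult: "real k * tree_weight k = tree_fps $ k * exp (-1) ^ k"
proof (cases "k \<le> 1")
  case True
  then have "k = 0 \<or> k = 1" by auto
  then show ?thesis by (auto simp: tree_weight_def tree_fps_def)
next
  case False
  then have "real k ^ (k - 1) = real k * real k ^ (k - 2)"
    by (subst power_Suc[symmetric]) (simp add: Suc_diff_Suc numeral_2_eq_2)
  then show ?thesis using False
    by (simp add: tree_weight_def tree_fps_def exp_of_nat_mult[symmetric])
qed

lemma tree_weight_mult_sums: "(\<lambda>k. real k * tree_weight k) sums 1"
  using tree_sums by (simp add: tree_weight_mult)

lemma fps_X_mult_deriv_nth: "(fps_X * fps_deriv F) $ k = real k * (F :: real fps) $ k"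
  by (cases k) auto

text \<open>Unrooted trees have the series \<open>T - T^2/2\<close>: applying \<open>X d/dX\<close>
  and the differential equation gives \<open>T\<close> back. At \<open>exp (-1)\<close> this equals
  \<open>1 - 1/2\<close>, where the absolutely convergent Cauchy product evaluates the
  square.\<close>

lemma tree_weight_sums: "tree_weight sums (1/2)"
proof -
  define a where "a = (\<lambda>k. tree_fps $ k * exp (-1) ^ k :: real)"
  have ek: "exp (-1) ^ k * exp (real k) = 1" for k
  proof -
    have "exp (-1 :: real) ^ k = exp (- real k)" using exp_of_nat_mult[of k "-1::real"] by simp
    then show ?thesis by (simp flip: exp_add)
  qed
  have U: "tree_fps $ k - (tree_fps * tree_fps) $ k / 2 = tree_weight k * exp (real k)" for k
  proof (cases "k = 0")
    case False
    have "fps_X * fps_deriv (tree_fps - fps_const (1/2) * (tree_fps * tree_fps)) = tree_fps"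
    proof -
      have "fps_const (1/2) * 2 = (1 :: real fps)"
        by (metis fps_const_mult fps_const_1_eq_1 fps_numeral_fps_const divide_eq_1_iff nonzero_divide_mult_cancel_right times_divide_eq_left mult_1 zero_neq_numeral)
      then have "fps_X * fps_deriv tree_fps * (1 - fps_const (1/2) * 2 * tree_fps) = tree_fps"
        using tree_fps_diff_eq by (simp only: mult_1_left)
      moreover have "fps_X * fps_deriv (tree_fps - fps_const (1/2) * (tree_fps * tree_fps))
        = fps_X * fps_deriv tree_fps * (1 - fps_const (1/2) * 2 * tree_fps)"
        by (simp add: algebra_simps)
      ultimately show ?thesis by (simp only:)
    qed
    then have "(fps_X * fps_deriv (tree_fps - fps_const (1/2) * (tree_fps * tree_fps))) $ k = tree_fps $ k" by simp
    then have "real k * (tree_fps $ k - (tree_fps * tree_fps) $ k / 2) = tree_fps $ k"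
      unfolding fps_X_mult_deriv_nth by simp
    also have "\<dots> = real k * (tree_weight k * exp (real k))"
      unfolding mult.assoc[symmetric] tree_weight_mult by (simp add: mult.assoc ek)
    finally show ?thesis using False by simp
  qed (simp add: tree_fps_def tree_weight_def)
  have w: "tree_weight k = a k - (\<Sum>i\<le>k. a i * a (k - i)) / 2" for k
  proof -
    have "(\<Sum>i\<le>k. a i * a (k - i)) = (\<Sum>i\<le>k. tree_fps $ i * tree_fps $ (k - i)) * exp (-1) ^ k"
      unfolding sum_distrib_right a_def
      by (intro sum.cong) (auto simp: mult_ac simp flip: power_add)
    also have "(\<Sum>i\<le>k. tree_fps $ i * tree_fps $ (k - i)) = (tree_fps * tree_fps) $ k"
      by (simp add: fps_mult_nth atMost_atLeast0)
    finally have "a k - (\<Sum>i\<le>k. a i * a (k - i)) / 2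
      = (tree_fps $ k - (tree_fps * tree_fps) $ k / 2) * exp (-1) ^ k"
      by (simp add: a_def algebra_simps)
    then show ?thesis unfolding U by (simp add: mult.assoc ek mult.commute[of "exp (real k)"])
  qed
  have "summable (\<lambda>k. norm (a k))"
    using summable_tree tree_fps_nonneg by (simp add: a_def abs_mult)
  then have "(\<lambda>k. \<Sum>i\<le>k. a i * a (k - i)) sums (suminf a * suminf a)"
    by (intro Cauchy_product_sums)
  moreover have "a sums 1" using tree_sums by (simp add: a_def)
  moreover from this have "suminf a = 1" by (simp add: sums_iff)
  ultimately have "(\<lambda>k. a k - (\<Sum>i\<le>k. a i * a (k - i)) / 2) sums (1 - (1 * 1) / 2)"
    by (intro sums_diff sums_divide) auto
  then show ?thesis by (simp flip: w)
qed

section \<open>Concentration of powers of a power series\<close>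

lemma fps_power_support:
  fixes w :: "nat \<Rightarrow> real"
  assumes "\<And>k. k > M \<Longrightarrow> w k = 0" "N > t * M"
  shows "(Abs_fps w ^ t) $ N = 0"
  using assms(2)
proof (induction t arbitrary: N)
  case (Suc t)
  have "(Abs_fps w ^ t) $ i * w (N - i) = 0" if "i \<in> {0..N}" for i
  proof (cases "i > t * M")
    case False
    then have "N - i > M" using Suc.prems by simp
    then show ?thesis using assms(1) by simp
  qed (simp add: Suc.IH)
  then show ?case unfolding power_Suc2 fps_mult_nth by (intro sum.neutral) auto
qed auto

lemma fps_power_nonneg:
  fixes w :: "nat \<Rightarrow> real"
  assumes "\<And>k. w k \<ge> 0"
  shows "(Abs_fps w ^ t) $ N \<ge> 0"
proof (induction t arbitrary: N)
  case (Suc t)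
  then show ?case unfolding power_Suc2 using assms by (auto simp: fps_mult_nth intro!: sum_nonneg)
qed auto

lemma fps_power_mono:
  fixes w u :: "nat \<Rightarrow> real"
  assumes "\<And>k. w k \<ge> 0" "\<And>k. w k \<le> u k"
  shows "(Abs_fps w ^ t) $ N \<le> (Abs_fps u ^ t) $ N"
proof (induction t arbitrary: N)
  case (Suc t)
  have "u k \<ge> 0" for k using assms[of k] by linarith
  then show ?case unfolding power_Suc2 using assms Suc fps_power_nonneg
    by (auto simp: fps_mult_nth intro!: sum_mono mult_mono)
qed auto

lemma fps_mult_sum_weighted:
  fixes p q :: "real fps" and h :: "nat \<Rightarrow> real"
  assumes "\<And>i. i > L \<Longrightarrow> p $ i = 0" "\<And>k. k > M \<Longrightarrow> q $ k = 0"
  shows "(\<Sum>N\<le>L + M. h N * (p * q) $ N) = (\<Sum>i\<le>L. \<Sum>k\<le>M. h (i + k) * (p $ i * q $ k))"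
proof -
  define S where "S = {..L} \<times> {..M}"
  define f where "f = (\<lambda>(i, k). h (i + k) * (p $ i * q $ k))"
  have "(\<Sum>i\<le>L. \<Sum>k\<le>M. h (i + k) * (p $ i * q $ k)) = sum f S"
    by (simp add: S_def f_def sum.cartesian_product)
  also have "\<dots> = (\<Sum>N\<le>L + M. sum f {x \<in> S. (case x of (i, k) \<Rightarrow> i + k) = N})"
    by (rule sum.group[symmetric]) (auto simp: S_def)
  also have "\<dots> = (\<Sum>N\<le>L + M. h N * (p * q) $ N)"
  proof (rule sum.cong[OF refl])
    fix N
    let ?A = "{x \<in> S. (case x of (i, k) \<Rightarrow> i + k) = N}"
    have "sum f ?A = (\<Sum>x\<in>(\<lambda>i. (i, N - i)) ` {0..N}. f x)"
    proof (rule sum.mono_neutral_left)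
      show "?A \<subseteq> (\<lambda>i. (i, N - i)) ` {0..N}" by (auto simp: S_def image_iff)
      show "\<forall>x\<in>(\<lambda>i. (i, N - i)) ` {0..N} - ?A. f x = 0"
        using assms by (auto simp: S_def f_def) (metis not_le)+
    qed auto
    also have "\<dots> = (\<Sum>i=0..N. f (i, N - i))" by (subst sum.reindex) (auto simp: inj_on_def)
    also have "\<dots> = h N * (p * q) $ N" by (simp add: f_def fps_mult_nth sum_distrib_left)
    finally show "sum f ?A = h N * (p * q) $ N" .
  qed
  finally show ?thesis by simp
qed

text \<open>\<open>w\<close> is an unnormalised distribution with mass \<open>\<beta>\<close> and
  mean \<open>\<mu>\<close>, and its \<open>t\<close>-th power is the law of a sum of
  \<open>t\<close> independent copies, so centred first moments stay zero and variances add. The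
  third claim carries a factor \<open>\<beta>\<close> to avoid the exponent
  \<open>t - 1\<close>.\<close>

lemma fps_power_total_variance:
  fixes w :: "nat \<Rightarrow> real"
  assumes supp: "\<And>k. k > M \<Longrightarrow> w k = 0"
    and mu: "(\<Sum>k\<le>M. (real k - \<mu>) * w k) = 0"
  defines "\<beta> \<equiv> (\<Sum>k\<le>M. w k)"
  shows "(\<Sum>N\<le>t * M. (Abs_fps w ^ t) $ N) = \<beta> ^ t"
    and "(\<Sum>N\<le>t * M. (real N - real t * \<mu>) * (Abs_fps w ^ t) $ N) = 0"
    and "\<beta> * (\<Sum>N\<le>t * M. (real N - real t * \<mu>)\<^sup>2 * (Abs_fps w ^ t) $ N)
           = real t * \<beta> ^ t * (\<Sum>k\<le>M. (real k - \<mu>)\<^sup>2 * w k)"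
proof (induction t)
  case 0
  {
    case 1 then show ?case by simp
  next
    case 2 then show ?case by simp
  next
    case 3 then show ?case by simp
  }
next
  case (Suc t)
  define P where "P = Abs_fps w ^ t"
  define V where "V = (\<Sum>k\<le>M. (real k - \<mu>)\<^sup>2 * w k)"
  have P0: "P $ i = 0" if "i > t * M" for i
    unfolding P_def using fps_power_support[OF supp that] by simp
  have conv: "(\<Sum>N\<le>Suc t * M. h N * (Abs_fps w ^ Suc t) $ N) = (\<Sum>i\<le>t * M. \<Sum>k\<le>M. h (i + k) * (P $ i * w k))"
    for h :: "nat \<Rightarrow> real"
    using fps_mult_sum_weighted[of "t * M" P M "Abs_fps w" h] P0 supp
    by (simp add: P_def power_commutes add.commute)
  note IH = Suc.IH[folded P_def]
  {
    case 1
    have "(\<Sum>N\<le>Suc t * M. (Abs_fps w ^ Suc t) $ N) = (\<Sum>i\<le>t * M. P $ i) * \<beta>"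
      using conv[of "\<lambda>_. 1"] by (simp add: \<beta>_def sum_product)
    then show ?case using IH(1) by simp
  next
    case 2
    have "(\<Sum>N\<le>Suc t * M. (real N - real (Suc t) * \<mu>) * (Abs_fps w ^ Suc t) $ N)
      = (\<Sum>i\<le>t * M. \<Sum>k\<le>M. ((real i - real t * \<mu>) * P $ i) * w k + P $ i * ((real k - \<mu>) * w k))"
      unfolding conv by (intro sum.cong) (auto simp: algebra_simps)
    also have "\<dots> = (\<Sum>i\<le>t * M. (real i - real t * \<mu>) * P $ i) * \<beta>
        + (\<Sum>i\<le>t * M. P $ i) * (\<Sum>k\<le>M. (real k - \<mu>) * w k)"
      by (simp add: sum.distrib sum_product \<beta>_def)
    finally show ?case using IH(2) mu by simp
  next
    case 3
    \<comment> \<open>The middle summand is the covariance of the old sum and the new term; it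
      vanishes since the first moment of \<open>w\<close> is centred.\<close>
    have "(\<Sum>N\<le>Suc t * M. (real N - real (Suc t) * \<mu>)\<^sup>2 * (Abs_fps w ^ Suc t) $ N)
      = (\<Sum>i\<le>t * M. \<Sum>k\<le>M. ((real i - real t * \<mu>)\<^sup>2 * P $ i) * w k
          + 2 * (((real i - real t * \<mu>) * P $ i) * ((real k - \<mu>) * w k))
          + P $ i * ((real k - \<mu>)\<^sup>2 * w k))"
      unfolding conv by (intro sum.cong) (auto simp: algebra_simps power2_eq_square)
    also have "\<dots> = (\<Sum>i\<le>t * M. (real i - real t * \<mu>)\<^sup>2 * P $ i) * \<beta>
        + 2 * ((\<Sum>i\<le>t * M. (real i - real t * \<mu>) * P $ i) * (\<Sum>k\<le>M. (real k - \<mu>) * w k))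
        + (\<Sum>i\<le>t * M. P $ i) * V"
      unfolding sum.distrib sum_product \<beta>_def V_def by (simp add: sum_distrib_left)
    finally have "(\<Sum>N\<le>Suc t * M. (real N - real (Suc t) * \<mu>)\<^sup>2 * (Abs_fps w ^ Suc t) $ N)
      = \<beta> * (\<Sum>i\<le>t * M. (real i - real t * \<mu>)\<^sup>2 * P $ i) + \<beta> ^ t * V"
      using mu IH(1) by simp
    then have "\<beta> * (\<Sum>N\<le>Suc t * M. (real N - real (Suc t) * \<mu>)\<^sup>2 * (Abs_fps w ^ Suc t) $ N)
      = \<beta> * (\<beta> * (\<Sum>i\<le>t * M. (real i - real t * \<mu>)\<^sup>2 * P $ i)) + \<beta> * (\<beta> ^ t * V)"
      by (simp add: algebra_simps)
    also have "\<dots> = \<beta> * (real t * \<beta> ^ t * V) + \<beta> * (\<beta> ^ t * V)" using IH(3) by (simp add: V_def)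
    also have "\<dots> = real (Suc t) * \<beta> ^ Suc t * V" by (simp add: algebra_simps)
    finally show ?case by (simp add: V_def)
  }
qed

lemma fps_power_chebyshev:
  fixes w :: "nat \<Rightarrow> real"
  assumes supp: "\<And>k. k > M \<Longrightarrow> w k = 0" and nn: "\<And>k. w k \<ge> 0"
    and mu: "(\<Sum>k\<le>M. (real k - \<mu>) * w k) = 0"
    and beta: "\<beta> = (\<Sum>k\<le>M. w k)" "\<beta> > 0"
    and V: "(\<Sum>k\<le>M. (real k - \<mu>)\<^sup>2 * w k) \<le> V" and a: "a > 0"
  shows "(\<Sum>N | N \<le> t * M \<and> \<bar>real N - real t * \<mu>\<bar> \<le> a. (Abs_fps w ^ t) $ N)
           \<ge> \<beta> ^ t * (1 - real t * V / (\<beta> * a\<^sup>2))"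
proof -
  define P where "P = Abs_fps w ^ t"
  have Pnn: "P $ N \<ge> 0" for N unfolding P_def by (rule fps_power_nonneg[OF nn])
  note tv = fps_power_total_variance[OF supp mu, of t, folded beta(1) P_def]
  let ?A = "{N. N \<le> t * M \<and> \<bar>real N - real t * \<mu>\<bar> \<le> a}"
  let ?B = "{N. N \<le> t * M \<and> \<bar>real N - real t * \<mu>\<bar> > a}"
  have "a\<^sup>2 * sum (fps_nth P) ?B = (\<Sum>N\<in>?B. a\<^sup>2 * P $ N)" by (simp add: sum_distrib_left)
  also have "\<dots> \<le> (\<Sum>N\<in>?B. (real N - real t * \<mu>)\<^sup>2 * P $ N)"
  proof (rule sum_mono)
    fix N assume "N \<in> ?B"
    then have "a\<^sup>2 \<le> \<bar>real N - real t * \<mu>\<bar>\<^sup>2" using a by (intro power_mono) auto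
    then show "a\<^sup>2 * P $ N \<le> (real N - real t * \<mu>)\<^sup>2 * P $ N"
      using Pnn by (intro mult_right_mono) auto
  qed
  also have "\<dots> \<le> (\<Sum>N\<le>t * M. (real N - real t * \<mu>)\<^sup>2 * P $ N)"
    by (rule sum_mono2) (auto intro!: Pnn mult_nonneg_nonneg)
  also have "\<dots> = real t * \<beta> ^ t * (\<Sum>k\<le>M. (real k - \<mu>)\<^sup>2 * w k) / \<beta>"
    using tv(3) beta(2) by (simp add: field_simps)
  also have "\<dots> \<le> real t * \<beta> ^ t * V / \<beta>"
    using V beta(2) by (intro divide_right_mono mult_left_mono) auto
  finally have "sum (fps_nth P) ?B \<le> real t * \<beta> ^ t * V / \<beta> / a\<^sup>2"
    using a by (subst pos_le_divide_eq) (auto simp: mult.commute)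
  moreover have "\<beta> ^ t = sum (fps_nth P) ?A + sum (fps_nth P) ?B"
  proof -
    have "{..t * M} = ?A \<union> ?B" by auto
    then have "sum (fps_nth P) {..t * M} = sum (fps_nth P) ?A + sum (fps_nth P) ?B"
      by (simp only:) (subst sum.union_disjoint, auto)
    then show ?thesis using tv(1) by simp
  qed
  moreover have "\<beta> ^ t - real t * \<beta> ^ t * V / \<beta> / a\<^sup>2 = \<beta> ^ t * (1 - real t * V / (\<beta> * a\<^sup>2))"
    by (simp add: algebra_simps)
  ultimately show ?thesis unfolding P_def by linarith
qed

section \<open>Tree weights truncated at size \<open>M\<close>\<close>

lemma tree_weight_mult_le: "k \<ge> 1 \<Longrightarrow> real k * tree_weight k \<le> real k powr (-3/2)"
  using tree_term_le[of k] exp_of_nat_mult[of k "-1::real"] by (simp add: tree_weight_mult)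

text \<open>A discrete form of integrating \<open>y^(-3/2)\<close>; the right-hand side telescopes
  over the tail.\<close>

lemma powr_neg_three_halves: 
  assumes "k \<ge> 1"
  shows "real (Suc k) powr (-3/2) \<le> 2 / sqrt (real k) - 2 / sqrt (real (Suc k))"
proof -
  define x y where "x = sqrt (real k)" and "y = sqrt (real (Suc k))"
  have xy: "0 < x" "x \<le> y" using assms by (auto simp: x_def y_def)
  have d: "y * y - x * x = 1" by (simp add: x_def y_def)
  have "real (Suc k) powr (-3/2) = 1 / y ^ 3"
  proof -
    have "y ^ 3 = real (Suc k) powr (3/2)"
      by (simp add: y_def powr_half_sqrt[symmetric] powr_powr flip: powr_realpow)
    then show ?thesis by (simp add: powr_minus_divide)
  qed
  also have "\<dots> \<le> 2 / (x * y * (x + y))"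
  proof -
    have "x * y * (x + y) \<le> y * y * (y + y)" using xy by (intro mult_mono) auto
    also have "\<dots> = 2 * y ^ 3" by (simp add: power3_eq_cube)
    finally have "x * y * (x + y) \<le> 2 * y ^ 3" .
    moreover have "x * y * (x + y) > 0" "y ^ 3 > 0" using xy by auto
    ultimately show ?thesis by (simp add: divide_simps)
  qed
  also have "\<dots> = 2 / x - 2 / y"
  proof -
    have "2 / x - 2 / y = 2 * (y - x) / (x * y)" using xy by (simp add: field_simps)
    also have "\<dots> = 2 * ((y - x) * (x + y)) / (x * y * (x + y))" using xy by simp
    also have "(y - x) * (x + y) = 1" using d by (simp add: algebra_simps)
    finally show ?thesis by simp
  qed
  finally show ?thesis by (simp add: x_def y_def)
qed

text \<open>The size-weighted tail is compared with a telescoping series. Beyond \<open>M\<close> a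
  weight is at most \<open>1/M\<close> times its size-weighted version, which gives the second bound
  from the first.\<close>

lemma tree_weight_tail:
  assumes "M \<ge> 1"
  shows "1 - (\<Sum>k\<le>M. real k * tree_weight k) \<le> 2 / sqrt (real M)"
    and "1/2 - (\<Sum>k\<le>M. tree_weight k) \<le> 2 / (real M * sqrt (real M))"
    and "0 \<le> 1/2 - (\<Sum>k\<le>M. tree_weight k)"
proof -
  define f where "f = (\<lambda>i. 2 / sqrt (real (i + M)))"
  have "f \<longlonglongrightarrow> 0"
  proof -
    have "filterlim (\<lambda>i. sqrt (real (i + M))) at_top sequentially"
      by (intro filterlim_compose[OF sqrt_at_top] filterlim_compose[OF filterlim_real_sequentially]
          filterlim_add_const_nat_at_top)
    then show ?thesis unfolding f_def by (intro tendsto_divide_0[OF tendsto_const] filterlim_at_top_imp_at_infinity)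
  qed
  then have tel: "(\<lambda>i. f i - f (Suc i)) sums (f 0 - 0)" by (rule telescope_sums')
  have s1: "(\<lambda>i. real (i + Suc M) * tree_weight (i + Suc M)) sums (1 - (\<Sum>k<Suc M. real k * tree_weight k))"
    by (rule sums_split_initial_segment[OF tree_weight_mult_sums])
  have s2: "(\<lambda>i. tree_weight (i + Suc M)) sums (1/2 - (\<Sum>k<Suc M. tree_weight k))"
    by (rule sums_split_initial_segment[OF tree_weight_sums])
  have "real (i + Suc M) * tree_weight (i + Suc M) \<le> f i - f (Suc i)" for i
    using tree_weight_mult_le[of "i + Suc M"] powr_neg_three_halves[of "i + M"] assms
    by (simp add: f_def add_ac)
  then have t1: "1 - (\<Sum>k<Suc M. real k * tree_weight k) \<le> f 0"
    using sums_le[OF _ s1 tel] by simp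
  then show "1 - (\<Sum>k\<le>M. real k * tree_weight k) \<le> 2 / sqrt (real M)"
    by (simp add: f_def lessThan_Suc_atMost)
  have "tree_weight (i + Suc M) \<le> (real (i + Suc M) * tree_weight (i + Suc M)) / real M" for i
  proof -
    have "tree_weight (i + Suc M) * real M \<le> tree_weight (i + Suc M) * real (i + Suc M)"
      using tree_weight_nonneg by (intro mult_left_mono) auto
    then show ?thesis using assms by (simp add: field_simps)
  qed
  then have "1/2 - (\<Sum>k<Suc M. tree_weight k) \<le> (1 - (\<Sum>k<Suc M. real k * tree_weight k)) / real M"
    by (intro sums_le[OF _ s2 sums_divide[OF s1]])
  also have "\<dots> \<le> f 0 / real M" by (intro divide_right_mono t1) auto
  finally show "1/2 - (\<Sum>k\<le>M. tree_weight k) \<le> 2 / (real M * sqrt (real M))"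
    by (simp add: f_def lessThan_Suc_atMost mult_ac)
  show "0 \<le> 1/2 - (\<Sum>k\<le>M. tree_weight k)"
    using sums_le[OF _ sums_zero s2] tree_weight_nonneg by (simp add: lessThan_Suc_atMost)
qed

text \<open>Over all sizes the sum is \<open>1 - 2 * (1/2) = 0\<close>, and cutting at
  \<open>M \<ge> 2\<close> removes only nonnegative terms. So truncation can only lower the
  mean.\<close>

lemma tree_weight_mean_le:
  assumes "M \<ge> 2"
  shows "(\<Sum>k\<le>M. (real k - 2) * tree_weight k) \<le> 0"
proof -
  have "(\<lambda>k. real k * tree_weight k - 2 * tree_weight k) sums (1 - 2 * (1/2))"
    by (intro sums_diff sums_mult tree_weight_mult_sums tree_weight_sums)
  then have s: "(\<lambda>k. (real k - 2) * tree_weight k) sums 0" by (simp add: algebra_simps)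
  have "0 \<le> 0 - (\<Sum>k<Suc M. (real k - 2) * tree_weight k)"
    by (rule sums_le[OF _ sums_zero sums_split_initial_segment[OF s]])
      (use assms tree_weight_nonneg in auto)
  then show ?thesis by (simp add: lessThan_Suc_atMost)
qed

text \<open>The terms are at most \<open>k^(-1/2)\<close>, which sums to order
  \<open>sqrt M\<close>.\<close>

lemma tree_weight_second_moment: "(\<Sum>k\<le>M. (real k)\<^sup>2 * tree_weight k) \<le> 2 * sqrt (real M)"
proof (induction M)
  case (Suc M)
  have "(real (Suc M))\<^sup>2 * tree_weight (Suc M) \<le> real (Suc M) * real (Suc M) powr (-3/2)"
    unfolding power2_eq_square mult.assoc by (intro mult_left_mono tree_weight_mult_le) auto
  also have "\<dots> = 1 / sqrt (real (Suc M))"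
  proof -
    have "real (Suc M) * real (Suc M) powr (-3/2) = real (Suc M) powr (-(1/2))"
      by (subst powr_mult_base) auto
    then show ?thesis by (simp add: powr_minus_divide powr_half_sqrt)
  qed
  also have "\<dots> \<le> 2 * (sqrt (real (Suc M)) - sqrt (real M))"
  proof -
    define x y where "x = sqrt (real M)" and "y = sqrt (real (Suc M))"
    have xy: "0 \<le> x" "x \<le> y" "0 < y" by (auto simp: x_def y_def)
    have d: "y * y - x * x = 1" by (simp add: x_def y_def)
    have "1 = (y - x) * (y + x)" using d by (simp add: algebra_simps)
    also have "\<dots> \<le> (y - x) * (2 * y)" using xy by (intro mult_left_mono) auto
    finally have "1 / y \<le> 2 * (y - x)" using xy by (simp add: field_simps)
    then show ?thesis by (simp only: x_def y_def)
  qed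
  finally show ?case using Suc by simp
qed (simp add: tree_weight_def)


lemma exp_le_one_minus:
  fixes y :: real
  assumes "0 \<le> y" "y \<le> 1/2"
  shows "exp (- 2 * y) \<le> 1 - y"
proof -
  have "1 \<le> 1 + y * (1 - 2 * y)" using assms by simp
  also have "\<dots> = (1 - y) * (1 + 2 * y)" by (simp add: algebra_simps)
  also have "\<dots> \<le> (1 - y) * exp (2 * y)" using assms by (intro mult_left_mono) auto
  finally show ?thesis by (simp add: exp_minus field_simps)
qed

text \<open>\<open>x\<close> stands for \<open>n^(1/3)\<close>. Chebyshev's inequality leaves the
  factor \<open>2/3\<close>, and the mass lost by truncation costs \<open>exp (-12)\<close>. The
  window reaches further down than up because the truncated mean may fall below 2 by
  \<open>6/x\<close>, which moves the centre down by up to \<open>3 x^2\<close>.\<close>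

lemma tree_weight_power_mass:
  fixes x :: real
  assumes x: "x \<ge> 4" and t: "real t \<le> x ^ 3 / 2"
  shows "(\<Sum>N\<in>{N. 2 * real t - 6 * x\<^sup>2 \<le> real N \<and> real N \<le> 2 * real t + 3 * x\<^sup>2}.
            (Abs_fps tree_weight ^ t) $ N) \<ge> exp (-12) * (2/3) * (1/2) ^ t"
proof -
  define M where "M = nat \<lfloor>x\<^sup>2\<rfloor>"
  have x2: "x\<^sup>2 \<ge> 16" using power_mono[OF x, of 2] by simp
  have Mle: "real M \<le> x\<^sup>2" unfolding M_def using x2 by simp
  have Mge: "real M \<ge> x\<^sup>2 / 2" unfolding M_def using x2 by linarith
  have M2: "M \<ge> 2" using Mge x2 by linarith
  have sM: "sqrt (real M) \<le> x" using Mle x by (intro real_le_lsqrt) auto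
  \<comment> \<open>\<open>7/10\<close> is a rational lower bound for
    \<open>1 / sqrt 2\<close>.\<close>
  have sM': "sqrt (real M) \<ge> 7/10 * x"
    using Mge x by (intro real_le_rsqrt) (auto simp: power_mult_distrib power2_eq_square)
  define w where "w = (\<lambda>k. if k \<le> M then tree_weight k else 0)"
  define \<beta> where "\<beta> = (\<Sum>k\<le>M. w k)"
  define \<mu> where "\<mu> = (\<Sum>k\<le>M. real k * w k) / \<beta>"
  have wsum: "(\<Sum>k\<le>M. h k * w k) = (\<Sum>k\<le>M. h k * tree_weight k)" for h
    by (rule sum.cong) (auto simp: w_def)
  have wn: "w k \<ge> 0" "w k \<le> tree_weight k" for k by (auto simp: w_def tree_weight_nonneg)
  have \<beta>: "\<beta> = (\<Sum>k\<le>M. tree_weight k)" using wsum[of "\<lambda>_. 1"] by (simp add: \<beta>_def)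
  have b_up: "\<beta> \<le> 1/2" using tree_weight_tail(3)[of M] M2 by (simp add: \<beta>)
  have b_lo: "\<beta> \<ge> 1/2 - 6 / x ^ 3"
  proof -
    have "x\<^sup>2 / 2 * (7/10 * x) \<le> real M * sqrt (real M)"
      using Mge sM' x by (intro mult_mono) auto
    then have "2 / (real M * sqrt (real M)) \<le> 2 / (x\<^sup>2 / 2 * (7/10 * x))"
      using x M2 by (intro divide_left_mono mult_pos_pos) auto
    also have "\<dots> \<le> 6 / x ^ 3" using x by (simp add: power2_eq_square power3_eq_cube field_simps)
    finally show ?thesis using tree_weight_tail(2)[of M] M2 by (simp add: \<beta>)
  qed
  have x3: "x ^ 3 \<ge> 64" using power_mono[OF x, of 3] by simp
  then have "6 / x ^ 3 \<le> 6 / 64" using x by (intro divide_left_mono) auto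
  then have b3: "\<beta> \<ge> 1/3" using b_lo by simp
  have mu_eq: "\<mu> * \<beta> = (\<Sum>k\<le>M. real k * w k)" using b3 by (simp add: \<mu>_def)
  have mu0: "(\<Sum>k\<le>M. (real k - \<mu>) * w k) = 0"
    using mu_eq by (simp add: left_diff_distrib sum_subtractf \<beta>_def sum_distrib_left)
  have "\<mu> * \<beta> \<le> 2 * \<beta>"
    using tree_weight_mean_le[OF M2] unfolding mu_eq wsum
    by (simp add: left_diff_distrib sum_subtractf \<beta> sum_distrib_left)
  then have mu2: "\<mu> \<le> 2" using b3 by simp
  have mu_lo: "\<mu> \<ge> 2 - 6 / x"
  proof -
    have "1 - 2 / sqrt (real M) \<le> \<mu> * \<beta>"
      using tree_weight_tail(1)[of M] M2 unfolding mu_eq wsum by simp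
    also have "\<dots> \<le> \<mu> * (1/2)"
      using b_up b3 by (intro mult_left_mono) (auto simp: \<mu>_def wn intro!: sum_nonneg divide_nonneg_nonneg)
    finally have "\<mu> \<ge> 2 - 4 / sqrt (real M)" by simp
    moreover have "4 / sqrt (real M) \<le> 4 / (7/10 * x)"
      using sM' x M2 by (intro divide_left_mono mult_pos_pos) auto
    moreover have "4 / (7/10 * x) \<le> 6 / x" using x by (simp add: field_simps)
    ultimately show ?thesis by linarith
  qed
  have V: "(\<Sum>k\<le>M. (real k - \<mu>)\<^sup>2 * w k) \<le> 2 * x"
  proof -
    have "(\<Sum>k\<le>M. (real k - \<mu>)\<^sup>2 * w k)
        = (\<Sum>k\<le>M. (real k)\<^sup>2 * w k) - 2 * \<mu> * (\<Sum>k\<le>M. real k * w k) + \<mu>\<^sup>2 * \<beta>"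
      unfolding \<beta>_def sum_distrib_left sum_subtractf[symmetric] sum.distrib[symmetric]
      by (rule sum.cong) (auto simp: power2_eq_square algebra_simps)
    also have "\<dots> = (\<Sum>k\<le>M. (real k)\<^sup>2 * w k) - \<mu>\<^sup>2 * \<beta>"
      unfolding mu_eq[symmetric] by (simp add: power2_eq_square)
    also have "\<dots> \<le> (\<Sum>k\<le>M. (real k)\<^sup>2 * w k)" using b3 by simp
    also have "\<dots> \<le> 2 * x" unfolding wsum using tree_weight_second_moment[of M] sM by linarith
    finally show ?thesis .
  qed
  let ?A = "{N. N \<le> t * M \<and> \<bar>real N - real t * \<mu>\<bar> \<le> 3 * x\<^sup>2}"
  let ?B = "{N. 2 * real t - 6 * x\<^sup>2 \<le> real N \<and> real N \<le> 2 * real t + 3 * x\<^sup>2}"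
  have "\<beta> ^ t * (2/3) \<le> \<beta> ^ t * (1 - real t * (2 * x) / (\<beta> * (3 * x\<^sup>2)\<^sup>2))"
  proof (rule mult_left_mono)
    \<comment> \<open>The radius \<open>3 x^2\<close> is chosen to make this quotient at most
      \<open>x^4 / (3 x^4)\<close>.\<close>
    have "real t * (2 * x) / (\<beta> * (3 * x\<^sup>2)\<^sup>2) \<le> (x ^ 3 / 2) * (2 * x) / ((1/3) * (3 * x\<^sup>2)\<^sup>2)"
      using t b3 x by (intro frac_le mult_mono mult_pos_pos) auto
    also have "\<dots> = 1/3" using x by (simp add: power2_eq_square power3_eq_cube field_simps)
    finally show "2/3 \<le> 1 - real t * (2 * x) / (\<beta> * (3 * x\<^sup>2)\<^sup>2)" by simp
  qed (use b3 in auto)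
  also have "\<dots> \<le> (\<Sum>N\<in>?A. (Abs_fps w ^ t) $ N)"
    by (rule fps_power_chebyshev[OF _ wn(1) mu0 \<beta>_def _ V]) (use b3 x in \<open>auto simp: w_def\<close>)
  also have "\<dots> \<le> (\<Sum>N\<in>?A. (Abs_fps tree_weight ^ t) $ N)"
    by (intro sum_mono fps_power_mono wn)
  also have "\<dots> \<le> (\<Sum>N\<in>?B. (Abs_fps tree_weight ^ t) $ N)"
  proof (rule sum_mono2)
    have "?B \<subseteq> {..nat \<lceil>2 * real t + 3 * x\<^sup>2\<rceil>}" by (auto simp: le_nat_iff) linarith
    then show "finite ?B" using finite_subset by blast
    show "?A \<subseteq> ?B"
    proof
      fix N assume "N \<in> ?A"
      then have N: "\<bar>real N - real t * \<mu>\<bar> \<le> 3 * x\<^sup>2" by simp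
      have "real t * \<mu> \<le> real t * 2" using mu2 by (intro mult_left_mono) auto
      moreover have "real t * (2 - 6 / x) \<le> real t * \<mu>" using mu_lo by (intro mult_left_mono) auto
      moreover have "real t * (6 / x) \<le> x ^ 3 / 2 * (6 / x)" using t x by (intro mult_right_mono) auto
      moreover have "x ^ 3 / 2 * (6 / x) = 3 * x\<^sup>2" using x by (simp add: power2_eq_square power3_eq_cube)
      ultimately have "2 * real t - 3 * x\<^sup>2 \<le> real t * \<mu>" "real t * \<mu> \<le> 2 * real t"
        by (simp_all add: algebra_simps)
      then show "N \<in> ?B" using N by auto
    qed
  qed (auto intro: fps_power_nonneg tree_weight_nonneg)
  finally have main: "\<beta> ^ t * (2/3) \<le> (\<Sum>N\<in>?B. (Abs_fps tree_weight ^ t) $ N)" .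
  \<comment> \<open>Each factor \<open>2 \<beta>\<close> is at least
    \<open>1 - 12 / x^3 \<ge> exp (- 24 / x^3)\<close>, and there are at most \<open>x^3 / 2\<close>
    of them.\<close>
  have "exp (-12) * (1/2) ^ t \<le> \<beta> ^ t"
  proof -
    have y: "0 \<le> 12 / x ^ 3" "12 / x ^ 3 \<le> 1/2" using x x3 by (auto simp: field_simps)
    have "exp (-12) \<le> exp (real t * (-2 * (12 / x ^ 3)))"
    proof -
      have "real t * (2 * (12 / x ^ 3)) \<le> x ^ 3 / 2 * (2 * (12 / x ^ 3))"
        using t x by (intro mult_right_mono) auto
      also have "\<dots> = 12" using x by simp
      finally show ?thesis by simp
    qed
    also have "\<dots> = exp (-2 * (12 / x ^ 3)) ^ t" by (rule exp_of_nat_mult)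
    also have "\<dots> \<le> (1 - 12 / x ^ 3) ^ t" by (intro power_mono exp_le_one_minus y) auto
    also have "\<dots> \<le> (2 * \<beta>) ^ t" using b_lo y by (intro power_mono) auto
    finally show ?thesis by (simp add: power_mult_distrib power_divide field_simps)
  qed
  then have "exp (-12) * (1/2) ^ t * (2/3) \<le> \<beta> ^ t * (2/3)" by (intro mult_right_mono) auto
  moreover have "exp (-12) * (1/2) ^ t * (2/3) = exp (-12) * (2/3) * (1/2 :: real) ^ t" by simp
  ultimately show ?thesis using main by linarith
qed

section \<open>Counting forests\<close>

text \<open>The forests on \<open>S\<close> with root set \<open>R\<close>, built level by level: \<open>I\<close> is the set of children of the
  roots and \<open>g\<close> assigns the parents.\<close>

inductive rooted_forest :: "'a set \<Rightarrow> 'a set \<Rightarrow> 'a set set \<Rightarrow> bool" where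
  roots: "rooted_forest R R {}"
| level: "rooted_forest S I E \<Longrightarrow> R \<inter> S = {} \<Longrightarrow> g ` I \<subseteq> R
    \<Longrightarrow> rooted_forest (R \<union> S) R (E \<union> (\<lambda>i. {i, g i}) ` I)"

lemma rooted_forest_roots_subset: "rooted_forest S R E \<Longrightarrow> R \<subseteq> S"
  by (induction rule: rooted_forest.induct) auto

lemma rooted_forest_edges:
  assumes "rooted_forest S R E"
  shows "simple_graph S E"
  using assms
proof (induction rule: rooted_forest.induct)
  case (level S I E R g)
  have "card {i, g i} = 2" "{i, g i} \<subseteq> R \<union> S" if "i \<in> I" for i
  proof -
    have "i \<in> S" "g i \<in> R" using level.hyps that rooted_forest_roots_subset[OF level.hyps(1)] by auto
    moreover from this have "i \<noteq> g i" using level.hyps(2) by auto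
    ultimately show "card {i, g i} = 2" "{i, g i} \<subseteq> R \<union> S" by auto
  qed
  then show ?case using level.IH unfolding simple_graph_def by blast
qed (simp add: simple_graph_def)

text \<open>Every vertex is joined to a root by a path. Stated through sets closed under edges, this
  recovers the vertex set of a piece from the edges alone in the injectivity proofs below.\<close>

lemma rooted_forest_connected:
  assumes "rooted_forest S R E" "R \<subseteq> A" "\<And>e. e \<in> E \<Longrightarrow> e \<inter> A \<noteq> {} \<Longrightarrow> e \<subseteq> A"
  shows "S \<subseteq> A"
  using assms
proof (induction rule: rooted_forest.induct)
  case (level S I E R g)
  have "I \<subseteq> A" using level.hyps level.prems(1) level.prems(2)[of "{i, g i}" for i] by blast
  then show ?case using level by blast
qed

lemma finite_edge_sets:
  assumes "finite S" "\<And>E. P E \<Longrightarrow> simple_graph S E"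
  shows "finite {E. P E}"
proof (rule finite_subset)
  show "{E. P E} \<subseteq> Pow (Pow S)" using assms(2) by (auto simp: simple_graph_def)
qed (use assms(1) in simp)

lemma finite_rooted_forests: "finite S \<Longrightarrow> finite {E. rooted_forest S R E}"
  by (rule finite_edge_sets) (auto intro: rooted_forest_edges)

lemma sum_Pow_card:
  fixes h :: "nat \<Rightarrow> 'b::comm_semiring_1"
  assumes "finite T"
  shows "(\<Sum>I\<in>Pow T. h (card I)) = (\<Sum>i\<le>card T. of_nat (card T choose i) * h i)"
proof -
  have "(\<Sum>I\<in>Pow T. h (card I)) = (\<Sum>i\<le>card T. \<Sum>I | I \<in> Pow T \<and> card I = i. h (card I))"
    by (rule sum.group[symmetric]) (use assms in \<open>auto intro: card_mono\<close>)
  also have "\<dots> = (\<Sum>i\<le>card T. of_nat (card T choose i) * h i)"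
    using assms by (intro sum.cong) (auto simp: n_subsets)
  finally show ?thesis .
qed

text \<open>The recursion behind Cayley's formula: \<open>i\<close> children of \<open>r\<close>
  roots, chosen among \<open>q\<close> vertices, are themselves the roots of a forest on those
  \<open>q\<close> vertices. The factor \<open>i\<close> is absorbed into the binomial coefficient,
  and the binomial theorem remains.\<close>

lemma weighted_binomial_sum:
  fixes r q :: nat
  assumes "q > 0"
  shows "(\<Sum>i\<le>q. (q choose i) * (r ^ i * (i * q ^ (q - i)))) = q * r * (r + q) ^ (q - 1)"
proof -
  obtain p where p: "q = Suc p" using assms gr0_implies_Suc by blast
  have "(\<Sum>i\<le>q. (q choose i) * (r ^ i * (i * q ^ (q - i))))
     = (\<Sum>j\<le>p. (Suc p choose Suc j) * (r ^ Suc j * (Suc j * q ^ (p - j))))"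
    unfolding p by (subst sum.atMost_Suc_shift) simp
  also have "\<dots> = (\<Sum>j\<le>p. q * r * ((p choose j) * r ^ j * q ^ (p - j)))"
  proof (rule sum.cong[OF refl])
    fix j
    have "(Suc p choose Suc j) * (r ^ Suc j * (Suc j * q ^ (p - j)))
       = (Suc j * (Suc p choose Suc j)) * (r ^ Suc j * q ^ (p - j))" by (simp only: mult_ac)
    also have "Suc j * (Suc p choose Suc j) = q * (p choose j)"
      unfolding p by (rule Suc_times_binomial)
    also have "q * (p choose j) * (r ^ Suc j * q ^ (p - j)) = q * r * ((p choose j) * r ^ j * q ^ (p - j))"
      by (simp add: mult_ac)
    finally show "(Suc p choose Suc j) * (r ^ Suc j * (Suc j * q ^ (p - j)))
      = q * r * ((p choose j) * r ^ j * q ^ (p - j))" .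
  qed
  also have "\<dots> = q * r * (r + q) ^ p" unfolding sum_distrib_left[symmetric] binomial by simp
  finally show ?thesis by (simp add: p)
qed

text \<open>The number \<open>r k^(k - r - 1)\<close>, multiplied by \<open>k\<close> since the exponent is \<open>-1\<close> for \<open>r = k\<close>.\<close>

lemma card_rooted_forests:
  assumes "finite S" "R \<subseteq> S"
  shows "card S * card {E. rooted_forest S R E} \<ge> card R * card S ^ (card S - card R)"
  using assms
proof (induction "card S" arbitrary: S R rule: less_induct)
  case less
  have finR: "finite R" using less.prems finite_subset by blast
  consider "R = S" | "R = {}" | "R \<noteq> {}" "R \<noteq> S" by blast
  then show ?case
  proof cases
    case 1
    have "{E. rooted_forest S R E} \<noteq> {}" using 1 rooted_forest.roots by blast
    then have "card {E. rooted_forest S R E} > 0"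
      using finite_rooted_forests[OF less.prems(1)] card_gt_0_iff by blast
    then show ?thesis using 1 by simp
  next
    case 2
    then show ?thesis by simp
  next
    case 3
    define T where "T = S - R"
    define q r where "q = card T" and "r = card R"
    have T: "finite T" "T \<noteq> {}" "R \<inter> T = {}" "S = R \<union> T" using less.prems 3 by (auto simp: T_def)
    have q0: "q > 0" using T by (simp add: q_def card_gt_0_iff)
    have cS: "card S = r + q" using T finR by (simp add: q_def r_def card_Un_disjoint)
    have qlt: "card T < card S" using cS q0 3 finR by (simp add: q_def r_def card_gt_0_iff)
    define X where "X = (SIGMA I:Pow T. (I \<rightarrow>\<^sub>E R) \<times> {E. rooted_forest T I E})"
    define f where "f = (\<lambda>(I, g, E). E \<union> (\<lambda>i :: 'a. {i, g i}) ` I)"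
    have maps: "f ` X \<subseteq> {E. rooted_forest S R E}"
      using T(3) by (auto simp: X_def f_def T(4) intro!: rooted_forest.level)
    \<comment> \<open>Edges avoiding \<open>R\<close> form the lower forest, and edges between
      \<open>T\<close> and \<open>R\<close> show which vertices are children and who their parents
      are, so the union determines the whole triple.\<close>
    have inj: "inj_on f X"
    proof (rule inj_onI)
      fix p q assume pq: "p \<in> X" "q \<in> X" "f p = f q"
      obtain I g E where p: "p = (I, g, E)" by (cases p) auto
      obtain I' g' E' where q: "q = (I', g', E')" by (cases q) auto
      have x: "(I, g, E) \<in> X" and x': "(I', g', E') \<in> X" and eq: "f (I, g, E) = f (I', g', E')"
        using pq p q by auto
      have fE: "E = {e \<in> f (I, g, E). e \<inter> R = {}}" if "(I, g, E) \<in> X" for I g E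
        using that rooted_forest_edges[of T I E] T(3)
        by (fastforce simp: X_def f_def simple_graph_def PiE_def Pi_def)
      have EE: "E = E'" using fE[OF x] fE[OF x'] eq by simp
      have fI: "(i \<in> I \<and> \<rho> = g i) \<longleftrightarrow> (i \<in> T \<and> \<rho> \<in> R \<and> {i, \<rho>} \<in> f (I, g, E))"
        if "(I, g, E) \<in> X" for I g E i \<rho>
      proof
        assume "i \<in> I \<and> \<rho> = g i"
        then show "i \<in> T \<and> \<rho> \<in> R \<and> {i, \<rho>} \<in> f (I, g, E)"
          using that by (auto simp: X_def f_def PiE_def Pi_def)
      next
        assume a: "i \<in> T \<and> \<rho> \<in> R \<and> {i, \<rho>} \<in> f (I, g, E)"
        have "simple_graph T E" using that rooted_forest_edges by (auto simp: X_def)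
        then have "\<rho> \<in> T" if "{i, \<rho>} \<in> E" using that unfolding simple_graph_def by blast
        then have "{i, \<rho>} \<notin> E" using a T(3) by blast
        then obtain j where j: "j \<in> I" "{i, \<rho>} = {j, g j}" using a by (auto simp: f_def)
        moreover have "j \<in> T" "g j \<in> R" using that j(1) by (auto simp: X_def PiE_def Pi_def)
        ultimately show "i \<in> I \<and> \<rho> = g i" using a T(3) by (auto simp: doubleton_eq_iff)
      qed
      have iff: "(i \<in> I \<and> \<rho> = g i) \<longleftrightarrow> (i \<in> I' \<and> \<rho> = g' i)" for i \<rho>
        using fI[OF x] fI[OF x'] eq by simp
      then have "I = I'" by blast
      moreover have "g = g'"
      proof (rule PiE_ext)
        show "g \<in> I \<rightarrow>\<^sub>E R" "g' \<in> I \<rightarrow>\<^sub>E R" using x x' \<open>I = I'\<close> by (auto simp: X_def)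
      qed (use iff in blast)
      ultimately show "p = q" unfolding p q using EE by simp
    qed
    have fin: "finite (I \<rightarrow>\<^sub>E R)" "finite {E. rooted_forest T I E}" if "I \<in> Pow T" for I
      using that T(1) finR finite_rooted_forests finite_subset by (auto intro!: finite_PiE)
    have "card X = (\<Sum>I\<in>Pow T. card ((I \<rightarrow>\<^sub>E R) \<times> {E. rooted_forest T I E}))"
      unfolding X_def by (rule card_SigmaI) (use T(1) fin in auto)
    also have "\<dots> = (\<Sum>I\<in>Pow T. r ^ card I * card {E. rooted_forest T I E})"
      using T(1) by (intro sum.cong) (auto simp: card_cartesian_product card_PiE r_def finite_subset)
    finally have cX: "card X = (\<Sum>I\<in>Pow T. r ^ card I * card {E. rooted_forest T I E})" .
    have "q * r * (r + q) ^ (q - 1) = (\<Sum>I\<in>Pow T. r ^ card I * (card I * q ^ (q - card I)))"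
      using sum_Pow_card[OF T(1), of "\<lambda>i. r ^ i * (i * q ^ (q - i))"] weighted_binomial_sum[OF q0, of r]
      by (simp add: q_def)
    also have "\<dots> \<le> (\<Sum>I\<in>Pow T. r ^ card I * (q * card {E. rooted_forest T I E}))"
      using less.hyps[OF qlt T(1)] by (intro sum_mono mult_left_mono) (auto simp: q_def)
    also have "\<dots> = q * card X" by (simp add: cX sum_distrib_left mult_ac)
    finally have "r * (r + q) ^ (q - 1) \<le> card X" using q0 by simp
    also have "card X \<le> card {E. rooted_forest S R E}"
      using card_inj_on_le[OF inj maps finite_rooted_forests[OF less.prems(1)]] .
    finally have "(r + q) * (r * (r + q) ^ (q - 1)) \<le> card S * card {E. rooted_forest S R E}"
      using cS by simp
    moreover have "(r + q) * (r * (r + q) ^ (q - 1)) = r * (r + q) ^ q"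
      using q0 by (simp add: power_eq_if)
    ultimately have "r * (r + q) ^ q \<le> card S * card {E. rooted_forest S R E}" by linarith
    moreover have "card R * card S ^ (card S - card R) = r * (r + q) ^ q" by (simp add: cS flip: r_def)
    ultimately show ?thesis by linarith
  qed
qed

section \<open>Leaf extensions and the 2-core\<close>

text \<open>The last argument counts the isolated vertices that were added.\<close>

inductive leaf_ext :: "'a set \<Rightarrow> 'a set set \<Rightarrow> 'a set \<Rightarrow> 'a set set \<Rightarrow> nat \<Rightarrow> bool" for V E where
  start: "leaf_ext V E V E 0"
| leaf: "leaf_ext V E V' E' t \<Longrightarrow> x \<notin> V' \<Longrightarrow> v \<in> V' \<Longrightarrow> leaf_ext V E (insert x V') (insert {x, v} E') t"
| isolated: "leaf_ext V E V' E' t \<Longrightarrow> x \<notin> V' \<Longrightarrow> leaf_ext V E (insert x V') E' (Suc t)"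

lemma leaf_ext_facts:
  assumes "leaf_ext V E V' E' t" "finite V" "simple_graph V E"
  shows "finite V' \<and> simple_graph V' E' \<and> V \<subseteq> V' \<and> E \<subseteq> E' \<and> card E' + card V + t = card E + card V'"
  using assms
proof (induction rule: leaf_ext.induct)
  case (leaf V' E' t x v)
  then have IH: "finite V'" "simple_graph V' E'" "card E' + card V + t = card E + card V'" "V \<subseteq> V'" "E \<subseteq> E'"
    by auto
  have "finite E'"
    by (rule finite_subset[of _ "Pow V'"]) (use IH in \<open>auto simp: simple_graph_def\<close>)
  moreover have "{x, v} \<notin> E'" "card {x, v} = 2"
    using IH(2) leaf.hyps by (auto simp: simple_graph_def card_2_iff)
  ultimately show ?case using IH leaf.hyps by (auto simp: simple_graph_def)
next
  case (isolated V' E' t x)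
  then show ?case by (auto simp: simple_graph_def)
qed auto

text \<open>The forest is grafted onto \<open>V\<close> along its roots: level by level, every child
  is a new leaf at its parent.\<close>

lemma rooted_forest_leaf_ext:
  assumes "rooted_forest S R E" "finite S" "leaf_ext V0 E0 V H t" "S \<inter> V = R"
  shows "leaf_ext V0 E0 (V \<union> S) (H \<union> E) t"
  using assms
proof (induction arbitrary: V H rule: rooted_forest.induct)
  case (roots R)
  then have "V \<union> R = V" by auto
  then show ?case using roots by simp
next
  case (level S I E R g)
  have RV: "R \<subseteq> V" "S \<inter> V = {}" using level by auto
  have IS: "I \<subseteq> S" "finite I" "finite S"
    using level.prems(1) rooted_forest_roots_subset[OF level.hyps(1)] by (auto intro: finite_subset)
  have "leaf_ext V0 E0 (V \<union> I) (H \<union> (\<lambda>i. {i, g i}) ` I) t"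
    using IS(2) IS(1) level.hyps(3)
  proof (induction I rule: finite_induct)
    case (insert i I)
    have "leaf_ext V0 E0 (insert i (V \<union> I)) (insert {i, g i} (H \<union> (\<lambda>i. {i, g i}) ` I)) t"
      by (rule leaf_ext.leaf) (use insert RV in auto)
    then show ?case by simp
  qed (use level.prems in simp)
  then have "leaf_ext V0 E0 (V \<union> I \<union> S) (H \<union> (\<lambda>i. {i, g i}) ` I \<union> E) t"
    by (rule level.IH[OF IS(3)]) (use IS RV in auto)
  moreover have "V \<union> I \<union> S = V \<union> (R \<union> S)" using IS RV by auto
  ultimately show ?case by (simp add: Un_ac)
qed

text \<open>The union of all vertex sets inducing minimum degree at least 2. It depends on the edge
  set alone, so the vertices on the cycles can be read off a finished graph.\<close>

definition two_core :: "'a set set \<Rightarrow> 'a set" where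
  "two_core E = \<Union>{A. \<forall>v\<in>A. 2 \<le> card {e \<in> E. v \<in> e \<and> e \<subseteq> A}}"

text \<open>The vertex added last has at most one edge and hence is not in such a set. Undoing the
  extension one vertex at a time leaves only \<open>V\<close>.\<close>

lemma leaf_ext_min_degree_2:
  assumes "leaf_ext V E V' E' t" "simple_graph V E" "finite V"
    and "A \<subseteq> V'" "\<And>v. v \<in> A \<Longrightarrow> 2 \<le> card {e \<in> E'. v \<in> e \<and> e \<subseteq> A}"
  shows "A \<subseteq> V"
  using assms
proof (induction rule: leaf_ext.induct)
  case (leaf V' E' t x w)
  have sg: "simple_graph V' E'" using leaf_ext_facts[OF leaf.hyps(1)] leaf.prems by blast
  have xA: "x \<notin> A"
  proof
    assume "x \<in> A"
    have "{e \<in> insert {x, w} E'. x \<in> e \<and> e \<subseteq> A} \<subseteq> {{x, w}}"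
      using sg leaf.hyps(2) by (auto simp: simple_graph_def)
    then have "card {e \<in> insert {x, w} E'. x \<in> e \<and> e \<subseteq> A} \<le> card {{x, w}}" by (intro card_mono) auto
    then show False using leaf.prems(4)[OF \<open>x \<in> A\<close>] by simp
  qed
  then have "{e \<in> insert {x, w} E'. v \<in> e \<and> e \<subseteq> A} = {e \<in> E'. v \<in> e \<and> e \<subseteq> A}" for v by auto
  then show ?case using leaf xA by (intro leaf.IH) auto
next
  case (isolated V' E' t x)
  have sg: "simple_graph V' E'" using leaf_ext_facts[OF isolated.hyps(1)] isolated.prems by blast
  have xA: "x \<notin> A"
  proof
    assume "x \<in> A"
    have e: "{e \<in> E'. x \<in> e \<and> e \<subseteq> A} = {}" using sg isolated.hyps(2) by (auto simp: simple_graph_def)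
    show False using isolated.prems(4)[OF \<open>x \<in> A\<close>] unfolding e by simp
  qed
  then show ?case using isolated by (intro isolated.IH) auto
qed

lemma two_core_leaf_ext:
  assumes "leaf_ext V E V' E' t" "simple_graph V E" "finite V" "\<And>v. v \<in> V \<Longrightarrow> 2 \<le> card {e \<in> E. v \<in> e}"
  shows "two_core E' = V"
proof
  have f: "finite V'" "simple_graph V' E'" "V \<subseteq> V'" "E \<subseteq> E'"
    using leaf_ext_facts[OF assms(1)] assms by auto
  have finE': "finite E'"
    by (rule finite_subset[of _ "Pow V'"]) (use f in \<open>auto simp: simple_graph_def\<close>)
  show "two_core E' \<subseteq> V"
  proof
    fix v assume "v \<in> two_core E'"
    then obtain A where A: "v \<in> A" "\<forall>v\<in>A. 2 \<le> card {e \<in> E'. v \<in> e \<and> e \<subseteq> A}"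
      by (auto simp: two_core_def)
    have "A \<subseteq> V'"
    proof
      fix u assume "u \<in> A"
      then have "card {e \<in> E'. u \<in> e \<and> e \<subseteq> A} \<noteq> 0" using A(2) by fastforce
      then have "{e \<in> E'. u \<in> e \<and> e \<subseteq> A} \<noteq> {}" by (metis card.empty)
      then show "u \<in> V'" using f(2) by (auto simp: simple_graph_def)
    qed
    then have "A \<subseteq> V" by (rule leaf_ext_min_degree_2[OF assms(1-3)]) (use A in auto)
    then show "v \<in> V" using A by auto
  qed
  have "2 \<le> card {e \<in> E'. v \<in> e \<and> e \<subseteq> V}" if "v \<in> V" for v
  proof -
    have "{e \<in> E. v \<in> e} \<subseteq> {e \<in> E'. v \<in> e \<and> e \<subseteq> V}"
      using f(4) assms(2) by (auto simp: simple_graph_def)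
    then have "card {e \<in> E. v \<in> e} \<le> card {e \<in> E'. v \<in> e \<and> e \<subseteq> V}"
      using finE' by (intro card_mono) auto
    then show ?thesis using assms(4)[OF that] by linarith
  qed
  then show "V \<subseteq> two_core E'" by (auto simp: two_core_def)
qed

section \<open>Forests of unordered trees\<close>

text \<open>Splitting off the tree that contains the least vertex decomposes a forest uniquely, so the
  \<open>t\<close> unordered trees are not overcounted.\<close>

inductive labelled_forest :: "nat set \<Rightarrow> nat \<Rightarrow> nat set set \<Rightarrow> bool" where
  empty: "labelled_forest {} 0 {}"
| tree: "labelled_forest S t E \<Longrightarrow> K \<inter> S = {} \<Longrightarrow> x \<in> K \<Longrightarrow> (\<And>y. y \<in> K \<union> S \<Longrightarrow> x \<le> y)
    \<Longrightarrow> rooted_forest K {x} E' \<Longrightarrow> labelled_forest (K \<union> S) (Suc t) (E' \<union> E)"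

lemma labelled_forest_edges: "labelled_forest S t E \<Longrightarrow> simple_graph S E"
proof (induction rule: labelled_forest.induct)
  case (tree S t E K x E')
  then show ?case using rooted_forest_edges[OF tree.hyps(5)] by (auto simp: simple_graph_def)
qed (simp add: simple_graph_def)

lemma finite_labelled_forests: "finite S \<Longrightarrow> finite {E. labelled_forest S t E}"
  by (rule finite_edge_sets) (auto intro: labelled_forest_edges)

lemma labelled_forest_leaf_ext:
  assumes "labelled_forest S t E" "finite S" "leaf_ext V0 E0 V H s" "S \<inter> V = {}"
  shows "leaf_ext V0 E0 (V \<union> S) (H \<union> E) (s + t)"
  using assms
proof (induction rule: labelled_forest.induct)
  case (tree S t E K x E')
  have "leaf_ext V0 E0 (V \<union> S) (H \<union> E) (s + t)" using tree by auto
  then have "leaf_ext V0 E0 (insert x (V \<union> S)) (H \<union> E) (Suc (s + t))"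
    by (rule leaf_ext.isolated) (use tree in auto)
  then have "leaf_ext V0 E0 (insert x (V \<union> S) \<union> K) (H \<union> E \<union> E') (Suc (s + t))"
    by (rule rooted_forest_leaf_ext[OF tree.hyps(5), rotated]) (use tree in auto)
  moreover have "insert x (V \<union> S) \<union> K = V \<union> (K \<union> S)" using tree by auto
  ultimately show ?case by (simp add: Un_ac)
qed simp

lemma card_trees:
  assumes "finite K" "x \<in> K"
  shows "card {E. rooted_forest K {x} E} \<ge> card K ^ (card K - 2)"
proof -
  have k: "card K > 0" using assms by (auto simp: card_gt_0_iff)
  have c: "card K * card {E. rooted_forest K {x} E} \<ge> card K ^ (card K - 1)"
    using card_rooted_forests[of K "{x}"] assms by simp
  show ?thesis
  \<comment> \<open>For one vertex the truncated subtraction \<open>1 - 2\<close> is 0, so no factor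
    \<open>card K\<close> can be split off the power.\<close>
  proof (cases "card K = 1")
    case True
    then show ?thesis using c by simp
  next
    case False
    then have "card K ^ (card K - 1) = card K * card K ^ (card K - 2)"
      using k by (subst power_Suc[symmetric]) (simp add: Suc_diff_Suc numeral_2_eq_2)
    then show ?thesis using c k by simp
  qed
qed

lemma card_subsets_containing:
  assumes "finite S" "x \<in> S" "k \<ge> 1"
  shows "card {K. K \<subseteq> S \<and> x \<in> K \<and> card K = k} = (card S - 1) choose (k - 1)"
proof -
  have "bij_betw (insert x) {L. L \<subseteq> S - {x} \<and> card L = k - 1} {K. K \<subseteq> S \<and> x \<in> K \<and> card K = k}"
  proof (rule bij_betwI[where g="\<lambda>K. K - {x}"])
    show "insert x \<in> {L. L \<subseteq> S - {x} \<and> card L = k - 1} \<rightarrow> {K. K \<subseteq> S \<and> x \<in> K \<and> card K = k}"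
    proof
      fix L assume L: "L \<in> {L. L \<subseteq> S - {x} \<and> card L = k - 1}"
      then have "finite L" "x \<notin> L" using assms(1) finite_subset[of L "S - {x}"] by auto
      then show "insert x L \<in> {K. K \<subseteq> S \<and> x \<in> K \<and> card K = k}" using L assms by auto
    qed
    show "(\<lambda>K. K - {x}) \<in> {K. K \<subseteq> S \<and> x \<in> K \<and> card K = k} \<rightarrow> {L. L \<subseteq> S - {x} \<and> card L = k - 1}"
      using assms by (auto simp: finite_subset)
  qed auto
  then have "card {K. K \<subseteq> S \<and> x \<in> K \<and> card K = k} = card {L. L \<subseteq> S - {x} \<and> card L = k - 1}"
    by (simp add: bij_betw_same_card)
  also have "\<dots> = (card S - 1) choose (k - 1)" using assms by (subst n_subsets) auto
  finally show ?thesis .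
qed

text \<open>In the injectivity proof \<open>K\<close> is recovered as the component of the least
  vertex: each of two candidates is closed under the tree edges of the other, so connectedness
  yields both inclusions.\<close>

lemma card_labelled_forests_rec:
  assumes "finite S" "S \<noteq> {}"
  shows "card {E. labelled_forest S (Suc t) E} \<ge>
    (\<Sum>K | K \<subseteq> S \<and> Min S \<in> K. card {E. rooted_forest K {Min S} E} * card {E. labelled_forest (S - K) t E})"
proof -
  define x where "x = Min S"
  have xS: "x \<in> S" "\<And>y. y \<in> S \<Longrightarrow> x \<le> y" using assms by (auto simp: x_def)
  define X where "X = (SIGMA K:{K. K \<subseteq> S \<and> x \<in> K}. {E. rooted_forest K {x} E} \<times> {E. labelled_forest (S - K) t E})"
  define f where "f = (\<lambda>(K :: nat set, E' :: nat set set, E). E' \<union> E)"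
  have "f ` X \<subseteq> {E. labelled_forest S (Suc t) E}"
  proof
    fix F assume "F \<in> f ` X"
    then obtain K E' E where F: "F = f (K, E', E)" "(K, E', E) \<in> X" by auto
    then have K: "K \<subseteq> S" "x \<in> K" "rooted_forest K {x} E'" "labelled_forest (S - K) t E"
      by (auto simp: X_def)
    have "labelled_forest (K \<union> (S - K)) (Suc t) (E' \<union> E)"
      by (rule labelled_forest.tree[OF K(4) _ K(2) _ K(3)]) (use K xS in auto)
    moreover have "K \<union> (S - K) = S" using K by auto
    ultimately show "F \<in> {E. labelled_forest S (Suc t) E}" by (simp add: f_def F(1))
  qed
  moreover have "inj_on f X"
  proof (rule inj_onI)
    fix p q assume pq: "p \<in> X" "q \<in> X" "f p = f q"
    obtain K E' E where p: "p = (K, E', E)" by (cases p) auto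
    obtain L F' F where q: "q = (L, F', F)" by (cases q) auto
    have X1: "(K, E', E) \<in> X" and X2: "(L, F', F) \<in> X" and eq: "f (K, E', E) = f (L, F', F)"
      using pq p q by auto
    have sub: "K \<subseteq> L" if "(K, E', E) \<in> X" "(L, F', F) \<in> X" "f (K, E', E) = f (L, F', F)" for K E' E L F' F
    proof (rule rooted_forest_connected[of K "{x}" E'])
      show "rooted_forest K {x} E'" "{x} \<subseteq> L" using that by (auto simp: X_def)
      fix e assume "e \<in> E'" "e \<inter> L \<noteq> {}"
      then have "e \<in> F' \<or> e \<in> F" using that(3) by (auto simp: f_def)
      moreover have "simple_graph L F'" "simple_graph (S - L) F"
        using that(2) rooted_forest_edges labelled_forest_edges by (auto simp: X_def)
      ultimately show "e \<subseteq> L" using \<open>e \<inter> L \<noteq> {}\<close> by (auto simp: simple_graph_def)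
    qed
    have KL: "K = L" using sub[OF X1 X2 eq] sub[OF X2 X1 eq[symmetric]] by auto
    have parts: "E' = {e \<in> f (K, E', E). e \<subseteq> K}" "E = {e \<in> f (K, E', E). \<not> e \<subseteq> K}"
      if "(K, E', E) \<in> X" for K E' E
    proof -
      have "simple_graph K E'" "simple_graph (S - K) E"
        using that rooted_forest_edges labelled_forest_edges by (auto simp: X_def)
      then have "e \<subseteq> K" if "e \<in> E'" for e using that by (auto simp: simple_graph_def)
      moreover have "\<not> e \<subseteq> K" if "e \<in> E" for e
      proof -
        have "e \<subseteq> S - K" "card e = 2" using \<open>simple_graph (S - K) E\<close> that by (auto simp: simple_graph_def)
        moreover from this have "e \<noteq> {}" by auto
        ultimately show ?thesis by blast
      qed
      ultimately show "E' = {e \<in> f (K, E', E). e \<subseteq> K}" "E = {e \<in> f (K, E', E). \<not> e \<subseteq> K}"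
        by (auto simp: f_def)
    qed
    show "p = q" unfolding p q
      using KL parts[OF X1] parts[OF X2] eq by simp
  qed
  ultimately have "card X \<le> card {E. labelled_forest S (Suc t) E}"
    using card_inj_on_le finite_labelled_forests[OF assms(1)] by blast
  moreover have "card X = (\<Sum>K | K \<subseteq> S \<and> x \<in> K. card ({E. rooted_forest K {x} E} \<times> {E. labelled_forest (S - K) t E}))"
    unfolding X_def using assms(1)
    by (intro card_SigmaI) (auto intro!: finite_rooted_forests finite_labelled_forests intro: finite_subset)
  ultimately show ?thesis by (simp add: card_cartesian_product x_def)
qed

text \<open>Applying \<open>X d/dX\<close> to a power singles out one factor and weights it by its
  size \<open>k\<close>. This matches the tree of a prescribed vertex, which contains that vertex
  with frequency \<open>k / N\<close>.\<close>

lemma fps_power_Suc_nth_size_biased: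
  fixes W :: "real fps"
  shows "real N * (W ^ Suc t) $ N = real (Suc t) * (\<Sum>k=0..N. real k * W $ k * (W ^ t) $ (N - k))"
proof -
  have "real N * (W ^ Suc t) $ N = (fps_X * fps_deriv (W ^ Suc t)) $ N"
    by (simp only: fps_X_mult_deriv_nth)
  also have "fps_X * fps_deriv (W ^ Suc t) = fps_const (real (Suc t)) * ((fps_X * fps_deriv W) * W ^ t)"
    by (simp add: fps_deriv_power mult_ac del: power_Suc)
  also have "\<dots> $ N = real (Suc t) * (\<Sum>k=0..N. real k * W $ k * (W ^ t) $ (N - k))"
    unfolding fps_mult_left_const_nth by (subst fps_mult_nth) (simp only: fps_X_mult_deriv_nth)
  finally show ?thesis .
qed

text \<open>The factors \<open>fact (card S)\<close> and \<open>exp (card S)\<close> undo the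
  normalisation of \<open>tree_weight\<close>, and \<open>1 / fact t\<close> reflects that the trees
  are unordered. The induction splits off the tree of the least vertex.\<close>

lemma card_labelled_forests:
  assumes "finite S"
  shows "real (card {E. labelled_forest S t E}) \<ge>
    fact (card S) * exp (real (card S)) / fact t * (Abs_fps tree_weight ^ t) $ card S"
  using assms
proof (induction t arbitrary: S)
  case 0
  show ?case
  proof (cases "S = {}")
    case True
    have "{E. labelled_forest {} 0 E} \<noteq> {}" using labelled_forest.empty by blast
    then have "card {E. labelled_forest S 0 E} > 0"
      using finite_labelled_forests[of S 0] True by (auto simp: card_gt_0_iff)
    then show ?thesis using True by simp
  next
    case False
    then show ?thesis using 0 by (simp add: card_gt_0_iff)
  qed
next
  case (Suc t)
  show ?case
  proof (cases "S = {}")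
    case True
    have "(Abs_fps tree_weight ^ Suc t) $ 0 = 0" by (simp add: tree_weight_def)
    then show ?thesis using True by (simp add: tree_weight_def)
  next
    case False
    define N where "N = card S"
    define x where "x = Min S"
    define P where "P = Abs_fps tree_weight ^ t"
    have xS: "x \<in> S" using False Suc.prems by (simp add: x_def)
    have N: "N \<ge> 1" using False Suc.prems by (simp add: N_def Suc_le_eq card_gt_0_iff)
    define h where "h k = real k ^ (k - 2) * (fact (N - k) * exp (real (N - k)) / fact t * P $ (N - k))" for k
    \<comment> \<open>A factor \<open>N\<close> is taken out of \<open>fact N\<close> because
      size-biasing needs it; the remaining \<open>fact (N - 1)\<close> supplies the binomial
      coefficient for the other vertices of the tree.\<close>
    have "fact N * exp (real N) / fact (Suc t) * (Abs_fps tree_weight ^ Suc t) $ N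
      = fact (N - 1) * exp (real N) / fact (Suc t) * (real N * (Abs_fps tree_weight ^ Suc t) $ N)"
      using N by (simp add: fact_reduce[of N] del: power_Suc)
    also have "\<dots> = fact (N - 1) * exp (real N) / fact t * (\<Sum>k=0..N. real k * tree_weight k * P $ (N - k))"
      unfolding fps_power_Suc_nth_size_biased by (simp add: P_def)
    also have "\<dots> = (\<Sum>k=0..N. fact (N - 1) * exp (real N) / fact t * (real k * tree_weight k * P $ (N - k)))"
      by (rule sum_distrib_left)
    also have "\<dots> = (\<Sum>k=1..N. fact (N - 1) * exp (real N) / fact t * (real k * tree_weight k * P $ (N - k)))"
      by (rule sum.mono_neutral_right) (auto simp: not_le)
    also have "\<dots> = (\<Sum>k=1..N. real ((N - 1) choose (k - 1)) * h k)"
    proof (rule sum.cong[OF refl])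
      fix k assume k: "k \<in> {1..N}"
      have "real ((N - 1) choose (k - 1)) = fact (N - 1) / (fact (k - 1) * fact (N - k))"
        using k by (subst binomial_fact) auto
      moreover have "exp (real N) = exp (real k) * exp (real (N - k))"
        using k by (simp flip: exp_add)
      moreover have "fact k = real k * fact (k - 1)" using k by (simp add: fact_reduce)
      ultimately show "fact (N - 1) * exp (real N) / fact t * (real k * tree_weight k * P $ (N - k))
          = real ((N - 1) choose (k - 1)) * h k"
        using k by (simp add: h_def tree_weight_def exp_minus field_simps)
    qed
    also have "\<dots> = (\<Sum>k=1..N. \<Sum>K | K \<in> {K. K \<subseteq> S \<and> x \<in> K} \<and> card K = k. h (card K))"
    proof (rule sum.cong[OF refl])
      fix k assume "k \<in> {1..N}"
      then have "card {K. K \<subseteq> S \<and> x \<in> K \<and> card K = k} = (N - 1) choose (k - 1)"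
        using card_subsets_containing[OF Suc.prems xS, of k] by (simp add: N_def)
      then show "real ((N - 1) choose (k - 1)) * h k = (\<Sum>K | K \<in> {K. K \<subseteq> S \<and> x \<in> K} \<and> card K = k. h (card K))"
        by (simp add: conj_assoc)
    qed
    also have "\<dots> = (\<Sum>K | K \<subseteq> S \<and> x \<in> K. h (card K))"
    proof (rule sum.group)
      show "card ` {K. K \<subseteq> S \<and> x \<in> K} \<subseteq> {1..N}"
        using Suc.prems by (auto simp: N_def Suc_le_eq card_gt_0_iff finite_subset intro: card_mono)
    qed (use Suc.prems in auto)
    also have "\<dots> \<le> (\<Sum>K | K \<subseteq> S \<and> x \<in> K.
        real (card {E. rooted_forest K {x} E}) * real (card {E. labelled_forest (S - K) t E}))"
    proof (rule sum_mono)
      fix K assume "K \<in> {K. K \<subseteq> S \<and> x \<in> K}"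
      then have K: "K \<subseteq> S" "x \<in> K" "finite K" using Suc.prems finite_subset by auto
      have c: "card (S - K) = N - card K" using K by (simp add: N_def card_Diff_subset)
      have "h (card K) = real (card K ^ (card K - 2)) *
          (fact (card (S - K)) * exp (real (card (S - K))) / fact t * P $ card (S - K))"
        unfolding h_def c by simp
      also have "\<dots> \<le> real (card {E. rooted_forest K {x} E}) * real (card {E. labelled_forest (S - K) t E})"
      proof (rule mult_mono)
        show "real (card K ^ (card K - 2)) \<le> real (card {E. rooted_forest K {x} E})"
          using card_trees[OF K(3,2)] of_nat_mono by blast
        show "fact (card (S - K)) * exp (real (card (S - K))) / fact t * P $ card (S - K)
            \<le> real (card {E. labelled_forest (S - K) t E})"
          unfolding P_def by (rule Suc.IH) (use Suc.prems in auto)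
        show "0 \<le> fact (card (S - K)) * exp (real (card (S - K))) / fact t * P $ card (S - K)"
          using fps_power_nonneg[OF tree_weight_nonneg] by (auto simp: P_def)
      qed auto
      finally show "h (card K) \<le> real (card {E. rooted_forest K {x} E}) * real (card {E. labelled_forest (S - K) t E})" .
    qed
    also have "\<dots> \<le> real (card {E. labelled_forest S (Suc t) E})"
      using card_labelled_forests_rec[OF Suc.prems False, of t] unfolding x_def[symmetric]
      by (simp flip: of_nat_mult of_nat_sum)
    finally show ?thesis by (simp only: N_def)
  qed
qed

section \<open>Counting disjoint unions of cycles\<close>

lemma two_regular_finite:
  assumes "finite V" "two_regular V E"
  shows "finite E"
  by (rule finite_subset[of _ "Pow V"]) (use assms in \<open>auto simp: two_regular_def simple_graph_def\<close>)

lemma two_regular_subdivide: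
  assumes "finite V" "two_regular V E" "x \<notin> V" "e \<in> E"
  shows "two_regular (insert x V) (E - {e} \<union> (\<lambda>v. {x, v}) ` e)"
proof -
  let ?E = "E - {e} \<union> (\<lambda>v. {x, v}) ` e"
  have sg: "simple_graph V E" and cE: "card E = card V"
    and deg: "\<And>v. v \<in> V \<Longrightarrow> card {f \<in> E. v \<in> f} = 2"
    using assms(2) by (auto simp: two_regular_def)
  have finE: "finite E" using two_regular_finite[OF assms(1,2)] .
  have e: "e \<subseteq> V" "card e = 2" using sg assms(4) by (auto simp: simple_graph_def)
  have fe: "finite e" using e(2) by (intro card_ge_0_finite) simp
  have xf: "x \<notin> f" if "f \<in> E" for f using that sg assms(3) by (auto simp: simple_graph_def)
  have inj: "inj_on (\<lambda>v. {x, v}) e" by (auto simp: inj_on_def doubleton_eq_iff)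
  have "simple_graph (insert x V) ?E"
    unfolding simple_graph_def
  proof
    fix f assume "f \<in> ?E"
    then consider "f \<in> E" | v where "v \<in> e" "f = {x, v}" by blast
    then show "f \<subseteq> insert x V \<and> card f = 2"
    proof cases
      case 1
      then show ?thesis using sg by (auto simp: simple_graph_def)
    next
      case 2
      then have "x \<noteq> v" "v \<in> V" using e(1) assms(3) by auto
      then show ?thesis using 2 by simp
    qed
  qed
  moreover have "card ?E = card (insert x V)"
  proof -
    have "card ?E = card (E - {e}) + card ((\<lambda>v. {x, v}) ` e)"
      using finE fe xf by (intro card_Un_disjoint) auto
    also have "\<dots> = (card V - 1) + 2" using assms(4) inj e(2) cE finE by (simp add: card_image)
    finally show ?thesis using assms(1,3,4) cE finE
      by (metis One_nat_def Suc_pred add_Suc_right add_2_eq_Suc' card_gt_0_iff card_insert_disjoint empty_iff)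
  qed
  moreover have "card {f \<in> ?E. v \<in> f} = 2" if v: "v \<in> insert x V" for v
  proof (cases "v = x")
    case True
    have "{f \<in> ?E. x \<in> f} = (\<lambda>v. {x, v}) ` e" using xf by auto
    then show ?thesis using True inj e(2) by (simp add: card_image)
  next
    case False
    then have vV: "v \<in> V" using v by simp
    show ?thesis
    proof (cases "v \<in> e")
      case True
      have "{f \<in> ?E. v \<in> f} = insert {x, v} ({f \<in> E. v \<in> f} - {e})"
        using True False by auto
      moreover have "{x, v} \<notin> {f \<in> E. v \<in> f} - {e}" using xf by auto
      moreover have "card ({f \<in> E. v \<in> f} - {e}) = 1" using deg[OF vV] True assms(4) finE by simp
      ultimately show ?thesis using finE by simp
    next
      case False
      have "{f \<in> ?E. v \<in> f} = {f \<in> E. v \<in> f}" using False \<open>v \<noteq> x\<close> by auto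
      then show ?thesis using deg[OF vV] by simp
    qed
  qed
  ultimately show ?thesis unfolding two_regular_def by blast
qed

lemma two_regular_triangle:
  assumes "finite V" "two_regular V E" "x \<notin> V" "y \<notin> V" "z \<notin> V" "x \<noteq> y" "x \<noteq> z" "y \<noteq> z"
  shows "two_regular (insert x (insert y (insert z V))) (E \<union> {{x, y}, {x, z}, {y, z}})"
proof -
  let ?E = "E \<union> {{x, y}, {x, z}, {y, z}}"
  have sg: "simple_graph V E" and cE: "card E = card V"
    and deg: "\<And>v. v \<in> V \<Longrightarrow> card {f \<in> E. v \<in> f} = 2"
    using assms(2) by (auto simp: two_regular_def)
  have finE: "finite E" using two_regular_finite[OF assms(1,2)] .
  have nf: "x \<notin> f" "y \<notin> f" "z \<notin> f" if "f \<in> E" for f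
    using that sg assms(3-5) by (auto simp: simple_graph_def)
  have ne: "{x, y} \<noteq> {x, z}" "{x, y} \<noteq> {y, z}" "{x, z} \<noteq> {y, z}"
    using assms(6-8) by (simp_all add: doubleton_eq_iff)
  have "simple_graph (insert x (insert y (insert z V))) ?E"
    using sg assms(6-8) by (auto simp: simple_graph_def)
  moreover have "card ?E = card (insert x (insert y (insert z V)))"
  proof -
    have "card ?E = card E + card {{x, y}, {x, z}, {y, z}}"
      using finE nf by (intro card_Un_disjoint) auto
    also have "card {{x, y}, {x, z}, {y, z}} = 3" using ne by simp
    finally show ?thesis using cE assms by simp
  qed
  moreover have "card {f \<in> ?E. v \<in> f} = 2" if v: "v \<in> insert x (insert y (insert z V))" for v
  proof -
    consider "v = x" | "v = y" | "v = z" | "v \<in> V" using v by blast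
    then show ?thesis
    proof cases
      case 1
      have "{f \<in> ?E. x \<in> f} = {{x, y}, {x, z}}" using nf assms(6-8) by auto
      then show ?thesis using 1 ne by simp
    next
      case 2
      have "{f \<in> ?E. y \<in> f} = {{x, y}, {y, z}}" using nf assms(6-8) by auto
      then show ?thesis using 2 ne by simp
    next
      case 3
      have "{f \<in> ?E. z \<in> f} = {{x, z}, {y, z}}" using nf assms(6-8) by auto
      then show ?thesis using 3 ne by simp
    next
      case 4
      then have "{f \<in> ?E. v \<in> f} = {f \<in> E. v \<in> f}" using assms(3-5) by auto
      then show ?thesis using deg[OF 4] by simp
    qed
  qed
  ultimately show ?thesis unfolding two_regular_def by blast
qed

text \<open>The triangle goes to the right of everything else, so old and new chords cannot
  interleave, and a crossing within it would need four distinct endpoints.\<close>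

lemma convex_drawable_triangle:
  assumes "finite V" "simple_graph V E" "convex_drawable V E"
    and "x \<notin> V" "y \<notin> V" "z \<notin> V" "x \<noteq> y" "x \<noteq> z" "y \<noteq> z"
  shows "convex_drawable (insert x (insert y (insert z V))) (E \<union> {{x, y}, {x, z}, {y, z}})"
proof -
  obtain \<pi> where \<pi>: "inj_on \<pi> V" "noncrossing \<pi> E"
    using assms(3) by (auto simp: convex_drawable_def)
  obtain p where p: "\<And>u. u \<in> V \<Longrightarrow> \<pi> u < p"
  proof -
    obtain q where q: "\<forall>a\<in>\<pi> ` V. a \<le> q"
      using bdd_above_finite[of "\<pi> ` V"] assms(1) by (auto simp: bdd_above_def)
    show thesis by (rule that[of "q + 1"]) (use q in fastforce)
  qed
  define \<pi>' where "\<pi>' = \<pi>(x := p, y := p + 1, z := p + 2)"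
  have new: "\<pi>' x = p" "\<pi>' y = p + 1" "\<pi>' z = p + 2" using assms(7-9) by (auto simp: \<pi>'_def)
  have old: "\<pi>' u = \<pi> u" "\<pi>' u < p" if "u \<in> V" for u
    using that p[OF that] assms(4-6) by (auto simp: \<pi>'_def)
  have "inj_on \<pi>' (insert x (insert y (insert z V)))"
  proof (rule inj_onI)
    fix u w assume u: "u \<in> insert x (insert y (insert z V))" and w: "w \<in> insert x (insert y (insert z V))"
      and eq: "\<pi>' u = \<pi>' w"
    have key: "u \<in> V \<longleftrightarrow> \<pi>' u < p" if "u \<in> insert x (insert y (insert z V))" for u
    proof
      show "\<pi>' u < p" if "u \<in> V" using old(2)[OF that] .
      show "u \<in> V" if "\<pi>' u < p"
      proof (rule ccontr)
        assume "u \<notin> V"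
        then have "u = x \<or> u = y \<or> u = z" using \<open>u \<in> insert x (insert y (insert z V))\<close> by auto
        then show False using that new by auto
      qed
    qed
    have iff: "u \<in> V \<longleftrightarrow> w \<in> V" using key[OF u] key[OF w] eq by simp
    show "u = w"
    proof (cases "u \<in> V")
      case True
      then have "w \<in> V" using iff by simp
      then show ?thesis using True eq old(1)[OF True] old(1)[OF \<open>w \<in> V\<close>] inj_onD[OF \<pi>(1)] by simp
    next
      case False
      then have "u = x \<or> u = y \<or> u = z" "w = x \<or> w = y \<or> w = z" using iff u w by blast+
      then show ?thesis using eq new by (elim disjE) simp_all
    qed
  qed
  moreover have "noncrossing \<pi>' (E \<union> {{x, y}, {x, z}, {y, z}})"
    unfolding noncrossing_def
  proof (intro allI impI notI)
    fix a b c d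
    assume e: "{a, b} \<in> E \<union> {{x, y}, {x, z}, {y, z}}" "{c, d} \<in> E \<union> {{x, y}, {x, z}, {y, z}}"
      and cr: "\<pi>' a < \<pi>' c \<and> \<pi>' c < \<pi>' b \<and> \<pi>' b < \<pi>' d"
    have dich: "({u, w} \<in> E \<and> u \<in> V \<and> w \<in> V) \<or> (\<pi>' u \<in> {p, p + 1, p + 2} \<and> \<pi>' w \<in> {p, p + 1, p + 2})"
      if "{u, w} \<in> E \<union> {{x, y}, {x, z}, {y, z}}" for u w
    proof (cases "{u, w} \<in> E")
      case True
      then show ?thesis using assms(2) by (auto simp: simple_graph_def)
    next
      case False
      then have "{u, w} \<subseteq> {x, y, z}" using that by auto
      then have "u = x \<or> u = y \<or> u = z" "w = x \<or> w = y \<or> w = z" by auto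
      then show ?thesis using new by auto
    qed
    from dich[OF e(1)] show False
    proof
      assume ab: "{a, b} \<in> E \<and> a \<in> V \<and> b \<in> V"
      then have "\<pi>' c < p" using cr old(2)[of b] by auto
      then have cd: "{c, d} \<in> E \<and> c \<in> V \<and> d \<in> V" using dich[OF e(2)] by auto
      have "\<not> (\<pi> a < \<pi> c \<and> \<pi> c < \<pi> b \<and> \<pi> b < \<pi> d)"
        using \<pi>(2) ab cd unfolding noncrossing_def by blast
      then show False using cr ab cd old(1) by auto
    next
      assume ab: "\<pi>' a \<in> {p, p + 1, p + 2} \<and> \<pi>' b \<in> {p, p + 1, p + 2}"
      then have "p \<le> \<pi>' c" using cr by auto
      then have "\<pi>' c \<in> {p, p + 1, p + 2} \<and> \<pi>' d \<in> {p, p + 1, p + 2}"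
        using dich[OF e(2)] old(2)[of c] by auto
      then show False using ab cr by auto
    qed
  qed
  ultimately show ?thesis by (auto simp: convex_drawable_def)
qed

definition cycle_graphs :: "'a set \<Rightarrow> 'a set set set" where
  "cycle_graphs V = {E. two_regular V E \<and> convex_drawable V E}"

lemma finite_cycle_graphs: "finite V \<Longrightarrow> finite (cycle_graphs V)"
  unfolding cycle_graphs_def by (rule finite_edge_sets) (auto simp: two_regular_def)

text \<open>Removing a vertex from a cycle of length at least \<open>4\<close> and joining its neighbours, or removing its
  whole triangle, turns a 2-regular graph into a smaller one.\<close>

fun cycle_num :: "nat \<Rightarrow> nat" where
  "cycle_num 0 = 1"
| "cycle_num (Suc 0) = 0"
| "cycle_num (Suc (Suc 0)) = 0"
| "cycle_num (Suc (Suc (Suc r))) = (r + 2) * cycle_num (r + 2) + ((r + 2) choose 2) * cycle_num r"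

text \<open>Two injections: \<open>f\<close> subdivides an edge by \<open>x\<close>, and
  \<open>g\<close> adds a triangle through \<open>x\<close>. Both can be undone from the neighbours
  \<open>nb\<close> of \<open>x\<close> and the edges \<open>rest\<close> avoiding \<open>x\<close>.
  Their images are disjoint because the two neighbours of \<open>x\<close> are adjacent after
  \<open>g\<close> but not after \<open>f\<close>.\<close>

lemma cycle_graphs_insert:
  assumes "finite V" "x \<notin> V"
  shows "card (cycle_graphs (insert x V)) \<ge> card V * card (cycle_graphs V)
    + (\<Sum>P | P \<subseteq> V \<and> card P = 2. card (cycle_graphs (V - P)))"
proof -
  define A where "A = (SIGMA E:cycle_graphs V. E)"
  define f where "f = (\<lambda>(E, e). E - {e} \<union> (\<lambda>v. {x, v}) ` e)"
  define B where "B = (SIGMA P:{P. P \<subseteq> V \<and> card P = 2}. cycle_graphs (V - P))"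
  define g where "g = (\<lambda>(P, E). insert P (E \<union> (\<lambda>v. {x, v}) ` P))"
  define nb where "nb F = {v. v \<noteq> x \<and> {x, v} \<in> F}" for F :: "'a set set"
  define rest where "rest F = {e \<in> F. x \<notin> e}" for F :: "'a set set"
  have fA: "f ` A \<subseteq> cycle_graphs (insert x V)"
    using assms by (auto simp: A_def f_def cycle_graphs_def intro!: two_regular_subdivide convex_drawable_subdivide)
  have gB: "g ` B \<subseteq> cycle_graphs (insert x V)"
  proof
    fix F assume "F \<in> g ` B"
    then obtain P E where F: "F = g (P, E)" "(P, E) \<in> B" by auto
    then have P: "P \<subseteq> V" "card P = 2" and E: "two_regular (V - P) E" "convex_drawable (V - P) E"
      by (auto simp: B_def cycle_graphs_def)
    obtain y z where yz: "P = {y, z}" "y \<noteq> z" using P(2) card_2_iff[of P] by blast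
    have V: "insert x (insert y (insert z (V - P))) = insert x V" using yz P by auto
    have gE: "g (P, E) = E \<union> {{x, y}, {x, z}, {y, z}}" using yz by (auto simp: g_def)
    have ne: "x \<noteq> y" "x \<noteq> z" using assms(2) yz P by auto
    have new: "x \<notin> V - P" "y \<notin> V - P" "z \<notin> V - P" using assms(2) yz by simp_all
    have fin: "finite (V - P)" and sg: "simple_graph (V - P) E"
      using assms(1) E(1) by (simp_all add: two_regular_def)
    have "two_regular (insert x V) (g (P, E))"
      using two_regular_triangle[OF fin E(1) new ne yz(2)] by (simp only: V gE)
    moreover have "convex_drawable (insert x V) (g (P, E))"
      using convex_drawable_triangle[OF fin sg E(2) new ne yz(2)] by (simp only: V gE)
    ultimately have "two_regular (insert x V) (g (P, E)) \<and> convex_drawable (insert x V) (g (P, E))" by simp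
    then show "F \<in> cycle_graphs (insert x V)" by (simp add: cycle_graphs_def F(1))
  qed
  have fn: "nb (f (E, e)) = e" "rest (f (E, e)) = E - {e}" if "(E, e) \<in> A" for E e
  proof -
    have "e \<in> E" "simple_graph V E" using that by (auto simp: A_def cycle_graphs_def two_regular_def)
    then have xE: "x \<notin> h" if "h \<in> E" for h using that assms(2) by (auto simp: simple_graph_def)
    then have xe: "x \<notin> e" using \<open>e \<in> E\<close> by auto
    show "nb (f (E, e)) = e"
    proof
      show "nb (f (E, e)) \<subseteq> e"
      proof
        fix v assume "v \<in> nb (f (E, e))"
        then have v: "v \<noteq> x" "{x, v} \<in> f (E, e)" by (auto simp: nb_def)
        then have "{x, v} \<in> (\<lambda>v. {x, v}) ` e" using xE[of "{x, v}"] by (auto simp: f_def)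
        then obtain w where "w \<in> e" "{x, v} = {x, w}" by blast
        then show "v \<in> e" using v(1) by (simp add: doubleton_eq_iff)
      qed
      show "e \<subseteq> nb (f (E, e))" using xe by (auto simp: nb_def f_def)
    qed
    show "rest (f (E, e)) = E - {e}" using xE by (auto simp: rest_def f_def)
  qed
  have gn: "nb (g (P, E)) = P" "rest (g (P, E)) = insert P E" "P \<notin> E" if "(P, E) \<in> B" for P E
  proof -
    have P: "P \<subseteq> V" "card P = 2" and sg: "simple_graph (V - P) E"
      using that by (auto simp: B_def cycle_graphs_def two_regular_def)
    have xE: "x \<notin> h" if "h \<in> E" for h using that sg assms(2) by (auto simp: simple_graph_def)
    have xP: "x \<notin> P" using P assms(2) by auto
    show "nb (g (P, E)) = P"
    proof
      show "nb (g (P, E)) \<subseteq> P"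
      proof
        fix v assume "v \<in> nb (g (P, E))"
        then have v: "v \<noteq> x" "{x, v} \<in> g (P, E)" by (auto simp: nb_def)
        then have "{x, v} \<in> (\<lambda>v. {x, v}) ` P" using xE[of "{x, v}"] xP by (auto simp: g_def)
        then obtain w where "w \<in> P" "{x, v} = {x, w}" by blast
        then show "v \<in> P" using v(1) by (simp add: doubleton_eq_iff)
      qed
      show "P \<subseteq> nb (g (P, E))" using xP by (auto simp: nb_def g_def)
    qed
    show "rest (g (P, E)) = insert P E" using xE xP by (auto simp: rest_def g_def)
    show "P \<notin> E"
    proof
      assume "P \<in> E"
      then have "P \<subseteq> V - P" using sg by (auto simp: simple_graph_def)
      then have "P = {}" by auto
      then show False using P(2) by simp
    qed
  qed
  have injf: "inj_on f A"
  proof (rule inj_onI)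
    fix p q assume pq: "p \<in> A" "q \<in> A" "f p = f q"
    obtain E e where p: "p = (E, e)" by (cases p) auto
    obtain E' e' where q: "q = (E', e')" by (cases q) auto
    have 1: "(E, e) \<in> A" "(E', e') \<in> A" and eq: "f (E, e) = f (E', e')"
      using pq p q by auto
    have "e = e'" using fn(1)[OF 1(1)] fn(1)[OF 1(2)] eq by simp
    moreover have "E - {e} = E' - {e'}" using fn(2)[OF 1(1)] fn(2)[OF 1(2)] eq by simp
    moreover have "e \<in> E" "e' \<in> E'" using 1 by (auto simp: A_def)
    ultimately show "p = q" unfolding p q by blast
  qed
  have injg: "inj_on g B"
  proof (rule inj_onI)
    fix p q assume pq: "p \<in> B" "q \<in> B" "g p = g q"
    obtain P E where p: "p = (P, E)" by (cases p) auto
    obtain P' E' where q: "q = (P', E')" by (cases q) auto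
    have 1: "(P, E) \<in> B" "(P', E') \<in> B" and eq: "g (P, E) = g (P', E')"
      using pq p q by auto
    have "P = P'" using gn(1)[OF 1(1)] gn(1)[OF 1(2)] eq by simp
    moreover have "insert P E = insert P' E'" using gn(2)[OF 1(1)] gn(2)[OF 1(2)] eq by simp
    ultimately show "p = q" unfolding p q using gn(3)[OF 1(1)] gn(3)[OF 1(2)] by (simp add: insert_ident)
  qed
  have disj: "f ` A \<inter> g ` B = {}"
  proof (rule ccontr)
    assume "f ` A \<inter> g ` B \<noteq> {}"
    then obtain E e P E' where 1: "(E, e) \<in> A" "(P, E') \<in> B" "f (E, e) = g (P, E')" by auto
    have "e = P" using fn(1)[OF 1(1)] gn(1)[OF 1(2)] 1(3) by simp
    moreover have "E - {e} = insert P E'" using fn(2)[OF 1(1)] gn(2)[OF 1(2)] 1(3) by simp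
    ultimately show False by blast
  qed
  have fin: "finite (cycle_graphs (insert x V))" using assms by (simp add: finite_cycle_graphs)
  have "card (f ` A) + card (g ` B) = card (f ` A \<union> g ` B)"
    using disj fin finite_subset[OF fA] finite_subset[OF gB] by (simp add: card_Un_disjoint)
  also have "\<dots> \<le> card (cycle_graphs (insert x V))" using fA gB fin by (intro card_mono) auto
  finally have "card A + card B \<le> card (cycle_graphs (insert x V))"
    using injf injg by (simp add: card_image)
  moreover have "card A = card V * card (cycle_graphs V)"
  proof -
    have "card A = (\<Sum>E\<in>cycle_graphs V. card E)"
      unfolding A_def using assms(1) finite_cycle_graphs[OF assms(1)] two_regular_finite
      by (intro card_SigmaI) (auto simp: cycle_graphs_def)
    also have "\<dots> = (\<Sum>E\<in>cycle_graphs V. card V)" by (rule sum.cong) (auto simp: cycle_graphs_def two_regular_def)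
    finally show ?thesis by simp
  qed
  moreover have "card B = (\<Sum>P | P \<subseteq> V \<and> card P = 2. card (cycle_graphs (V - P)))"
    unfolding B_def using assms(1) by (intro card_SigmaI) (auto simp: finite_cycle_graphs)
  ultimately show ?thesis by simp
qed

lemma card_cycle_graphs:
  assumes "finite V"
  shows "card (cycle_graphs V) \<ge> cycle_num (card V)"
  using assms
proof (induction "card V" arbitrary: V rule: less_induct)
  case less
  consider "card V = 0" | "card V = 1" | "card V = 2" | r where "card V = Suc (Suc (Suc r))"
    by (metis One_nat_def Suc_1 not0_implies_Suc)
  then show ?case
  proof cases
    case 1
    then have "V = {}" using less.prems by simp
    then have "{} \<in> cycle_graphs V"
      by (simp add: cycle_graphs_def two_regular_def simple_graph_def convex_drawable_def noncrossing_def)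
    then have "card (cycle_graphs V) > 0" using finite_cycle_graphs[OF less.prems] by (auto simp: card_gt_0_iff)
    then show ?thesis using 1 by simp
  next
    case (4 r)
    then obtain x where x: "x \<in> V" by fastforce
    define U where "U = V - {x}"
    have U: "finite U" "x \<notin> U" "V = insert x U" "card U = r + 2"
      using less.prems x 4 by (auto simp: U_def)
    have "cycle_num (card V) = card U * cycle_num (card U) + (card U choose 2) * cycle_num r"
      using 4 U(4) by simp
    also have "(card U choose 2) * cycle_num r = (\<Sum>P | P \<subseteq> U \<and> card P = 2. cycle_num r)"
      using n_subsets[OF U(1), of 2] by simp
    also have "card U * cycle_num (card U) + \<dots>
      \<le> card U * card (cycle_graphs U) + (\<Sum>P | P \<subseteq> U \<and> card P = 2. card (cycle_graphs (U - P)))"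
    proof (intro add_mono mult_left_mono sum_mono)
      show "cycle_num (card U) \<le> card (cycle_graphs U)" by (rule less.hyps) (use U 4 in auto)
      fix P assume "P \<in> {P. P \<subseteq> U \<and> card P = 2}"
      then have "P \<subseteq> U" "card P = 2" "finite P" using U(1) finite_subset by auto
      then have "card (U - P) = r" using U(4) by (simp add: card_Diff_subset)
      then show "cycle_num r \<le> card (cycle_graphs (U - P))"
        using less.hyps[of "U - P"] U 4 by simp
    qed auto
    also have "\<dots> \<le> card (cycle_graphs V)" unfolding U(3) by (rule cycle_graphs_insert[OF U(1,2)])
    finally show ?thesis .
  qed (simp_all add: numeral_2_eq_2)
qed

text \<open>With \<open>s^2 = q + 2\<close>, the two summands of the recurrence together contribute
  the factor \<open>s^2 + 1/2\<close>, and \<open>(s^2 + 1/2)^2 \<ge> s^2 (s^2 + 1)\<close>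
  reproduces the growth of \<open>r! / sqrt r\<close>. Sizes 4 and 5 are base cases because the
  recurrence falls back there on sizes 1 and 2, for which the bound fails.\<close>

lemma cycle_num_lower:
  assumes "r \<ge> 3"
  shows "real (cycle_num r) \<ge> fact r / (5 * sqrt (real r))"
  using assms
proof (induction r rule: less_induct)
  case (less r)
  consider "r = 3" | "r = 4" | "r = 5" | "r \<ge> 6" using less.prems by linarith
  then show ?case
  proof cases
    case 1
    have "sqrt 3 \<ge> (6/5 :: real)" by (rule real_le_rsqrt) (simp add: power2_eq_square)
    then show ?thesis using 1 by (simp add: eval_nat_numeral divide_le_eq)
  next
    case 2
    have "sqrt 4 = (2 :: real)" by (simp add: real_sqrt_unique)
    then show ?thesis using 2 by (simp add: numeral_eq_Suc fact_numeral)
  next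
    case 3
    have "sqrt 5 \<ge> (2 :: real)" by (rule real_le_rsqrt) (simp add: power2_eq_square)
    then show ?thesis using 3 by (simp add: numeral_eq_Suc fact_numeral divide_le_eq choose_two)
  next
    case 4
    define q where "q = r - 3"
    have r: "r = Suc (Suc (Suc q))" "q \<ge> 3" using 4 by (auto simp: q_def)
    define s where "s = sqrt (real (q + 2))"
    have s: "s > 0" "s * s = real (q + 2)" by (auto simp: s_def)
    have IH1: "real (cycle_num (q + 2)) \<ge> fact (q + 2) / (5 * s)"
      unfolding s_def by (rule less.IH) (use r in auto)
    have IH2: "real (cycle_num q) \<ge> fact q / (5 * s)"
    proof -
      have "fact q / (5 * s) \<le> fact q / (5 * sqrt (real q))"
        using r s by (intro divide_left_mono) (auto simp: s_def)
      also have "\<dots> \<le> real (cycle_num q)" by (rule less.IH) (use r in auto)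
      finally show ?thesis .
    qed
    have ch: "real ((q + 2) choose 2) * fact q = fact (q + 2) / 2"
      by (subst binomial_fact) auto
    have "fact r / (5 * sqrt (real r)) \<le> (real (q + 2) + 1/2) * (fact (q + 2) / (5 * s))"
    proof -
      have sr: "sqrt (real r) * sqrt (real r) = real r" by simp
      have "(s * sqrt (real r))\<^sup>2 \<le> (real (q + 2) + 1/2)\<^sup>2"
      proof -
        have "(s * sqrt (real r))\<^sup>2 = (s * s) * (sqrt (real r) * sqrt (real r))"
          by (simp add: power2_eq_square)
        also have "\<dots> = (real q + 2) * (real q + 3)" unfolding s(2) sr r(1) by (simp add: add_ac)
        also have "\<dots> \<le> (real (q + 2) + 1/2)\<^sup>2" by (simp add: power2_eq_square algebra_simps)
        finally show ?thesis .
      qed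
      then have "s * sqrt (real r) \<le> real (q + 2) + 1/2" by (rule power2_le_imp_le) simp
      then have "s * real r \<le> (real (q + 2) + 1/2) * sqrt (real r)"
        using sr by (metis mult.assoc mult_right_mono real_sqrt_ge_zero of_nat_0_le_iff)
      then have "real r / sqrt (real r) \<le> (real (q + 2) + 1/2) / s"
        using s r by (simp add: divide_le_eq le_divide_eq mult.commute)
      then have "real r / sqrt (real r) * (fact (q + 2) / 5) \<le> (real (q + 2) + 1/2) / s * (fact (q + 2) / 5)"
        by (intro mult_right_mono) auto
      moreover have "fact r = real r * fact (q + 2)" using r by simp
      ultimately show ?thesis by (simp add: field_simps)
    qed
    also have "\<dots> = real (q + 2) * (fact (q + 2) / (5 * s)) + real ((q + 2) choose 2) * (fact q / (5 * s))"
      using ch by (simp add: algebra_simps add_divide_distrib) 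
    also have "\<dots> \<le> real (q + 2) * real (cycle_num (q + 2)) + real ((q + 2) choose 2) * real (cycle_num q)"
      by (intro add_mono mult_left_mono IH1 IH2) auto
    also have "\<dots> = real (cycle_num r)" by (simp add: r algebra_simps)
    finally show ?thesis .
  qed
qed

lemma leaf_ext_convex_drawable:
  assumes "leaf_ext V E V' E' t" "finite V" "simple_graph V E" "convex_drawable V E"
  shows "convex_drawable V' E'"
  using assms
proof (induction rule: leaf_ext.induct)
  case (leaf V' E' t x v)
  then show ?case using leaf_ext_facts[OF leaf.hyps(1)] by (intro convex_drawable_leaf) auto
next
  case (isolated V' E' t x)
  then show ?case using leaf_ext_facts[OF isolated.hyps(1)] by (intro convex_drawable_isolated) auto
qed auto

section \<open>Pseudoforests\<close>

lemma binomial_prod: "real (N choose m) * fact m = (\<Prod>i=0..<m. real N - real i)"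
  by (simp add: binomial_gbinomial gbinomial_mult_fact mult.commute[of _ "fact m"])

lemma binomial_mult_fact_ge:
  assumes "r \<le> j"
  shows "(real j - real r) ^ r \<le> real (j choose r) * fact r"
proof -
  have "(\<Prod>i=0..<r. real j - real r) \<le> (\<Prod>i=0..<r. real j - real i)"
    using assms by (intro prod_mono) auto
  then show ?thesis by (simp add: binomial_prod)
qed

lemma rooted_forest_edge_not_roots:
  assumes "rooted_forest S R E" "e \<in> E"
  shows "\<not> e \<subseteq> R"
  using assms
proof (induction rule: rooted_forest.induct)
  case (level S I E R g)
  have "simple_graph S E" "I \<subseteq> S"
    using level.hyps rooted_forest_edges rooted_forest_roots_subset by blast+
  have "\<exists>v\<in>e. v \<in> S"
  proof (cases "e \<in> E")
    case True
    then have "e \<subseteq> S" "card e = 2" using \<open>simple_graph S E\<close> by (auto simp: simple_graph_def)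
    then show ?thesis by (cases "e = {}") auto
  next
    case False
    then show ?thesis using level.prems \<open>I \<subseteq> S\<close> by auto
  qed
  then show ?case using level.hyps(2) by blast
qed simp

text \<open>\<open>R\<close> carries the cycles, and the forest hangs from it. Only sizes
  \<open>r\<close> of order \<open>sqrt j\<close> are kept: there are order \<open>sqrt j\<close> of
  them, each contributing order \<open>j^(j - 1) sqrt r\<close>, and the exponents add up to
  \<open>j - 1/4\<close>.\<close>

lemma card_unicyclic_lower:
  assumes "finite J" "card J \<ge> 100"
  shows "(\<Sum>R\<in>Pow J. real (card (cycle_graphs R)) * real (card {E. rooted_forest J R E}))
    \<ge> real (card J) powr (real (card J) - 1/4) / 80"
proof -
  define j where "j = card J"
  \<comment> \<open>\<open>2 \<rho>^2 \<le> j\<close> keeps the falling factorial of length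
    \<open>r \<le> \<rho>\<close> above \<open>j^r / 2\<close>, by Bernoulli's inequality.\<close>
  define \<rho> where "\<rho> = nat \<lfloor>sqrt (real j / 2)\<rfloor>"
  have j: "j \<ge> 100" using assms by (simp add: j_def)
  have s7: "sqrt (real j / 2) \<ge> 7"
    using j by (intro real_le_rsqrt) simp
  have rho_le: "real \<rho> \<le> sqrt (real j / 2)" using s7 by (simp add: \<rho>_def)
  have rho_gt: "real \<rho> > sqrt (real j / 2) - 1" unfolding \<rho>_def using s7 by linarith
  have rho7: "\<rho> \<ge> 7" unfolding \<rho>_def using s7 by linarith
  have rho2: "2 * real \<rho> ^ 2 \<le> real j"
    using power_mono[OF rho_le, of 2] by simp
  define b where "b = real j powr (1/4)"
  have b0: "b > 0" using j by (simp add: b_def)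
  have b2: "b * b = sqrt (real j)"
    using j by (simp add: b_def powr_half_sqrt[symmetric] flip: powr_add)
  have sj: "sqrt (real j) \<ge> 10" using j by (intro real_le_rsqrt) simp
  have rho_b: "real \<rho> \<ge> b * b / 2"
  proof -
    have "sqrt (real j / 2) \<ge> 7/10 * sqrt (real j)"
      by (rule real_le_rsqrt) (simp add: power_mult_distrib power2_eq_square)
    then show ?thesis using rho_gt sj b2 by linarith
  qed
  define h where "h r = real (cycle_num r) * (real r * real j ^ (j - r) / real j)" for r
  \<comment> \<open>Sizes below \<open>\<rho> / 2\<close> are dropped so that \<open>sqrt r\<close>
    is at least half of \<open>b = j^(1/4)\<close>.\<close>
  define I where "I = {r. \<rho> \<le> 2 * r \<and> r \<le> \<rho>}"
  have term_ge: "real (j choose r) * h r \<ge> real j ^ (j - 1) * (b / 20)" if "r \<in> I" for r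
  proof -
    have r: "r \<le> \<rho>" "r \<ge> 3" "real \<rho> \<le> 2 * real r" using that rho7 by (auto simp: I_def)
    have "real r ^ 2 \<le> real \<rho> ^ 2" using r by (intro power_mono) auto
    then have r2: "2 * real r ^ 2 \<le> real j" using rho2 by linarith
    moreover have "real r \<le> real r ^ 2" using r by (simp add: power2_eq_square)
    ultimately have rj: "r < j" using r by linarith
    have ff: "real (j choose r) * fact r \<ge> real j ^ r / 2"
    proof -
      have "1/2 \<le> 1 + real r * (- (real r / real j))"
        using r2 j by (simp add: power2_eq_square field_simps)
      also have "\<dots> \<le> (1 + - (real r / real j)) ^ r"
        using rj by (intro Bernoulli_inequality) simp
      finally have "real j ^ r * (1/2) \<le> real j ^ r * (1 + - (real r / real j)) ^ r"
        by (intro mult_left_mono) auto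
      also have "\<dots> = (real j - real r) ^ r"
        using j by (subst power_mult_distrib[symmetric]) (simp add: algebra_simps)
      also have "\<dots> \<le> real (j choose r) * fact r" using rj by (intro binomial_mult_fact_ge) simp
      finally show ?thesis by simp
    qed
    have sr: "sqrt (real r) \<ge> b / 2"
    proof (rule real_le_rsqrt)
      show "(b / 2)\<^sup>2 \<le> real r" using rho_b r(3) by (simp add: power2_eq_square)
    qed
    have "real j ^ (j - 1) * (b / 20) \<le> real j ^ (j - 1) * (sqrt (real r) / 10)"
      using sr by (intro mult_left_mono) auto
    also have "\<dots> = real j ^ r / 2 / (5 * sqrt (real r)) * (real r * real j ^ (j - r) / real j)"
    proof -
      have "real j ^ j = real j ^ r * real j ^ (j - r)" using rj by (simp flip: power_add)
      moreover have "real j ^ j = real j * real j ^ (j - 1)" using j by (simp add: power_eq_if)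
      ultimately have p: "real j ^ (j - 1) = real j ^ r * real j ^ (j - r) / real j"
        using j by (simp add: field_simps)
      have q: "sqrt (real r) = real r / sqrt (real r)" by (simp add: real_div_sqrt)
      show ?thesis unfolding p by (subst q) (simp add: field_simps)
    qed
    also have "\<dots> \<le> real (j choose r) * fact r / (5 * sqrt (real r)) * (real r * real j ^ (j - r) / real j)"
      by (intro mult_right_mono divide_right_mono ff) auto
    also have "\<dots> = real (j choose r) * (fact r / (5 * sqrt (real r))) * (real r * real j ^ (j - r) / real j)"
      by simp
    also have "\<dots> \<le> real (j choose r) * real (cycle_num r) * (real r * real j ^ (j - r) / real j)"
      using cycle_num_lower[OF r(2)] by (intro mult_right_mono mult_left_mono) auto
    finally show ?thesis by (simp add: h_def mult.assoc)
  qed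
  have cardI: "real (card I) \<ge> real \<rho> / 2"
  proof -
    have "I = {(\<rho> + 1) div 2..\<rho>}" by (auto simp: I_def)
    then have "card I = Suc \<rho> - (\<rho> + 1) div 2" by simp
    then have "2 * card I \<ge> \<rho>" by presburger
    then show ?thesis by linarith
  qed
  \<comment> \<open>The constant is \<open>80 = 4 * 20\<close>: there are at least
    \<open>\<rho> / 2 \<ge> b^2 / 4\<close> sizes, each worth at least
    \<open>j^(j - 1) * b / 20\<close>.\<close>
  have "real j powr (real j - 1/4) / 80 = b * b / 2 / 2 * (real j ^ (j - 1) * (b / 20))"
  proof -
    have "real j powr (real j - 1/4) = real j powr (real (j - 1) + 3/4)"
      using j by (simp add: of_nat_diff)
    also have "\<dots> = real j ^ (j - 1) * (real j powr (3/4))"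
      unfolding powr_add by (subst powr_realpow) (use j in auto)
    also have "real j powr (3/4) = b * b * b" using j by (simp add: b_def flip: powr_add)
    finally show ?thesis by simp
  qed
  also have "\<dots> \<le> real (card I) * (real j ^ (j - 1) * (b / 20))"
    using cardI rho_b b0 by (intro mult_right_mono) auto
  also have "\<dots> = (\<Sum>r\<in>I. real j ^ (j - 1) * (b / 20))" by simp
  also have "\<dots> \<le> (\<Sum>r\<in>I. real (j choose r) * h r)" by (intro sum_mono term_ge)
  also have "\<dots> \<le> (\<Sum>r\<le>j. real (j choose r) * h r)"
  proof (rule sum_mono2)
    have "\<rho> \<le> j"
    proof -
      have "real \<rho> \<le> real \<rho> ^ 2" using rho7 by (simp add: power2_eq_square)
      then show ?thesis using rho2 by linarith
    qed
    then show "I \<subseteq> {..j}" by (auto simp: I_def)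
  qed (auto simp: h_def)
  also have "\<dots> = (\<Sum>R\<in>Pow J. h (card R))"
    using sum_Pow_card[OF assms(1), of h] by (simp add: j_def)
  also have "\<dots> \<le> (\<Sum>R\<in>Pow J. real (card (cycle_graphs R)) * real (card {E. rooted_forest J R E}))"
  proof (rule sum_mono)
    fix R assume "R \<in> Pow J"
    then have R: "R \<subseteq> J" "finite R" using assms(1) finite_subset by auto
    have "real (card R) * real j ^ (j - card R) / real j \<le> real (card {E. rooted_forest J R E})"
    proof -
      have "card R * j ^ (j - card R) \<le> j * card {E. rooted_forest J R E}"
        using card_rooted_forests[OF assms(1) R(1)] by (simp add: j_def)
      then have "real (card R * j ^ (j - card R)) \<le> real (j * card {E. rooted_forest J R E})"
        by (rule of_nat_mono)
      then show ?thesis using j by (simp add: divide_le_eq mult.commute)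
    qed
    then show "h (card R) \<le> real (card (cycle_graphs R)) * real (card {E. rooted_forest J R E})"
      unfolding h_def using card_cycle_graphs[OF R(2)] by (intro mult_mono) auto
  qed
  finally show ?thesis by (simp add: j_def)
qed

lemma planar_mono:
  assumes "planar V E" "E' \<subseteq> E"
  shows "planar V E'"
proof -
  obtain p \<gamma> where pd: "plane_drawing V E p \<gamma>" using assms(1) by (auto simp: planar_def)
  have "plane_drawing V E' p \<gamma>"
    unfolding plane_drawing_def
  proof (intro conjI ballI)
    show "inj_on p V" using pd by (simp add: plane_drawing_def)
  next
    fix e assume "e \<in> E'"
    then have "e \<in> E" using assms(2) by auto
    then show "arc (\<gamma> e)" "{pathstart (\<gamma> e), pathfinish (\<gamma> e)} = p ` e"
      "path_image (\<gamma> e) \<inter> p ` V = p ` e"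
      using pd by (simp_all add: plane_drawing_def)
  next
    fix e e' assume "e \<in> E'" "e' \<in> E'"
    then have "e \<in> E" "e' \<in> E" using assms(2) by auto
    then show "e \<noteq> e' \<longrightarrow> path_image (\<gamma> e) \<inter> path_image (\<gamma> e') \<subseteq> p ` (e \<inter> e')"
      using pd by (simp add: plane_drawing_def)
  qed
  then show ?thesis by (auto simp: planar_def)
qed

text \<open>The pieces can be recovered from the graph: the cycles span its 2-core \<open>R\<close>, and \<open>J\<close> is the union
  of the components that meet \<open>R\<close>.\<close>

lemma card_planar_graphs_ge:
  assumes "t \<le> n"
  shows "card (planar_graphs n (n - t)) \<ge>
    (\<Sum>J\<in>Pow {1..n}. (\<Sum>R\<in>Pow J. card (cycle_graphs R) * card {E. rooted_forest J R E})
       * card {E. labelled_forest ({1..n} - J) t E})"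
proof -
  define X where "X = (SIGMA J:Pow {1..n}. (SIGMA R:Pow J. cycle_graphs R \<times> {E. rooted_forest J R E})
      \<times> {E. labelled_forest ({1..n} - J) t E})"
  define f where "f = (\<lambda>(J :: nat set, (R :: nat set, C, E1), E2). C \<union> E1 \<union> E2 :: nat set set)"
  have mem: "J \<subseteq> {1..n}" "R \<subseteq> J" "finite R" "finite J" "C \<in> cycle_graphs R" "rooted_forest J R E1"
    "labelled_forest ({1..n} - J) t E2" "simple_graph R C" "simple_graph J E1"
    "simple_graph ({1..n} - J) E2" if "(J, (R, C, E1), E2) \<in> X" for J R C E1 E2
  proof -
    show J: "J \<subseteq> {1..n}" and R: "R \<subseteq> J" and C: "C \<in> cycle_graphs R" and E1: "rooted_forest J R E1"
      and E2: "labelled_forest ({1..n} - J) t E2"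
      using that by (auto simp: X_def)
    show "finite J" using J finite_subset by blast
    then show "finite R" using R finite_subset by blast
    show "simple_graph R C" using C by (simp add: cycle_graphs_def two_regular_def)
    show "simple_graph J E1" using rooted_forest_edges[OF E1] .
    show "simple_graph ({1..n} - J) E2" using labelled_forest_edges[OF E2] .
  qed
  have ext: "leaf_ext R C {1..n} (f (J, (R, C, E1), E2)) t" if X: "(J, (R, C, E1), E2) \<in> X" for J R C E1 E2
  proof -
    note m = mem[OF X]
    have "leaf_ext R C (R \<union> J) (C \<union> E1) 0"
      by (rule rooted_forest_leaf_ext[OF m(6,4) leaf_ext.start]) (use m in auto)
    moreover have "R \<union> J = J" using m by auto
    ultimately have "leaf_ext R C J (C \<union> E1) 0" by simp
    then have "leaf_ext R C (J \<union> ({1..n} - J)) (C \<union> E1 \<union> E2) (0 + t)"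
      by (rule labelled_forest_leaf_ext[OF m(7), rotated]) auto
    moreover have "J \<union> ({1..n} - J) = {1..n}" using m by auto
    ultimately show ?thesis by (simp add: f_def)
  qed
  have maps: "f ` X \<subseteq> planar_graphs n (n - t)"
  proof
    fix F assume "F \<in> f ` X"
    then obtain J R C E1 E2 where F: "F = f (J, (R, C, E1), E2)" and X: "(J, (R, C, E1), E2) \<in> X" by auto
    note m = mem[OF X] and e = ext[OF X, folded F]
    have facts: "simple_graph {1..n} F" "card F + card R + t = card C + card {1..n}"
      using leaf_ext_facts[OF e m(3,8)] by auto
    \<comment> \<open>On the cycles, edges and vertices balance, and leaves keep the balance; so the
      edge count falls short of \<open>n\<close> by the \<open>t\<close> isolated starting vertices
      only.\<close>
    have "card C = card R" "convex_drawable R C" using m(5) by (auto simp: cycle_graphs_def two_regular_def)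
    then have "card F = n - t" "planar {1..n} F"
      using facts leaf_ext_convex_drawable[OF e m(3,8)] convex_drawable_planar by auto
    then show "F \<in> planar_graphs n (n - t)" using facts by (simp add: planar_graphs_def)
  qed
  have core: "two_core (f (J, (R, C, E1), E2)) = R" if X: "(J, (R, C, E1), E2) \<in> X" for J R C E1 E2
    using two_core_leaf_ext[OF ext[OF X] mem(8)[OF X] mem(3)[OF X]] mem(5)[OF X]
    by (auto simp: cycle_graphs_def two_regular_def)
  have inj: "inj_on f X"
  proof (rule inj_onI)
    fix p q assume pq: "p \<in> X" "q \<in> X" "f p = f q"
    obtain J R C E1 E2 where p: "p = (J, (R, C, E1), E2)" by (cases p) auto
    obtain J' R' C' F1 F2 where q: "q = (J', (R', C', F1), F2)" by (cases q) auto
    have X1: "(J, (R, C, E1), E2) \<in> X" and X2: "(J', (R', C', F1), F2) \<in> X"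
      and eq: "f (J, (R, C, E1), E2) = f (J', (R', C', F1), F2)" using pq p q by auto
    have RR: "R = R'" using core[OF X1] core[OF X2] eq by simp
    have sub: "J \<subseteq> J'" if X1: "(J, (R, C, E1), E2) \<in> X" and X2: "(J', (R, C', F1), F2) \<in> X"
      and eq: "f (J, (R, C, E1), E2) = f (J', (R, C', F1), F2)" for J R C E1 E2 J' C' F1 F2
    proof (rule rooted_forest_connected[OF mem(6)[OF X1]])
      show "R \<subseteq> J'" using mem(2)[OF X2] .
      fix e assume "e \<in> E1" "e \<inter> J' \<noteq> {}"
      then have "e \<in> C' \<or> e \<in> F1 \<or> e \<in> F2" using eq by (auto simp: f_def)
      then consider "e \<subseteq> R" | "e \<subseteq> J'" | "e \<subseteq> {1..n} - J'"
        using mem(8-10)[OF X2] unfolding simple_graph_def by blast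
      then show "e \<subseteq> J'" using mem(2)[OF X2] \<open>e \<inter> J' \<noteq> {}\<close> by cases auto
    qed
    have JJ: "J = J'" using sub[of J R C E1 E2 J' C' F1 F2] sub[of J' R C' F1 F2 J C E1 E2] X1 X2 eq RR by auto
    \<comment> \<open>The three edge sets are separated by position: inside \<open>R\<close>, inside
      \<open>J\<close> but not inside \<open>R\<close>, and outside \<open>J\<close>. This relies on
      a rooted forest having no edge within its root set.\<close>
    have parts: "C = {e \<in> f (J, (R, C, E1), E2). e \<subseteq> R} \<and>
        E1 = {e \<in> f (J, (R, C, E1), E2). e \<subseteq> J \<and> \<not> e \<subseteq> R} \<and>
        E2 = {e \<in> f (J, (R, C, E1), E2). \<not> e \<subseteq> J}" if X: "(J, (R, C, E1), E2) \<in> X" for J R C E1 E2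
    proof -
      note m = mem[OF X]
      have "e \<subseteq> R \<and> e \<subseteq> J" if "e \<in> C" for e using that m(2,8) unfolding simple_graph_def by blast
      moreover have "e \<subseteq> J \<and> \<not> e \<subseteq> R" if "e \<in> E1" for e
        using that m(9) rooted_forest_edge_not_roots[OF m(6) that] unfolding simple_graph_def by blast
      moreover have "\<not> e \<subseteq> J \<and> \<not> e \<subseteq> R" if "e \<in> E2" for e
      proof -
        have "e \<subseteq> {1..n} - J" "card e = 2" using m(10) that by (auto simp: simple_graph_def)
        moreover from this have "e \<noteq> {}" by auto
        ultimately show ?thesis using m(2) by blast
      qed
      ultimately show ?thesis unfolding f_def by auto
    qed
    show "p = q" unfolding p q using RR JJ parts[OF X1] parts[OF X2] eq by simp
  qed
  have "card X \<le> card (planar_graphs n (n - t))"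
    using card_inj_on_le[OF inj maps finite_planar_graphs] .
  moreover have "card X = (\<Sum>J\<in>Pow {1..n}. (\<Sum>R\<in>Pow J. card (cycle_graphs R) * card {E. rooted_forest J R E})
       * card {E. labelled_forest ({1..n} - J) t E})"
  proof -
    have fin: "finite (cycle_graphs R \<times> {E. rooted_forest J R E})" if "J \<subseteq> {1..n}" "R \<subseteq> J" for J R
    proof -
      have "finite J" "finite R" using that by (auto intro: finite_subset)
      then show ?thesis by (simp add: finite_cycle_graphs finite_rooted_forests)
    qed
    have fin2: "finite (SIGMA R:Pow J. cycle_graphs R \<times> {E. rooted_forest J R E})" if "J \<subseteq> {1..n}" for J
    proof (rule finite_SigmaI)
      show "finite (Pow J)" using that finite_subset by auto
    qed (use fin that in blast)
    have c2: "card (SIGMA R:Pow J. cycle_graphs R \<times> {E. rooted_forest J R E})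
        = (\<Sum>R\<in>Pow J. card (cycle_graphs R) * card {E. rooted_forest J R E})" if "J \<subseteq> {1..n}" for J
    proof -
      have "card (SIGMA R:Pow J. cycle_graphs R \<times> {E. rooted_forest J R E})
        = (\<Sum>R\<in>Pow J. card (cycle_graphs R \<times> {E. rooted_forest J R E}))"
      proof (rule card_SigmaI)
        show "finite (Pow J)" using that finite_subset by auto
      qed (use fin that in blast)
      then show ?thesis by (simp add: card_cartesian_product)
    qed
    have "card X = (\<Sum>J\<in>Pow {1..n}. card ((SIGMA R:Pow J. cycle_graphs R \<times> {E. rooted_forest J R E})
      \<times> {E. labelled_forest ({1..n} - J) t E}))"
      unfolding X_def
    proof (rule card_SigmaI)
      show "\<forall>J\<in>Pow {1..n}. finite ((SIGMA R:Pow J. cycle_graphs R \<times> {E. rooted_forest J R E})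
          \<times> {E. labelled_forest ({1..n} - J) t E})"
        using fin2 finite_labelled_forests by (intro ballI finite_cartesian_product) auto
    qed simp
    also have "\<dots> = (\<Sum>J\<in>Pow {1..n}. (\<Sum>R\<in>Pow J. card (cycle_graphs R) * card {E. rooted_forest J R E})
       * card {E. labelled_forest ({1..n} - J) t E})"
      by (rule sum.cong) (auto simp: card_cartesian_product c2)
    finally show ?thesis .
  qed
  ultimately show ?thesis by simp
qed


text \<open>For \<open>j = card J\<close> of order \<open>x^2\<close>, the factor
  \<open>j^(-3/4)\<close> is at least of order \<open>n^(-1/2)\<close>, and Stirling's bound for
  \<open>fact j\<close> reduces the rest to coefficients of the tree power, whose mass in the window
  is known. The constant is \<open>exp (-1) / 80\<close> times
  \<open>exp (-12) * 2/3\<close>.\<close>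

lemma card_planar_graphs_ge_mass:
  fixes x C :: real
  assumes n: "real n = x ^ 3" and x: "x \<ge> 11" and C: "C \<ge> 2" and t: "t \<le> n"
    and t_lo: "real n - 2 * real t \<le> 2 * C * x\<^sup>2" and t_up: "2 * real t \<le> real n - 2 * C * x\<^sup>2 + 2"
  shows "real (card (planar_graphs n (n - t))) \<ge>
    (exp (-13) / 120 * (2 * C + 6) powr (-3/4)) *
      (fact n * exp (real n) * real n powr (-1/2) * (1/2) ^ t / fact t)"
proof -
  \<comment> \<open>The window for \<open>N\<close> starts at \<open>2 t - 6 x^2\<close>, so
    \<open>j = n - N\<close> is at most \<open>n - 2 t + 6 x^2 \<le> (2 C + 6) x^2\<close>.\<close>
  define A where "A = 2 * C + 6"
  define P where "P = fps_nth (Abs_fps tree_weight ^ t)"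
  have Pnn: "P N \<ge> 0" for N unfolding P_def by (rule fps_power_nonneg[OF tree_weight_nonneg])
  have x2: "x\<^sup>2 \<ge> 121" using power_mono[OF x, of 2] by simp
  have Cx: "C * x\<^sup>2 \<ge> 2 * x\<^sup>2" using C by (intro mult_right_mono) auto
  define G where "G = {j. 100 \<le> j \<and> j \<le> n \<and> real j \<le> A * x\<^sup>2}"
  define U where "U j = (if j \<ge> 100 then real j powr (real j - 1/4) / 80 else 0)" for j :: nat
  define L where "L N = fact N * exp (real N) / fact t * P N" for N
  define K where "K = exp (-1) / 80 * A powr (-3/4) * (fact n * exp (real n) * real n powr (-1/2) / fact t)"
  have Unn: "U j \<ge> 0" and Lnn: "L j \<ge> 0" for j using Pnn by (auto simp: U_def L_def)
  have K0: "K \<ge> 0" by (simp add: K_def)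
  have term_ge: "K * P (n - j) \<le> real (n choose j) * (U j * L (n - j))" if "j \<in> G" for j
  proof -
    have j: "j \<ge> 100" "j \<le> n" "real j \<le> A * x\<^sup>2" using that by (auto simp: G_def)
    have "fact j \<le> exp 1 * real j powr (real j + 1/2) * exp (- real j)"
      by (rule fact_upper_stirling) (use j in simp)
    also have "real j powr (real j + 1/2) = real j powr (real j - 1/4) * real j powr (3/4)"
      by (simp add: add.commute flip: powr_add)
    finally have f: "fact j * (exp (-1) * real j powr (-3/4) * exp (real j)) \<le> real j powr (real j - 1/4)"
    proof -
      assume a: "fact j \<le> exp 1 * (real j powr (real j - 1/4) * real j powr (3/4)) * exp (- real j)"
      have "fact j * (exp (-1) * real j powr (-3/4) * exp (real j))
        \<le> exp 1 * (real j powr (real j - 1/4) * real j powr (3/4)) * exp (- real j)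
            * (exp (-1) * real j powr (-3/4) * exp (real j))"
        by (rule mult_right_mono[OF a]) auto
      also have "\<dots> = (exp 1 * exp (-1)) * (exp (- real j) * exp (real j))
          * (real j powr (3/4) * real j powr (-3/4)) * real j powr (real j - 1/4)"
        by (simp only: mult_ac)
      also have "\<dots> = real j powr (real j - 1/4)"
        using j by (simp flip: exp_add powr_add)
      finally show ?thesis .
    qed
    have jp: "A powr (-3/4) * real n powr (-1/2) \<le> real j powr (-3/4)"
    proof -
      have "(A * x\<^sup>2) powr (-3/4) \<le> real j powr (-3/4)"
        using j by (intro powr_mono2') auto
      moreover have "(A * x\<^sup>2) powr (-3/4) = A powr (-3/4) * (x\<^sup>2) powr (-3/4)"
        using C by (simp add: powr_mult A_def)
      moreover have "(x\<^sup>2) powr (-3/4) = real n powr (-1/2)"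
      proof -
        have p: "x\<^sup>2 = x powr 2" "x ^ 3 = x powr 3" using x by simp_all
        show ?thesis unfolding n p powr_powr by simp
      qed
      ultimately show ?thesis by simp
    qed
    have "K * P (n - j) = (fact n * exp (real n) / fact t * P (n - j) / 80 * exp (-1)) * (A powr (-3/4) * real n powr (-1/2))"
      by (simp add: K_def mult_ac)
    also have "\<dots> \<le> (fact n * exp (real n) / fact t * P (n - j) / 80 * exp (-1)) * real j powr (-3/4)"
      using Pnn by (intro mult_left_mono jp) auto
    also have "\<dots> = (fact n / fact j * exp (real (n - j)) / fact t * P (n - j) / 80)
        * (fact j * (exp (-1) * real j powr (-3/4) * exp (real j)))"
    proof -
      have "exp (real n) = exp (real (n - j)) * exp (real j)" using j by (simp flip: exp_add)
      then show ?thesis by (simp add: field_simps)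
    qed
    also have "\<dots> \<le> (fact n / fact j * exp (real (n - j)) / fact t * P (n - j) / 80) * real j powr (real j - 1/4)"
      using Pnn by (intro mult_left_mono f) auto
    also have "\<dots> = real (n choose j) * (U j * L (n - j))"
      using j by (simp add: U_def L_def binomial_fact mult_ac)
    finally show ?thesis .
  qed
  let ?B = "{N. 2 * real t - 6 * x\<^sup>2 \<le> real N \<and> real N \<le> 2 * real t + 3 * x\<^sup>2}"
  have tx: "real t \<le> x ^ 3 / 2" using t_up Cx x2 n by linarith
  have "K * (exp (-12) * (2/3) * (1/2) ^ t) \<le> K * (\<Sum>N\<in>?B. P N)"
    using tree_weight_power_mass[of x t] x tx K0 by (intro mult_left_mono) (auto simp: P_def)
  also have "\<dots> \<le> K * (\<Sum>j\<in>G. P (n - j))"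
  proof (intro mult_left_mono K0)
    have "(\<Sum>N\<in>?B. P N) \<le> (\<Sum>N\<in>(\<lambda>j. n - j) ` G. P N)"
    proof (rule sum_mono2)
      show "finite ((\<lambda>j. n - j) ` G)" by (simp add: G_def)
      show "?B \<subseteq> (\<lambda>j. n - j) ` G"
      proof
        fix N assume "N \<in> ?B"
        then have N: "2 * real t - 6 * x\<^sup>2 \<le> real N" "real N \<le> 2 * real t + 3 * x\<^sup>2" by auto
        \<comment> \<open>\<open>n - N\<close> is at least
          \<open>2 C x^2 - 2 - 3 x^2 \<ge> x^2 - 2\<close>; with \<open>C \<ge> 2\<close> and
          \<open>x \<ge> 11\<close> this supplies the 100 vertices demanded by the unicyclic
          bound.\<close>
        have N100: "real N \<le> real n - 100" using N(2) t_up Cx x2 by linarith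
        then have "n - N \<in> G"
          using N(1) t_lo by (simp add: G_def A_def of_nat_diff algebra_simps)
        moreover have "N = n - (n - N)" using N100 by simp
        ultimately show "N \<in> (\<lambda>j. n - j) ` G" by blast
      qed
    qed (auto intro: Pnn)
    also have "\<dots> = (\<Sum>j\<in>G. P (n - j))"
      by (subst sum.reindex) (auto simp: inj_on_def G_def)
    finally show "(\<Sum>N\<in>?B. P N) \<le> (\<Sum>j\<in>G. P (n - j))" .
  qed
  also have "\<dots> = (\<Sum>j\<in>G. K * P (n - j))" by (rule sum_distrib_left)
  also have "\<dots> \<le> (\<Sum>j\<in>G. real (n choose j) * (U j * L (n - j)))" by (intro sum_mono term_ge)
  also have "\<dots> \<le> (\<Sum>j\<le>n. real (n choose j) * (U j * L (n - j)))"
    by (rule sum_mono2) (auto simp: G_def Unn Lnn)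
  also have "\<dots> = (\<Sum>J\<in>Pow {1..n}. U (card J) * L (n - card J))"
    using sum_Pow_card[of "{1..n}" "\<lambda>j. U j * L (n - j)"] by simp
  also have "\<dots> \<le> (\<Sum>J\<in>Pow {1..n}. (\<Sum>R\<in>Pow J. real (card (cycle_graphs R)) * real (card {E. rooted_forest J R E}))
       * real (card {E. labelled_forest ({1..n} - J) t E}))"
  proof (rule sum_mono)
    fix J assume "J \<in> Pow {1..n}"
    then have J: "J \<subseteq> {1..n}" "finite J" using finite_subset by auto
    have "U (card J) \<le> (\<Sum>R\<in>Pow J. real (card (cycle_graphs R)) * real (card {E. rooted_forest J R E}))"
      using card_unicyclic_lower[OF J(2)] by (auto simp: U_def intro!: sum_nonneg)
    moreover have "L (n - card J) \<le> real (card {E. labelled_forest ({1..n} - J) t E})"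
      using card_labelled_forests[of "{1..n} - J" t] J by (simp add: L_def P_def card_Diff_subset)
    ultimately show "U (card J) * L (n - card J) \<le>
      (\<Sum>R\<in>Pow J. real (card (cycle_graphs R)) * real (card {E. rooted_forest J R E}))
       * real (card {E. labelled_forest ({1..n} - J) t E})"
      by (intro mult_mono Lnn) (auto intro!: sum_nonneg)
  qed
  also have "\<dots> \<le> real (card (planar_graphs n (n - t)))"
    using of_nat_mono[OF card_planar_graphs_ge[OF t], where ?'a = real] by simp
  finally have "K * (exp (-12) * (2/3) * (1/2) ^ t) \<le> real (card (planar_graphs n (n - t)))" .
  moreover have "K * (exp (-12) * (2/3) * (1/2) ^ t) = (exp (-13) / 120 * A powr (-3/4)) *
      (fact n * exp (real n) * real n powr (-1/2) * (1/2) ^ t / fact t)"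
  proof -
    have "exp (-13 :: real) = exp (-1) * exp (-12)" by (simp flip: exp_add)
    then show ?thesis by (simp add: K_def mult_ac)
  qed
  ultimately show ?thesis by (simp only: A_def)
qed

section \<open>The proportion of planar graphs\<close>

lemma real_choose_two: "n \<ge> 2 \<Longrightarrow> real (n choose 2) = real n * (real n - 1) / 2"
  using binomial_prod[of n 2] by (simp add: numeral_2_eq_2)

lemma le_choose_two: "n \<ge> 3 \<Longrightarrow> n \<le> n choose 2"
  using div_le_mono[of "n * 2" "n * (n - 1)" 2] mult_left_mono[of 2 "n - 1" n] by (simp add: choose_two)

definition all_graphs :: "nat \<Rightarrow> nat \<Rightarrow> nat set set set" where
  "all_graphs n m = {E. simple_graph {1..n} E \<and> card E = m}"

definition vertex_pairs :: "nat \<Rightarrow> nat set set" where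
  "vertex_pairs n = {e. e \<subseteq> {1..n} \<and> card e = 2}"

lemma finite_vertex_pairs: "finite (vertex_pairs n)"
  by (rule finite_subset[of _ "Pow {1..n}"]) (auto simp: vertex_pairs_def)

lemma card_vertex_pairs: "card (vertex_pairs n) = n choose 2"
  unfolding vertex_pairs_def by (subst n_subsets) auto

lemma all_graphs_eq: "all_graphs n m = {E. E \<subseteq> vertex_pairs n \<and> card E = m}"
  by (auto simp: all_graphs_def vertex_pairs_def simple_graph_def)

lemma finite_all_graphs: "finite (all_graphs n m)"
  unfolding all_graphs_eq using finite_vertex_pairs by simp

lemma card_all_graphs: "card (all_graphs n m) = (n choose 2) choose m"
  unfolding all_graphs_eq by (simp add: n_subsets finite_vertex_pairs card_vertex_pairs)

lemma planar_graphs_subset: "planar_graphs n m \<subseteq> all_graphs n m"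
  by (auto simp: planar_graphs_def all_graphs_def)

text \<open>Double counting of planar graphs with a marked edge: deleting the edge leaves a planar
  graph with a marked non-edge.\<close>

lemma card_planar_graphs_Suc:
  "card (planar_graphs n (Suc m)) * Suc m \<le> card (planar_graphs n m) * ((n choose 2) - m)"
proof -
  define A where "A = (SIGMA F:planar_graphs n (Suc m). F)"
  define B where "B = (SIGMA E:planar_graphs n m. vertex_pairs n - E)"
  define f where "f = (\<lambda>(F, e). (F - {e}, e :: nat set))"
  have fin: "finite E" if "E \<in> planar_graphs n k" for E k
  proof -
    have "E \<subseteq> vertex_pairs n" using that planar_graphs_subset[of n k] by (auto simp: all_graphs_eq)
    then show ?thesis using finite_vertex_pairs finite_subset by blast
  qed
  have "f ` A \<subseteq> B"
  proof
    fix p assume "p \<in> f ` A"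
    then obtain F e where p: "p = (F - {e}, e)" and F: "F \<in> planar_graphs n (Suc m)" and e: "e \<in> F"
      by (auto simp: A_def f_def)
    have sg: "simple_graph {1..n} F" "card F = Suc m" "planar {1..n} F"
      using F by (auto simp: planar_graphs_def)
    have "simple_graph {1..n} (F - {e})" using sg(1) by (auto simp: simple_graph_def)
    moreover have "card (F - {e}) = m" using sg(2) e fin[OF F] by simp
    moreover have "planar {1..n} (F - {e})" by (rule planar_mono[OF sg(3)]) auto
    moreover have "e \<in> vertex_pairs n" using sg(1) e by (auto simp: simple_graph_def vertex_pairs_def)
    ultimately show "p \<in> B" by (simp add: p B_def planar_graphs_def)
  qed
  moreover have "inj_on f A"
  proof (rule inj_onI)
    fix p q assume "p \<in> A" "q \<in> A" "f p = f q"
    then show "p = q" by (cases p, cases q) (auto simp: A_def f_def)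
  qed
  moreover have "finite B"
    unfolding B_def by (intro finite_SigmaI finite_planar_graphs finite_Diff finite_vertex_pairs)
  ultimately have "card A \<le> card B" using card_inj_on_le by blast
  moreover have "card A = card (planar_graphs n (Suc m)) * Suc m"
  proof -
    have "card A = (\<Sum>F\<in>planar_graphs n (Suc m). card F)"
      unfolding A_def using fin finite_planar_graphs by (intro card_SigmaI) auto
    also have "\<dots> = (\<Sum>F\<in>planar_graphs n (Suc m). Suc m)" by (rule sum.cong) (auto simp: planar_graphs_def)
    finally show ?thesis by simp
  qed
  moreover have "card B = card (planar_graphs n m) * ((n choose 2) - m)"
  proof -
    have "card B = (\<Sum>E\<in>planar_graphs n m. card (vertex_pairs n - E))"
      unfolding B_def using finite_vertex_pairs finite_planar_graphs by (intro card_SigmaI) auto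
    also have "\<dots> = (\<Sum>E\<in>planar_graphs n m. (n choose 2) - m)"
    proof (rule sum.cong[OF refl])
      fix E assume E: "E \<in> planar_graphs n m"
      then have "E \<subseteq> vertex_pairs n" "card E = m" using planar_graphs_subset[of n m] by (auto simp: all_graphs_eq)
      then show "card (vertex_pairs n - E) = (n choose 2) - m"
        using fin[OF E] by (simp add: card_Diff_subset card_vertex_pairs)
    qed
    finally show ?thesis by simp
  qed
  ultimately show ?thesis by simp
qed

text \<open>For all graphs the preceding double count is an equality, so the planar proportion
  cannot grow with the number of edges.\<close>

lemma planar_fraction_antimono:
  assumes "k \<le> m" "m \<le> n choose 2" "c * real (card (all_graphs n m)) \<le> real (card (planar_graphs n m))"
  shows "c * real (card (all_graphs n k)) \<le> real (card (planar_graphs n k))"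
  using assms
proof (induction m rule: dec_induct)
  case (step m)
  define N where "N = n choose 2"
  have mN: "m < N" using step.prems by (simp add: N_def)
  have ab: "real (N choose Suc m) * real (Suc m) = real (N choose m) * real (N - m)"
  proof -
    have "(N choose Suc m) * Suc m = (N choose m) * (N - m)"
      using binomial_absorb_comp[of N m] binomial_absorption[of m N] by (simp add: mult.commute)
    then show ?thesis by (metis of_nat_mult)
  qed
  have "c * real (N choose Suc m) * real (Suc m) \<le> real (card (planar_graphs n (Suc m))) * real (Suc m)"
    using step.prems(2) by (intro mult_right_mono) (auto simp: card_all_graphs N_def)
  also have "\<dots> \<le> real (card (planar_graphs n m)) * real (N - m)"
    using of_nat_mono[OF card_planar_graphs_Suc[of n m], where ?'a = real] by (simp only: N_def of_nat_mult)
  finally have "c * real (N choose m) * real (N - m) \<le> real (card (planar_graphs n m)) * real (N - m)"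
    using ab by (simp add: mult.assoc)
  then have "c * real (N choose m) \<le> real (card (planar_graphs n m))" using mN by simp
  then show ?case using step by (simp add: card_all_graphs N_def)
qed

text \<open>The left-hand side has derivative \<open>ln (1 - y^2)\<close>, so its linear and
  quadratic terms cancel. The cubic error is what tolerates a deviation of order
  \<open>n^(2/3)\<close> from \<open>n / 2\<close> edges.\<close>

lemma entropy_diff_lower:
  fixes y :: real
  assumes "0 \<le> y" "y \<le> 1/2"
  shows "(1 + y) * ln (1 + y) - (1 - y) * ln (1 - y) - 2 * y \<ge> - (2/3) * y ^ 3"
proof -
  define g where "g = (\<lambda>u::real. (1 + u) * ln (1 + u) - (1 - u) * ln (1 - u) - 2 * u + (2/3) * u ^ 3)"
  have "g 0 \<le> g y"
  proof (rule DERIV_nonneg_imp_nondecreasing[OF assms(1)])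
    fix u :: real assume u: "0 \<le> u" "u \<le> y"
    then have u1: "0 \<le> u" "u \<le> 1/2" using assms by auto
    have "(g has_real_derivative (ln (1 + u) + (1 + u) * (1 / (1 + u))
        - ((1 - u) * (- 1 / (1 - u)) - ln (1 - u)) - 2 + (2/3) * (3 * u\<^sup>2))) (at u)"
      unfolding g_def using u1 by (auto intro!: derivative_eq_intros)
    then have "(g has_real_derivative (ln (1 + u) + ln (1 - u) + 2 * u\<^sup>2)) (at u)"
      using u1 by simp
    moreover have "ln (1 + u) + ln (1 - u) = ln (1 - u\<^sup>2)"
    proof -
      have "1 - u\<^sup>2 = (1 + u) * (1 - u)" by (simp add: power2_eq_square algebra_simps)
      moreover have "1 + u > 0" "1 - u > 0" using u1 by auto
      ultimately show ?thesis using ln_mult[of "1 + u" "1 - u"] by simp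
    qed
    moreover have "- 2 * u\<^sup>2 \<le> ln (1 - u\<^sup>2)"
    proof -
      have "u\<^sup>2 \<le> (1/2)\<^sup>2" using u1 by (intro power_mono) auto
      then have "u\<^sup>2 \<le> 1/2" by (simp add: power2_eq_square)
      then have "exp (- 2 * u\<^sup>2) \<le> 1 - u\<^sup>2" by (intro exp_le_one_minus) auto
      then show ?thesis by (subst ln_ge_iff) (use \<open>u\<^sup>2 \<le> 1/2\<close> in auto)
    qed
    ultimately show "\<exists>z. (g has_real_derivative z) (at u) \<and> 0 \<le> z" by force
  qed
  then show ?thesis by (simp add: g_def)
qed

lemma binomial_le_pow_div_fact: "real (N choose m) \<le> real N ^ m / fact m"
proof (cases "m \<le> N")
  case True
  have "(\<Prod>i=0..<m. real N - real i) \<le> (\<Prod>i=0..<m. real N)" using True by (intro prod_mono) auto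
  then show ?thesis by (simp add: le_divide_eq binomial_prod)
qed (simp add: binomial_eq_0)

text \<open>With \<open>m = n (1 + y) / 2\<close> and \<open>t = n (1 - y) / 2\<close>, the terms of
  order \<open>n ln n\<close> and \<open>n\<close> cancel, and the entropy bound costs
  \<open>n y^3 / 3 \<le> (8/3) C^3\<close>. The further \<open>- 1\<close> in the exponent pays for
  the upper Stirling bound of \<open>fact t\<close>.\<close>

lemma all_graphs_upper:
  fixes C x :: real
  assumes n: "n = m + t" "real n = x ^ 3" "x > 0" and tm: "1 \<le> t" "t \<le> m"
    and d: "real m - real t \<le> 2 * C * x\<^sup>2" "2 * C \<le> x / 2"
  shows "exp (- (8/3) * C ^ 3 - 1) * real (card (all_graphs n m))
    \<le> fact n * exp (real n) * real n powr (-1/2) * (1/2) ^ t / fact t"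
proof -
  have n0: "n > 0" using n tm by simp
  have m0: "m \<ge> 1" using tm by simp
  define y where "y = (real m - real t) / real n"
  have y0: "0 \<le> y" using tm by (simp add: y_def)
  have yx: "y \<le> 2 * C / x"
  proof -
    have "y \<le> 2 * C * x\<^sup>2 / x ^ 3" unfolding y_def n(2) using d n(3) by (intro divide_right_mono) auto
    also have "\<dots> = 2 * C / x" using n(3) by (simp add: power2_eq_square power3_eq_cube)
    finally show ?thesis .
  qed
  also have "2 * C / x \<le> 1/2" using d n(3) by (simp add: divide_le_eq)
  finally have y2: "y \<le> 1/2" .
  have my: "real m = real n / 2 * (1 + y)" "real t = real n / 2 * (1 - y)"
    using n0 n(1) by (auto simp: y_def field_simps)
  have y3: "real n * y ^ 3 \<le> 8 * C ^ 3"
  proof -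
    have "y ^ 3 \<le> (2 * C / x) ^ 3" using yx y0 by (intro power_mono) auto
    then have "real n * y ^ 3 \<le> real n * (2 * C / x) ^ 3" by (intro mult_left_mono) auto
    also have "\<dots> = 8 * C ^ 3" unfolding n(2) using n(3) by (simp add: power_divide power_mult_distrib)
    finally show ?thesis .
  qed
  have h: "(real n - 2 * real m) * ln (real n) + (real m - real t) * ln 2 + real m * ln (real m)
      - real t * ln (real t) - (real m - real t) \<ge> - (8/3) * C ^ 3"
  proof -
    have lm: "ln (real m) = ln (real n) - ln 2 + ln (1 + y)"
      unfolding my(1) using n0 y0 by (simp add: ln_mult ln_div)
    have lt: "ln (real t) = ln (real n) - ln 2 + ln (1 - y)"
      unfolding my(2) using n0 y2 by (simp add: ln_mult ln_div)
    have rn: "real n = real m + real t" using n(1) by simp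
    have "(real n - 2 * real m) * ln (real n) + (real m - real t) * ln 2 + real m * ln (real m)
      - real t * ln (real t) - (real m - real t)
      = real m * ln (1 + y) - real t * ln (1 - y) - (real m - real t)"
      unfolding lm lt rn by (simp add: algebra_simps)
    also have "\<dots> = real n / 2 * ((1 + y) * ln (1 + y) - (1 - y) * ln (1 - y) - 2 * y)"
      unfolding my by (simp add: algebra_simps add_divide_distrib diff_divide_distrib)
    also have "\<dots> \<ge> real n / 2 * (- (2/3) * y ^ 3)"
      using entropy_diff_lower[OF y0 y2] by (intro mult_left_mono) auto
    finally show ?thesis using y3 by (simp add: algebra_simps)
  qed
  have "real (card (all_graphs n m)) \<le> real (n choose 2) ^ m / fact m"
    unfolding card_all_graphs by (rule binomial_le_pow_div_fact)
  also have "\<dots> \<le> (real n ^ 2 / 2) ^ m / fact m"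
    using binomial_le_pow_div_fact[of n 2] by (intro divide_right_mono power_mono) (auto simp: fact_numeral)
  finally have up: "real (card (all_graphs n m)) \<le> (real n ^ 2 / 2) ^ m / fact m" .
  have "exp (- (8/3) * C ^ 3 - 1) * ((real n ^ 2 / 2) ^ m / fact m)
    \<le> fact n * exp (real n) * real n powr (-1/2) * (1/2) ^ t / fact t" (is "?l \<le> ?r")
  proof -
    have l0: "?l > 0" "?r > 0" using n0 by auto
    have l: "ln ?l = - (8/3) * C ^ 3 - 1 + (real m * (2 * ln (real n) - ln 2) - ln (fact m))"
      using n0 by (simp add: ln_mult ln_div ln_realpow)
    have r: "ln ?r = ln (fact n) + real n - ln (real n) / 2 - real t * ln 2 - ln (fact t)"
      using n0 by (simp add: ln_mult ln_div ln_realpow ln_powr)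
    have "ln ?l \<le> ln ?r"
    proof -
      have 1: "(real n + 1/2) * ln (real n) - real n \<le> ln (fact n)" using ln_fact_bounds(1)[of n] n0 by simp
      have 2: "(real m + 1/2) * ln (real m) - real m \<le> ln (fact m)" using ln_fact_bounds(1)[of m] m0 by simp
      have 3: "ln (fact t) \<le> (real t + 1/2) * ln (real t) - real t + 1" using ln_fact_bounds(2)[of t] tm by simp
      have 4: "ln (real t) \<le> ln (real m)" using tm by simp
      \<comment> \<open>The leftover \<open>(ln m - ln t) / 2\<close> from Stirling has the right
        sign because \<open>t \<le> m\<close>.\<close>
      show ?thesis unfolding l r using 1 2 3 4 h by (simp add: algebra_simps)
    qed
    then show ?thesis using l0 by (subst (asm) ln_le_cancel_iff)
  qed
  with mult_left_mono[OF up, of "exp (- (8/3) * C ^ 3 - 1)"] show ?thesis by simp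
qed

text \<open>Pseudoforests are counted at \<open>M\<close>, the largest edge number in the window for
  \<open>D = max C 2\<close>; monotonicity of the proportion carries the bound down to
  \<open>m n\<close>.\<close>

lemma planar_fraction_lower:
  fixes m :: "nat \<Rightarrow> nat" and C :: real
  assumes m: "\<And>n. n \<ge> 1 \<Longrightarrow> real (m n) \<le> real n / 2 + C * real n powr (2/3)"
  shows "\<exists>c>0. \<forall>\<^sub>F n in sequentially. c * real (card (all_graphs n (m n))) \<le> real (card (planar_graphs n (m n)))"
proof -
  define D where "D = max C 2"
  define c where "c = (exp (-13) / 120 * (2 * D + 6) powr (-3/4)) * exp (- (8/3) * D ^ 3 - 1)"
  have D2: "D \<ge> 2" by (simp add: D_def)
  have c0: "c > 0" using D2 by (simp add: c_def)
  \<comment> \<open>\<open>x \<ge> 4 D\<close> gives \<open>2 D \<le> x / 2\<close>, which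
    \<open>all_graphs_upper\<close> needs for \<open>y \<le> 1/2\<close>; \<open>x \<ge> 11\<close>
    is the demand of the lower bound.\<close>
  have ev: "\<forall>\<^sub>F n in sequentially. real n powr (1/3) \<ge> max 11 (4 * D)"
    by real_asymp
  have "\<forall>\<^sub>F n in sequentially. c * real (card (all_graphs n (m n))) \<le> real (card (planar_graphs n (m n)))"
    using ev eventually_ge_at_top[of 10]
  proof eventually_elim
    case (elim n)
    define x where "x = real n powr (1/3)"
    have x: "x \<ge> 11" "x \<ge> 4 * D" using elim by (auto simp: x_def)
    have p: "x\<^sup>2 = x powr 2" "x ^ 3 = x powr 3" using x by simp_all
    have x3: "real n = x ^ 3" unfolding p unfolding x_def powr_powr using elim by simp
    have x2: "real n powr (2/3) = x\<^sup>2" unfolding p unfolding x_def powr_powr by simp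
    have xx: "x\<^sup>2 \<ge> 121" using power_mono[OF x(1), of 2] by simp
    have Dx0: "D * x\<^sup>2 \<ge> 2 * x\<^sup>2" using D2 by (intro mult_right_mono) auto
    have Dx: "D * x\<^sup>2 \<le> real n / 4"
    proof -
      have "4 * D * x\<^sup>2 \<le> x * x\<^sup>2" using x by (intro mult_right_mono) auto
      then show ?thesis by (simp add: x3 power2_eq_square power3_eq_cube)
    qed
    define M where "M = nat \<lfloor>real n / 2 + D * x\<^sup>2\<rfloor>"
    have M: "real M \<le> real n / 2 + D * x\<^sup>2" "real M > real n / 2 + D * x\<^sup>2 - 1"
      unfolding M_def using Dx0 xx by linarith+
    define t where "t = n - M"
    have Mn: "M \<le> n" using M(1) Dx by linarith
    have nt: "n = M + t" "n - t = M" "t \<le> n" using Mn by (auto simp: t_def)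
    have rt: "real t = real n - real M" using Mn by (simp add: t_def of_nat_diff)
    have t1: "1 \<le> t" using rt M(1) Dx elim by linarith
    have tM: "t \<le> M" using rt M(2) Dx0 xx by linarith
    have "c * real (card (all_graphs n M)) \<le> real (card (planar_graphs n M))"
    proof -
      have "c * real (card (all_graphs n M)) = (exp (-13) / 120 * (2 * D + 6) powr (-3/4)) *
          (exp (- (8/3) * D ^ 3 - 1) * real (card (all_graphs n M)))" by (simp add: c_def)
      also have "\<dots> \<le> (exp (-13) / 120 * (2 * D + 6) powr (-3/4)) *
          (fact n * exp (real n) * real n powr (-1/2) * (1/2) ^ t / fact t)"
      proof (intro mult_left_mono all_graphs_upper[where x = x])
        show "real M - real t \<le> 2 * D * x\<^sup>2" using rt M(1) by linarith
      qed (use nt x3 x t1 tM in auto)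
      also have "\<dots> \<le> real (card (planar_graphs n (n - t)))"
      proof (rule card_planar_graphs_ge_mass[OF x3 x(1) D2 nt(3)])
        show "real n - 2 * real t \<le> 2 * D * x\<^sup>2" using rt M(1) by linarith
        show "2 * real t \<le> real n - 2 * D * x\<^sup>2 + 2" using rt M(2) by linarith
      qed
      finally show ?thesis using nt(2) by simp
    qed
    moreover have "m n \<le> M"
    proof -
      have "C * x\<^sup>2 \<le> D * x\<^sup>2" by (intro mult_right_mono) (auto simp: D_def)
      then have "real (m n) \<le> real n / 2 + D * x\<^sup>2" using m[of n] elim x2 by simp
      then show ?thesis unfolding M_def by (simp add: le_nat_iff le_floor_iff)
    qed
    moreover have "M \<le> n choose 2"
      using le_choose_two[of n] Mn elim by simp
    ultimately show ?case by (intro planar_fraction_antimono[of "m n" M])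
  qed
  then show ?thesis using c0 by blast
qed

section \<open>The zero of the exponent\<close>

lemma nu_fun_derivative:
  assumes "n \<ge> 1" "k \<ge> 1" "x > 0"
  shows "(nu_fun n k has_real_derivative (ln (real k) - ln (real n) - ln x - 1 / (2 * x))) (at x)"
proof -
  have "(nu_fun n k has_real_derivative
      (ln (real k) + 1 - ((x + 1/2) * (1 / x) + ln x) - ln (real n))) (at x)"
    unfolding nu_fun_def[abs_def] using assms by (auto intro!: derivative_eq_intros)
  moreover have "ln (real k) + 1 - ((x + 1/2) * (1 / x) + ln x) - ln (real n)
      = ln (real k) - ln (real n) - ln x - 1 / (2 * x)"
    using assms by (simp add: field_simps)
  ultimately show ?thesis by (simp only:)
qed

text \<open>\<open>- ln u - 1 / (2 u)\<close> is at most \<open>ln 2 - 1\<close>, so the derivative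
  is at most \<open>ln (12/5) - 1 < 0\<close>. The factor \<open>6/5\<close> leaves room for
  \<open>k = 2 m \<le> n + 2 C n^(2/3)\<close> with \<open>n\<close> large.\<close>

lemma nu_fun_strict_decreasing:
  assumes "n \<ge> 1" "k \<ge> 1" "real k \<le> 6/5 * real n" "0 < x" "x < y"
  shows "nu_fun n k y < nu_fun n k x"
proof (rule DERIV_neg_imp_decreasing[OF assms(5)])
  fix u assume u: "x \<le> u" "u \<le> y"
  then have u0: "u > 0" using assms by simp
  have "ln (1 / (2 * u)) \<le> 1 / (2 * u) - 1" using u0 by (intro ln_le_minus_one) simp
  then have 1: "- ln u - 1 / (2 * u) \<le> ln 2 - 1" using u0 by (simp add: ln_div ln_mult)
  have "ln (real k) \<le> ln (6/5 * real n)" using assms by (subst ln_le_cancel_iff) auto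
  then have 2: "ln (real k) - ln (real n) \<le> ln (6/5)" using assms by (simp add: ln_mult ln_div)
  have "ln (6/5 * 2 :: real) < 1"
  proof -
    have "6/5 * 2 < exp (1::real)" using exp_lower_Taylor_quadratic[of "1::real"] by simp
    then have "ln (6/5 * 2 :: real) < ln (exp 1)" by (subst ln_less_cancel_iff) auto
    then show ?thesis by simp
  qed
  then have "ln (6/5) + ln 2 < (1::real)" by (subst (asm) ln_mult) auto
  then have "ln (real k) - ln (real n) - ln u - 1 / (2 * u) < 0" using 1 2 by linarith
  then show "\<exists>z. (nu_fun n k has_real_derivative z) (at u) \<and> z < 0"
    using nu_fun_derivative[OF assms(1,2) u0] by blast
qed

text \<open>From \<open>27 \<ge> e^3\<close> on, the bracket that multiplies \<open>x\<close> is at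
  most \<open>1/5 + 1 - 3 < -1\<close>.\<close>

lemma nu_fun_large_bound:
  assumes "n \<ge> 1" "k \<ge> 1" "real k \<le> 6/5 * real n" "x \<ge> 27"
  shows "nu_fun n k x \<le> ln (real n) - x"
proof -
  have "ln (real k) \<le> ln (6/5 * real n)" using assms by (subst ln_le_cancel_iff) auto
  moreover have "ln (6/5 :: real) \<le> 1/5" using ln_le_minus_one[of "6/5::real"] by simp
  ultimately have kn: "ln (real k) - ln (real n) \<le> 1/5" using assms by (simp add: ln_mult ln_div)
  have "exp (3::real) \<le> 27"
  proof -
    have "exp (3::real) = exp 1 ^ 3" using exp_of_nat_mult[of 3 "1::real"] by simp
    also have "\<dots> \<le> 3 ^ 3" by (intro power_mono exp_le) auto
    finally show ?thesis by simp
  qed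
  then have lx: "ln x \<ge> 3" using assms(4) by (subst ln_ge_iff) auto
  have "nu_fun n k x = x * (ln (real k) - ln (real n) + 1 - ln x) - ln x / 2 + ln (real n)"
    by (simp add: nu_fun_def algebra_simps)
  also have "\<dots> \<le> x * (-1) - 0 + ln (real n)"
  proof -
    have "x * (ln (real k) - ln (real n) + 1 - ln x) \<le> x * (-1)"
      using kn lx assms(4) by (intro mult_left_mono) auto
    then show ?thesis using lx by linarith
  qed
  finally show ?thesis by simp
qed

text \<open>The value at 1 is \<open>ln k + 1 > 0\<close> and the value at \<open>27 + n\<close> is
  negative. Monotonicity gives the uniqueness on which the \<open>THE\<close> in \<open>nu\<close>
  depends.\<close>

lemma nu_root:
  assumes "n \<ge> 1" "k \<ge> 1" "real k \<le> 6/5 * real n"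
  shows "nu n k > 1" "nu_fun n k (nu n k) = 0"
proof -
  define y where "y = 27 + real n"
  have f1: "nu_fun n k 1 > 0"
  proof -
    have "ln (real k) \<ge> 0" using assms by simp
    then show ?thesis by (simp add: nu_fun_def)
  qed
  have "nu_fun n k y \<le> ln (real n) - y" using assms by (intro nu_fun_large_bound) (auto simp: y_def)
  moreover have "ln (real n) \<le> real n - 1" using assms by (intro ln_le_minus_one) auto
  ultimately have fy: "nu_fun n k y < 0" by (simp add: y_def)
  have "continuous_on {1..y} (nu_fun n k)"
  proof (intro continuous_at_imp_continuous_on ballI)
    fix u assume "u \<in> {1..y}"
    then show "isCont (nu_fun n k) u" using DERIV_isCont[OF nu_fun_derivative[OF assms(1,2), of u]] by simp
  qed
  then obtain z where z: "1 \<le> z" "nu_fun n k z = 0"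
    using IVT2'[of "nu_fun n k" y 0 1] f1 fy y_def by auto
  have ex: "\<exists>!x. x > 0 \<and> nu_fun n k x = 0"
  proof (rule ex1I[of _ z])
    show "z > 0 \<and> nu_fun n k z = 0" using z by simp
    fix x assume "x > 0 \<and> nu_fun n k x = 0"
    then show "x = z"
      using nu_fun_strict_decreasing[OF assms, of x z] nu_fun_strict_decreasing[OF assms, of z x] z
      by (cases x z rule: linorder_cases) auto
  qed
  have "nu n k = (THE x. x > 0 \<and> nu_fun n k x = 0)" using assms by (simp add: nu_def)
  then have "nu n k > 0 \<and> nu_fun n k (nu n k) = 0" using theI'[OF ex] by simp
  then show "nu_fun n k (nu n k) = 0" by simp
  have "nu n k = z" using ex z \<open>nu n k > 0 \<and> nu_fun n k (nu n k) = 0\<close> by (metis less_le_trans zero_less_one)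
  then show "nu n k > 1" using z f1 by (cases "z = 1") auto
qed

text \<open>Comparison with a line through the zero: to its right \<open>ln u\<close> only grows, so
  the slope stays below the negative of the last factor.\<close>

lemma nu_fun_above:
  assumes "n \<ge> 1" "k \<ge> 1" "real k \<le> 6/5 * real n" "nu n k \<le> y"
  shows "nu_fun n k y \<le> - (y - nu n k) * (ln (real n) + ln (nu n k) - ln (real k))"
proof -
  define \<nu> where "\<nu> = nu n k"
  define L where "L = ln (real n) + ln \<nu> - ln (real k)"
  have nu: "\<nu> > 1" "nu_fun n k \<nu> = 0" using nu_root[OF assms(1-3)] by (auto simp: \<nu>_def)
  define g where "g = (\<lambda>u. nu_fun n k u + (u - \<nu>) * L)"
  have "g y \<le> g \<nu>"
  proof (rule DERIV_nonpos_imp_nonincreasing[of _ _ g])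
    show "\<nu> \<le> y" using assms by (simp add: \<nu>_def)
    fix u assume u: "\<nu> \<le> u" "u \<le> y"
    then have u0: "u > 0" using nu by simp
    have "(g has_real_derivative (ln (real k) - ln (real n) - ln u - 1 / (2 * u) + L)) (at u)"
      unfolding g_def by (auto intro!: derivative_eq_intros nu_fun_derivative[OF assms(1,2) u0])
    moreover have "ln (real k) - ln (real n) - ln u - 1 / (2 * u) + L \<le> 0"
    proof -
      have "ln \<nu> \<le> ln u" using u nu by simp
      moreover have "1 / (2 * u) \<ge> 0" using u0 by simp
      ultimately show ?thesis unfolding L_def by linarith
    qed
    ultimately show "\<exists>z. (g has_real_derivative z) (at u) \<and> z \<le> 0" by blast
  qed
  then show ?thesis using nu by (simp add: g_def L_def \<nu>_def algebra_simps)
qed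

text \<open>To the left of the zero the slope bound has to use \<open>ln y\<close>, the smallest
  value of \<open>ln u\<close> on the interval, and is therefore weaker than in
  \<open>nu_fun_above\<close>.\<close>

lemma nu_fun_below:
  assumes "n \<ge> 1" "k \<ge> 1" "real k \<le> 6/5 * real n" "1 \<le> y" "y \<le> nu n k"
  shows "nu_fun n k y \<ge> (nu n k - y) * (ln (real n) + ln y - ln (real k))"
proof -
  define \<nu> where "\<nu> = nu n k"
  define L where "L = ln (real n) + ln y - ln (real k)"
  have nu: "\<nu> > 1" "nu_fun n k \<nu> = 0" using nu_root[OF assms(1-3)] by (auto simp: \<nu>_def)
  define g where "g = (\<lambda>u. nu_fun n k u + (u - \<nu>) * L)"
  have "g \<nu> \<le> g y"
  proof (rule DERIV_nonpos_imp_nonincreasing[of _ _ g])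
    show "y \<le> \<nu>" using assms by (simp add: \<nu>_def)
    fix u assume u: "y \<le> u" "u \<le> \<nu>"
    then have u0: "u > 0" using assms by simp
    have "(g has_real_derivative (ln (real k) - ln (real n) - ln u - 1 / (2 * u) + L)) (at u)"
      unfolding g_def by (auto intro!: derivative_eq_intros nu_fun_derivative[OF assms(1,2) u0])
    moreover have "ln (real k) - ln (real n) - ln u - 1 / (2 * u) + L \<le> 0"
    proof -
      have "ln y \<le> ln u" using u assms by simp
      moreover have "1 / (2 * u) \<ge> 0" using u0 by simp
      ultimately show ?thesis unfolding L_def by linarith
    qed
    ultimately show "\<exists>z. (g has_real_derivative z) (at u) \<and> z \<le> 0" by blast
  qed
  then show ?thesis using nu by (simp add: g_def L_def \<nu>_def algebra_simps)
qed

text \<open>A bounded slope would force \<open>nu\<close> to be bounded, but \<open>nu\<close> times the slope is at least \<open>ln n\<close>.\<close>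

lemma nu_slope_large:
  assumes "n \<ge> 1" "k \<ge> 1" "real k \<le> 6/5 * real n" "\<Lambda> > 0" "ln (real n) \<ge> \<Lambda> * (6/5 * exp \<Lambda>)"
  shows "ln (real n) + ln (nu n k) - ln (real k) \<ge> \<Lambda>"
proof (rule ccontr)
  assume a: "\<not> ?thesis"
  define \<nu> where "\<nu> = nu n k"
  define L where "L = ln (real n) + ln \<nu> - ln (real k)"
  have L: "L < \<Lambda>" using a by (simp add: L_def \<nu>_def)
  have nu: "\<nu> > 1" "nu_fun n k \<nu> = 0" using nu_root[OF assms(1-3)] by (auto simp: \<nu>_def)
  have "ln (real k) \<le> ln (6/5 * real n)" using assms by (subst ln_le_cancel_iff) auto
  then have "ln (real k) - ln (real n) \<le> ln (6/5)" using assms by (simp add: ln_mult ln_div)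
  then have "ln \<nu> \<le> ln (6/5) + \<Lambda>" using L by (simp add: L_def)
  also have "\<dots> = ln (6/5 * exp \<Lambda>)" by (simp add: ln_mult ln_div)
  finally have nub: "\<nu> \<le> 6/5 * exp \<Lambda>" using nu by (subst (asm) ln_le_cancel_iff) auto
  have "\<nu> * L = \<nu> + ln (real n) - ln \<nu> / 2" using nu(2) by (simp add: L_def nu_fun_def algebra_simps)
  moreover have "ln \<nu> \<le> \<nu> - 1" using nu by (intro ln_le_minus_one) simp
  ultimately have "ln (real n) < \<nu> * L" using nu(1) by simp
  also have "\<nu> * L \<le> \<nu> * \<Lambda>" using L nu by (intro mult_left_mono) auto
  also have "\<dots> \<le> 6/5 * exp \<Lambda> * \<Lambda>" using nub assms by (intro mult_right_mono) auto
  finally show False using assms(5) by (simp add: mult.commute)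
qed

text \<open>The slope at the zero tends to minus infinity uniformly in \<open>k\<close>, so moving
  by \<open>\<epsilon>\<close> changes the exponent by any prescribed \<open>\<Lambda>\<close>.
  Uniformity matters since \<open>k = 2 * m n\<close> varies freely with \<open>n\<close>.\<close>

lemma nu_fun_window:
  fixes \<epsilon> \<Lambda> :: real
  assumes "\<epsilon> > 0"
  shows "\<forall>\<^sub>F n in sequentially. \<forall>k. 1 \<le> k \<and> real k \<le> 6/5 * real n \<longrightarrow>
     (\<forall>y. nu n k + \<epsilon> \<le> y \<longrightarrow> nu_fun n k y \<le> - \<Lambda>) \<and>
     (\<forall>y. 1 \<le> y \<and> y \<le> nu n k - \<epsilon> \<longrightarrow> nu_fun n k y \<ge> \<Lambda>)"
proof -
  \<comment> \<open>The first term gives the change \<open>\<Lambda>\<close> over the distance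
    \<open>\<epsilon>\<close>. The second covers the loss of slope between \<open>nu\<close> and
    \<open>z = nu - \<epsilon>\<close>: as \<open>z \<ge> 1\<close>,
    \<open>nu \<le> (1 + \<epsilon>) z\<close>.\<close>
  define H where "H = max 1 \<Lambda> / \<epsilon> + ln (1 + \<epsilon>)"
  have H0: "H > 0" using assms by (simp add: H_def add_pos_nonneg)
  have eH: "\<epsilon> * (H - ln (1 + \<epsilon>)) \<ge> \<Lambda>" "\<epsilon> * H \<ge> \<Lambda>"
  proof -
    have "\<epsilon> * (H - ln (1 + \<epsilon>)) = max 1 \<Lambda>" using assms by (simp add: H_def)
    then show 1: "\<epsilon> * (H - ln (1 + \<epsilon>)) \<ge> \<Lambda>" by simp
    have "\<epsilon> * ln (1 + \<epsilon>) \<ge> 0" using assms by simp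
    then show "\<epsilon> * H \<ge> \<Lambda>" using 1 by (simp add: algebra_simps)
  qed
  have "\<forall>\<^sub>F n in sequentially. ln (real n) \<ge> H * (6/5 * exp H)" by real_asymp
  then show ?thesis using eventually_ge_at_top[of 1]
  proof eventually_elim
    case (elim n)
    show ?case
    proof (intro allI impI, goal_cases)
      case (1 k)
      then have k: "k \<ge> 1" "real k \<le> 6/5 * real n" by auto
      have n: "n \<ge> 1" using elim by simp
      define \<nu> where "\<nu> = nu n k"
      define L where "L = ln (real n) + ln \<nu> - ln (real k)"
      have nu: "\<nu> > 1" using nu_root[OF n k] by (simp add: \<nu>_def)
      have LH: "L \<ge> H" using nu_slope_large[OF n k H0 elim(1)] by (simp add: L_def \<nu>_def)
      have up: "nu_fun n k y \<le> - \<Lambda>" if "\<nu> + \<epsilon> \<le> y" for y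
      proof -
        have "nu_fun n k y \<le> - (y - \<nu>) * L"
          using nu_fun_above[OF n k, of y] that assms by (simp add: L_def \<nu>_def)
        also have "\<dots> \<le> - (\<epsilon> * H)"
        proof -
          have "\<epsilon> * H \<le> (y - \<nu>) * L" using that LH H0 assms by (intro mult_mono) auto
          then show ?thesis by (simp add: algebra_simps)
        qed
        finally show ?thesis using eH by linarith
      qed
      have lo: "nu_fun n k y \<ge> \<Lambda>" if y: "1 \<le> y" "y \<le> \<nu> - \<epsilon>" for y
      proof -
        define z where "z = \<nu> - \<epsilon>"
        have z: "1 \<le> z" "z \<le> \<nu>" "z + \<epsilon> = \<nu>" using y assms by (auto simp: z_def)
        have "\<nu> \<le> z * (1 + \<epsilon>)"
        proof -
          have "1 * \<epsilon> \<le> z * \<epsilon>" using z assms by (intro mult_right_mono) auto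
          then show ?thesis using z(3) by (simp add: algebra_simps)
        qed
        then have "ln \<nu> \<le> ln (z * (1 + \<epsilon>))" using nu z assms by (subst ln_le_cancel_iff) auto
        also have "\<dots> = ln z + ln (1 + \<epsilon>)" using z assms by (simp add: ln_mult)
        finally have lz: "ln z \<ge> ln \<nu> - ln (1 + \<epsilon>)" by simp
        have "\<Lambda> \<le> \<epsilon> * (L - ln (1 + \<epsilon>))"
          using eH(1) LH assms by (smt (verit) mult_left_mono)
        also have "\<dots> \<le> (\<nu> - z) * (ln (real n) + ln z - ln (real k))"
          using lz assms by (simp add: z_def L_def)
        also have "\<dots> \<le> nu_fun n k z" using nu_fun_below[OF n k, of z] z by (simp add: \<nu>_def)
        also have "\<dots> \<le> nu_fun n k y"
          using nu_fun_strict_decreasing[OF n k, of y z] y by (cases "y = z") (auto simp: z_def)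
        finally show ?thesis .
      qed
      show ?case using up lo by (auto simp: \<nu>_def)
    qed
  qed
qed

text \<open>By monotonicity a nonnegative exponent at \<open>d\<close> is nonnegative at 2 as well,
  which forces \<open>k^2\<close> to be of order at least \<open>n\<close>; and \<open>d\<close> is
  at most logarithmic. Together these make \<open>d^2 / k\<close> small.\<close>

lemma nu_fun_nonneg_bounds:
  assumes "n \<ge> 1" "k \<ge> 1" "real k \<le> 6/5 * real n" "d \<ge> 2" "nu_fun n k (real d) \<ge> 0"
  shows "real k \<ge> exp (-1) * sqrt (real n)" "real d \<le> 27 + ln (real n)"
proof -
  have "nu_fun n k 2 \<ge> 0"
    using nu_fun_strict_decreasing[OF assms(1-3), of 2 "real d"] assms(4,5) by (cases "d = 2") auto
  then have "ln (real n) \<le> 2 * ln (real k) + 2 - 5 * ln 2 / 2" by (simp add: nu_fun_def)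
  moreover have "0 \<le> ln (2::real)" by simp
  ultimately have "-1 + ln (real n) / 2 \<le> ln (real k)" by linarith
  then have "exp (-1 + ln (real n) / 2) \<le> exp (ln (real k))" by simp
  moreover have "exp (-1 + ln (real n) / 2) = exp (-1) * sqrt (real n)"
  proof -
    have "exp (ln (real n) / 2) = exp (ln (sqrt (real n)))" using assms(1) by (simp add: ln_sqrt)
    moreover have "exp (-1 + ln (real n) / 2) = exp (-1) * exp (ln (real n) / 2)" by (rule exp_add)
    ultimately show ?thesis using assms(1) by simp
  qed
  ultimately show "real k \<ge> exp (-1) * sqrt (real n)" using assms(2) by simp
  show "real d \<le> 27 + ln (real n)"
  proof (cases "real d \<ge> 27")
    case True
    then show ?thesis using nu_fun_large_bound[OF assms(1-3) True] assms(5) by simp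
  next
    case False
    moreover have "ln (real n) \<ge> 0" using assms(1) by simp
    ultimately show ?thesis by linarith
  qed
qed

section \<open>First moment\<close>

definition star :: "nat \<Rightarrow> nat \<Rightarrow> nat set set" where
  "star n v = {e \<in> vertex_pairs n. v \<in> e}"

lemma star_eq:
  assumes "v \<in> {1..n}"
  shows "star n v = (\<lambda>u. {v, u}) ` ({1..n} - {v})"
proof
  show "star n v \<subseteq> (\<lambda>u. {v, u}) ` ({1..n} - {v})"
  proof
    fix e assume "e \<in> star n v"
    then have e: "e \<subseteq> {1..n}" "card e = 2" "v \<in> e" by (auto simp: star_def vertex_pairs_def)
    obtain a b where ab: "e = {a, b}" "a \<noteq> b" using e(2) card_2_iff[of e] by blast
    then have "e = {v, if v = a then b else a}" using e(3) by auto
    moreover have "(if v = a then b else a) \<in> {1..n} - {v}" using e ab by auto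
    ultimately show "e \<in> (\<lambda>u. {v, u}) ` ({1..n} - {v})" by blast
  qed
  show "(\<lambda>u. {v, u}) ` ({1..n} - {v}) \<subseteq> star n v"
    using assms by (auto simp: star_def vertex_pairs_def)
qed

lemma inj_on_pair_with: "inj_on (\<lambda>u. {v, u}) A"
  by (auto simp: inj_on_def doubleton_eq_iff)

lemma card_star: "v \<in> {1..n} \<Longrightarrow> card (star n v) = n - 1"
  unfolding star_eq by (subst card_image[OF inj_on_pair_with]) simp

lemma degree_eq_card_star:
  assumes "E \<subseteq> vertex_pairs n"
  shows "degree E v = card (E \<inter> star n v)"
proof -
  have "{e \<in> E. v \<in> e} = E \<inter> star n v" using assms by (auto simp: star_def)
  then show ?thesis by (simp add: degree_def)
qed

lemma max_degree_ge_iff: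
  fixes E :: "nat set set"
  assumes "n \<ge> 1"
  shows "d \<le> max_degree {1..n} E \<longleftrightarrow> (\<exists>v\<in>{1..n}. d \<le> degree E v)"
  unfolding max_degree_def using assms by (subst Max_ge_iff) auto

lemma card_supersets:
  assumes "finite X" "T \<subseteq> X" "card T \<le> m"
  shows "card {E. E \<subseteq> X \<and> card E = m \<and> T \<subseteq> E} = (card X - card T) choose (m - card T)"
proof -
  have finT: "finite T" using assms finite_subset by blast
  have "bij_betw (\<lambda>F. F \<union> T) {F. F \<subseteq> X - T \<and> card F = m - card T} {E. E \<subseteq> X \<and> card E = m \<and> T \<subseteq> E}"
  proof (rule bij_betwI[where g = "\<lambda>E. E - T"])
    show "(\<lambda>F. F \<union> T) \<in> {F. F \<subseteq> X - T \<and> card F = m - card T} \<rightarrow> {E. E \<subseteq> X \<and> card E = m \<and> T \<subseteq> E}"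
    proof
      fix F assume F: "F \<in> {F. F \<subseteq> X - T \<and> card F = m - card T}"
      then have "finite F" using assms(1) finite_subset[of F "X - T"] by auto
      then have "card (F \<union> T) = card F + card T" using F finT by (intro card_Un_disjoint) auto
      then show "F \<union> T \<in> {E. E \<subseteq> X \<and> card E = m \<and> T \<subseteq> E}" using F assms by auto
    qed
    show "(\<lambda>E. E - T) \<in> {E. E \<subseteq> X \<and> card E = m \<and> T \<subseteq> E} \<rightarrow> {F. F \<subseteq> X - T \<and> card F = m - card T}"
      using finT by (auto simp: card_Diff_subset)
  qed auto
  then have "card {E. E \<subseteq> X \<and> card E = m \<and> T \<subseteq> E} = card {F. F \<subseteq> X - T \<and> card F = m - card T}"
    by (simp add: bij_betw_same_card)
  also have "\<dots> = (card X - card T) choose (m - card T)"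
    using assms(1,2) finT by (simp add: n_subsets card_Diff_subset)
  finally show ?thesis .
qed

lemma card_large_intersection_le:
  assumes "finite X" "S \<subseteq> X" "d \<le> m"
  shows "card {E. E \<subseteq> X \<and> card E = m \<and> d \<le> card (E \<inter> S)}
    \<le> (card S choose d) * ((card X - d) choose (m - d))"
proof -
  have finS: "finite S" using assms finite_subset by blast
  let ?T = "{T. T \<subseteq> S \<and> card T = d}"
  have finT: "finite ?T" using finS by simp
  have "{E. E \<subseteq> X \<and> card E = m \<and> d \<le> card (E \<inter> S)} \<subseteq> (\<Union>T\<in>?T. {E. E \<subseteq> X \<and> card E = m \<and> T \<subseteq> E})"
  proof
    fix E assume E: "E \<in> {E. E \<subseteq> X \<and> card E = m \<and> d \<le> card (E \<inter> S)}"
    then have "d \<le> card (E \<inter> S)" by simp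
    then obtain T where T: "T \<subseteq> E \<inter> S" "card T = d" by (rule obtain_subset_with_card_n)
    then show "E \<in> (\<Union>T\<in>?T. {E. E \<subseteq> X \<and> card E = m \<and> T \<subseteq> E})" using E by auto
  qed
  then have "card {E. E \<subseteq> X \<and> card E = m \<and> d \<le> card (E \<inter> S)}
      \<le> card (\<Union>T\<in>?T. {E. E \<subseteq> X \<and> card E = m \<and> T \<subseteq> E})"
    using assms(1) finT by (intro card_mono) auto
  also have "\<dots> \<le> (\<Sum>T\<in>?T. card {E. E \<subseteq> X \<and> card E = m \<and> T \<subseteq> E})" by (rule card_UN_le[OF finT])
  also have "\<dots> = (\<Sum>T\<in>?T. (card X - d) choose (m - d))"
    using assms by (intro sum.cong) (auto simp: card_supersets)
  also have "\<dots> = (card S choose d) * ((card X - d) choose (m - d))" using finS by (simp add: n_subsets)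
  finally show ?thesis .
qed

text \<open>The ratio of the two binomial coefficients is a product of factors
  \<open>(m - i) / (N - i)\<close>, each at most \<open>m / N\<close>.\<close>

lemma binomial_ratio_le:
  assumes "d \<le> m" "m \<le> N" "N > 0"
  shows "real ((N - d) choose (m - d)) \<le> real (N choose m) * (real m / real N) ^ d"
proof -
  have "real (m choose d) * fact d * real N ^ d \<le> real (N choose d) * fact d * real m ^ d"
  proof -
    have "real (m choose d) * fact d * real N ^ d = (\<Prod>i=0..<d. (real m - real i) * real N)"
      unfolding binomial_prod prod.distrib by simp
    also have "\<dots> \<le> (\<Prod>i=0..<d. (real N - real i) * real m)"
    proof (rule prod_mono)
      fix i assume "i \<in> {0..<d}"
      then have i: "i < d" by simp
      have "real i * real m \<le> real i * real N" using assms by (intro mult_left_mono) auto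
      then show "0 \<le> (real m - real i) * real N \<and> (real m - real i) * real N \<le> (real N - real i) * real m"
        using i assms by (simp add: algebra_simps)
    qed
    also have "\<dots> = real (N choose d) * fact d * real m ^ d"
      unfolding binomial_prod prod.distrib by simp
    finally show ?thesis .
  qed
  then have 1: "real (m choose d) * real N ^ d \<le> real (N choose d) * real m ^ d" by (simp add: mult_ac)
  have "(N choose m) * (m choose d) = (N choose d) * ((N - d) choose (m - d))"
    using assms by (intro choose_mult) auto
  then have 2: "real (N choose m) * real (m choose d) = real (N choose d) * real ((N - d) choose (m - d))"
    by (metis of_nat_mult)
  have 3: "real (N choose d) > 0" using assms by simp
  have "real (N choose d) * (real ((N - d) choose (m - d)) * real N ^ d)
      = real (N choose m) * (real (m choose d) * real N ^ d)"
    using 2 by (simp add: mult_ac)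
  also have "\<dots> \<le> real (N choose m) * (real (N choose d) * real m ^ d)"
    by (intro mult_left_mono 1) auto
  finally have "real (N choose d) * (real ((N - d) choose (m - d)) * real N ^ d)
     \<le> real (N choose d) * (real (N choose m) * real m ^ d)" by (simp add: mult_ac)
  then have "real ((N - d) choose (m - d)) * real N ^ d \<le> real (N choose m) * real m ^ d" using 3 by simp
  then show ?thesis using assms by (simp add: power_divide pos_le_divide_eq)
qed

text \<open>Union bound over a vertex and \<open>d\<close> edges of its star. Since
  \<open>(n - 1) * m / N = 2 m / n\<close>, it gives \<open>n (2 m / n)^d / d!\<close>, and the
  lower Stirling bound turns this into the exponential; this is the origin of
  \<open>nu_fun\<close>.\<close>

lemma card_high_degree_le:
  assumes "n \<ge> 2" "1 \<le> m" "m \<le> n choose 2" "1 \<le> d"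
  shows "real (card {E \<in> all_graphs n m. d \<le> max_degree {1..n} E})
    \<le> exp (nu_fun n (2 * m) (real d)) * real (card (all_graphs n m))"
proof -
  define N where "N = n choose 2"
  define A where "A v = {E. E \<subseteq> vertex_pairs n \<and> card E = m \<and> d \<le> card (E \<inter> star n v)}" for v
  have N: "real N = real n * (real n - 1) / 2"
    using real_choose_two[OF assms(1)] by (simp add: N_def)
  have N0: "N > 0" using assms by (simp add: N_def)
  have sub: "star n v \<subseteq> vertex_pairs n" for v by (auto simp: star_def)
  have cA: "real (card (A v)) \<le> (2 * real m / real n) ^ d / fact d * real (N choose m)" if v: "v \<in> {1..n}" for v
  proof (cases "d \<le> m")
    case True
    have "card (A v) \<le> ((n - 1) choose d) * ((N - d) choose (m - d))"
      unfolding A_def using card_large_intersection_le[OF finite_vertex_pairs sub[of v] True]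
      by (simp add: card_star[OF v] card_vertex_pairs N_def)
    then have "real (card (A v)) \<le> real ((n - 1) choose d) * real ((N - d) choose (m - d))"
      using of_nat_mono by fastforce
    also have "\<dots> \<le> (real (n - 1) ^ d / fact d) * (real (N choose m) * (real m / real N) ^ d)"
      using True assms(3) N0 by (intro mult_mono binomial_le_pow_div_fact binomial_ratio_le) (auto simp: N_def)
    also have "\<dots> = (real (n - 1) * (real m / real N)) ^ d / fact d * real (N choose m)"
      unfolding power_mult_distrib by simp
    also have "real (n - 1) * (real m / real N) = 2 * real m / real n"
      unfolding N using assms(1) by (simp add: of_nat_diff)
    finally show ?thesis .
  next
    case False
    have "A v = {}"
    proof (rule ccontr)
      assume "A v \<noteq> {}"
      then obtain E where E: "E \<subseteq> vertex_pairs n" "card E = m" "d \<le> card (E \<inter> star n v)" by (auto simp: A_def)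
      have "card (E \<inter> star n v) \<le> card E"
        using E finite_vertex_pairs finite_subset by (intro card_mono) auto
      then show False using False E by simp
    qed
    then show ?thesis by simp
  qed
  have "{E \<in> all_graphs n m. d \<le> max_degree {1..n} E} \<subseteq> (\<Union>v\<in>{1..n}. A v)"
  proof
    fix E assume "E \<in> {E \<in> all_graphs n m. d \<le> max_degree {1..n} E}"
    then have E: "E \<subseteq> vertex_pairs n" "card E = m" "d \<le> max_degree {1..n} E" by (auto simp: all_graphs_eq)
    then obtain v where "v \<in> {1..n}" "d \<le> degree E v" using max_degree_ge_iff[of n d E] assms(1) by auto
    then show "E \<in> (\<Union>v\<in>{1..n}. A v)" using E degree_eq_card_star[OF E(1)] by (auto simp: A_def)
  qed
  moreover have "finite (A v)" for v unfolding A_def using finite_vertex_pairs by simp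
  ultimately have "card {E \<in> all_graphs n m. d \<le> max_degree {1..n} E} \<le> card (\<Union>v\<in>{1..n}. A v)"
    by (intro card_mono) auto
  also have "\<dots> \<le> (\<Sum>v\<in>{1..n}. card (A v))" by (rule card_UN_le) simp
  finally have "real (card {E \<in> all_graphs n m. d \<le> max_degree {1..n} E}) \<le> (\<Sum>v\<in>{1..n}. real (card (A v)))"
    using of_nat_mono by fastforce
  also have "\<dots> \<le> (\<Sum>v\<in>{1..n}. (2 * real m / real n) ^ d / fact d * real (N choose m))"
    by (intro sum_mono cA)
  also have "\<dots> = real n * (2 * real m / real n) ^ d / fact d * real (N choose m)" by simp
  also have "\<dots> \<le> exp (nu_fun n (2 * m) (real d)) * real (N choose m)"
  proof (rule mult_right_mono)
    have "ln (real n * (2 * real m / real n) ^ d / fact d)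
       = ln (real n) + real d * (ln (real (2 * m)) - ln (real n)) - ln (fact d)"
      using assms by (simp add: ln_mult ln_div ln_realpow)
    also have "\<dots> \<le> nu_fun n (2 * m) (real d)"
      using ln_fact_bounds(1)[OF assms(4)] by (simp add: nu_fun_def algebra_simps)
    finally have "exp (ln (real n * (2 * real m / real n) ^ d / fact d)) \<le> exp (nu_fun n (2 * m) (real d))"
      by simp
    moreover have "real n * (2 * real m / real n) ^ d / fact d > 0" using assms by simp
    ultimately show "real n * (2 * real m / real n) ^ d / fact d \<le> exp (nu_fun n (2 * m) (real d))"
      by simp
  qed simp
  finally show ?thesis by (simp add: card_all_graphs N_def)
qed

section \<open>Second moment\<close>

text \<open>The condition \<open>Q\<close> sees only the part outside \<open>S\<close>, so the lemma
  can be applied again to a second star disjoint from the first.\<close>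

lemma card_split_intersection:
  assumes "finite X" "S \<subseteq> X" "a \<le> m"
  shows "card {E. E \<subseteq> X \<and> card E = m \<and> card (E \<inter> S) = a \<and> Q (E - S)}
    = (card S choose a) * card {F. F \<subseteq> X - S \<and> card F = m - a \<and> Q F}"
proof -
  have finS: "finite S" using assms finite_subset by blast
  let ?A = "{E. E \<subseteq> X \<and> card E = m \<and> card (E \<inter> S) = a \<and> Q (E - S)}"
  let ?T = "{T. T \<subseteq> S \<and> card T = a}" and ?F = "{F. F \<subseteq> X - S \<and> card F = m - a \<and> Q F}"
  have "bij_betw (\<lambda>E. (E \<inter> S, E - S)) ?A (?T \<times> ?F)"
  proof (rule bij_betwI[where g = "\<lambda>(T, F). T \<union> F"])
    show "(\<lambda>E. (E \<inter> S, E - S)) \<in> ?A \<rightarrow> ?T \<times> ?F"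
    proof
      fix E assume E: "E \<in> ?A"
      then have "finite E" using assms(1) finite_subset by blast
      then have "card (E - S) = card E - card (E \<inter> S)" by (simp add: card_Diff_subset_Int)
      then show "(E \<inter> S, E - S) \<in> ?T \<times> ?F" using E by auto
    qed
    show "(\<lambda>(T, F). T \<union> F) \<in> ?T \<times> ?F \<rightarrow> ?A"
    proof
      fix p assume "p \<in> ?T \<times> ?F"
      then obtain T F where p: "p = (T, F)" and T: "T \<subseteq> S" "card T = a" and F: "F \<subseteq> X - S" "card F = m - a" "Q F"
        by auto
      have "finite T" "finite F" using T F assms(1) finS finite_subset[of F "X - S"] finite_subset by auto
      moreover have "T \<inter> F = {}" using T F by auto
      ultimately have "card (T \<union> F) = m" using T F assms(3) by (simp add: card_Un_disjoint)
      moreover have "(T \<union> F) \<inter> S = T" "(T \<union> F) - S = F" using T F by auto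
      ultimately show "(case p of (T, F) \<Rightarrow> T \<union> F) \<in> ?A" using T F assms(2) p by auto
    qed
  qed auto
  then have "card ?A = card (?T \<times> ?F)" by (rule bij_betw_same_card)
  then show ?thesis using finS by (simp add: card_cartesian_product n_subsets)
qed

lemma card_degree_eq:
  assumes "v \<in> {1..n}" "d \<le> m"
  shows "card {E \<in> all_graphs n m. degree E v = d}
    = ((n - 1) choose d) * (((n choose 2) - (n - 1)) choose (m - d))"
proof -
  have sub: "star n v \<subseteq> vertex_pairs n" by (auto simp: star_def)
  have "{E \<in> all_graphs n m. degree E v = d}
      = {E. E \<subseteq> vertex_pairs n \<and> card E = m \<and> card (E \<inter> star n v) = d \<and> True}"
    by (auto simp: all_graphs_eq degree_eq_card_star)
  also have "card \<dots> = (card (star n v) choose d) * card {F. F \<subseteq> vertex_pairs n - star n v \<and> card F = m - d \<and> True}"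
    by (rule card_split_intersection[OF finite_vertex_pairs sub assms(2)])
  also have "card {F. F \<subseteq> vertex_pairs n - star n v \<and> card F = m - d \<and> True}
      = ((n choose 2) - (n - 1)) choose (m - d)"
    using sub finite_subset[OF sub finite_vertex_pairs] finite_vertex_pairs[of n]
    by (simp add: n_subsets card_Diff_subset card_vertex_pairs card_star[OF assms(1)])
  finally show ?thesis by (simp add: card_star[OF assms(1)])
qed

text \<open>The pair \<open>{u, v}\<close> is the only one in both stars. Without it the stars are
  disjoint of size \<open>n - 2\<close>; the summands are the cases where this edge is absent, and
  where it is present and accounts for one unit of both degrees.\<close>

lemma card_two_degrees_le:
  assumes uv: "u \<in> {1..n}" "v \<in> {1..n}" "u \<noteq> v" and d: "1 \<le> d" "2 * d \<le> m"
  shows "card {E \<in> all_graphs n m. degree E u = d \<and> degree E v = d}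
    \<le> ((n - 2) choose d) ^ 2 * (((n choose 2) - 1 - 2 * (n - 2)) choose (m - 2 * d))
     + ((n - 2) choose (d - 1)) ^ 2 * (((n choose 2) - 1 - 2 * (n - 2)) choose (m - 2 * d + 1))"
proof -
  define e where "e = {u, v}"
  define X where "X = vertex_pairs n - {e}"
  define S1 S2 where "S1 = star n u - {e}" and "S2 = star n v - {e}"
  define B where "B = (n choose 2) - 1 - 2 * (n - 2)"
  have n2: "n \<ge> 2" using uv by auto
  have eP: "e \<in> vertex_pairs n" using uv by (auto simp: e_def vertex_pairs_def)
  have eS: "e \<in> star n u" "e \<in> star n v" using eP by (auto simp: star_def e_def)
  have finP: "finite (vertex_pairs n)" by (rule finite_vertex_pairs)
  have fS: "finite (star n w)" for w by (rule finite_subset[OF _ finP]) (auto simp: star_def)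
  have finX: "finite X" using finP by (simp add: X_def)
  have disj: "S1 \<inter> S2 = {}"
  proof (rule ccontr)
    assume "S1 \<inter> S2 \<noteq> {}"
    then obtain f where f: "f \<in> vertex_pairs n" "u \<in> f" "v \<in> f" "f \<noteq> e" by (auto simp: S1_def S2_def star_def)
    have "card f = 2" using f by (simp add: vertex_pairs_def)
    moreover have "e \<subseteq> f" "card e = 2" using f uv by (auto simp: e_def)
    moreover have "finite f" using \<open>card f = 2\<close> by (intro card_ge_0_finite) simp
    ultimately have "e = f" by (intro card_subset_eq) auto
    then show False using f by simp
  qed
  have cS: "card S1 = n - 2" "card S2 = n - 2"
    unfolding S1_def S2_def using eS fS card_star[OF uv(1)] card_star[OF uv(2)] by simp_all
  have sub: "S1 \<subseteq> X" "S2 \<subseteq> X - S1" using disj by (auto simp: S1_def S2_def X_def star_def)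
  have cX: "card (X - S1 - S2) = B"
  proof -
    have "card X = (n choose 2) - 1" using eP finP by (simp add: X_def card_vertex_pairs)
    moreover have fin12: "finite S1" "finite S2" using fS by (auto simp: S1_def S2_def)
    have "card (X - S1) = card X - (n - 2)" using sub(1) fin12 cS by (simp add: card_Diff_subset)
    moreover have "card (X - S1 - S2) = card (X - S1) - (n - 2)" using sub(2) fin12 cS by (simp add: card_Diff_subset)
    ultimately show ?thesis by (simp add: B_def mult_2)
  qed
  have cnt: "card {E. E \<subseteq> X \<and> card E = k \<and> card (E \<inter> S1) = a \<and> card (E \<inter> S2) = a}
      = ((n - 2) choose a) ^ 2 * (B choose (k - 2 * a))" if "2 * a \<le> k" for a k
  proof -
    have "{E. E \<subseteq> X \<and> card E = k \<and> card (E \<inter> S1) = a \<and> card (E \<inter> S2) = a}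
      = {E. E \<subseteq> X \<and> card E = k \<and> card (E \<inter> S1) = a \<and> card ((E - S1) \<inter> S2) = a}"
    proof -
      have "(E - S1) \<inter> S2 = E \<inter> S2" for E using disj by auto
      then show ?thesis by simp
    qed
    also have "card \<dots> = (card S1 choose a) * card {F. F \<subseteq> X - S1 \<and> card F = k - a \<and> card (F \<inter> S2) = a}"
      using card_split_intersection[OF finX sub(1), of a k "\<lambda>F. card (F \<inter> S2) = a"] that by simp
    also have "card {F. F \<subseteq> X - S1 \<and> card F = k - a \<and> card (F \<inter> S2) = a}
      = (card S2 choose a) * card {F. F \<subseteq> X - S1 - S2 \<and> card F = k - a - a}"
      using card_split_intersection[OF _ sub(2), of a "k - a" "\<lambda>_. True"] that finX by simp
    also have "card {F. F \<subseteq> X - S1 - S2 \<and> card F = k - a - a} = B choose (k - 2 * a)"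
      using finX by (simp add: n_subsets cX mult_2)
    finally show ?thesis by (simp add: cS power2_eq_square)
  qed
  let ?A0 = "{E. E \<subseteq> X \<and> card E = m \<and> card (E \<inter> S1) = d \<and> card (E \<inter> S2) = d}"
  let ?A1 = "{F. F \<subseteq> X \<and> card F = m - 1 \<and> card (F \<inter> S1) = d - 1 \<and> card (F \<inter> S2) = d - 1}"
  have fin: "finite ?A0" "finite ?A1" using finX by auto
  have "{E \<in> all_graphs n m. degree E u = d \<and> degree E v = d} \<subseteq> ?A0 \<union> insert e ` ?A1"
  proof
    fix E assume "E \<in> {E \<in> all_graphs n m. degree E u = d \<and> degree E v = d}"
    then have E: "E \<subseteq> vertex_pairs n" "card E = m" "card (E \<inter> star n u) = d" "card (E \<inter> star n v) = d"
      by (auto simp: all_graphs_eq degree_eq_card_star)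
    have finE: "finite E" using E(1) finP finite_subset by blast
    show "E \<in> ?A0 \<union> insert e ` ?A1"
    proof (cases "e \<in> E")
      case False
      then have "E \<inter> S1 = E \<inter> star n u" "E \<inter> S2 = E \<inter> star n v" "E \<subseteq> X"
        using E(1) by (auto simp: S1_def S2_def X_def)
      then show ?thesis using E by simp
    next
      case True
      define F where "F = E - {e}"
      have EF: "E = insert e F" using True by (auto simp: F_def)
      have "F \<inter> S1 = (E \<inter> star n u) - {e}" "F \<inter> S2 = (E \<inter> star n v) - {e}" "F \<subseteq> X"
        using E(1) by (auto simp: S1_def S2_def X_def F_def)
      moreover have "card F = m - 1" using True E(2) finE by (simp add: F_def)
      ultimately have "F \<in> ?A1" using E True eS finE by simp
      then show ?thesis using EF by blast
    qed
  qed
  then have "card {E \<in> all_graphs n m. degree E u = d \<and> degree E v = d} \<le> card (?A0 \<union> insert e ` ?A1)"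
    using fin by (intro card_mono) auto
  also have "\<dots> \<le> card ?A0 + card (insert e ` ?A1)" by (rule card_Un_le)
  also have "\<dots> \<le> card ?A0 + card ?A1" using card_image_le[OF fin(2)] by simp
  also have "card ?A0 = ((n - 2) choose d) ^ 2 * (B choose (m - 2 * d))" by (rule cnt[OF d(2)])
  also have "card ?A1 = ((n - 2) choose (d - 1)) ^ 2 * (B choose (m - 1 - 2 * (d - 1)))"
    by (rule cnt) (use d in auto)
  also have "m - 1 - 2 * (d - 1) = m - 2 * d + 1" using d by simp
  finally show ?thesis by (simp add: B_def)
qed

text \<open>Chebyshev's inequality in counts instead of probabilities, for the number
  \<open>X\<close> of \<open>v\<close> satisfying \<open>P\<close>. The first term is
  \<open>1 / \<mu>\<close>, from the diagonal pairs; the others measure how far pairs exceed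
  independence.\<close>

lemma chebyshev_count_zero:
  fixes P :: "'a \<Rightarrow> 'b \<Rightarrow> bool" and a b :: real
  assumes "finite \<Omega>" "finite V" "V \<noteq> {}" "a > 0"
    and one: "\<And>v. v \<in> V \<Longrightarrow> real (card {E \<in> \<Omega>. P E v}) = a"
    and two: "\<And>u v. u \<in> V \<Longrightarrow> v \<in> V \<Longrightarrow> u \<noteq> v \<Longrightarrow> real (card {E \<in> \<Omega>. P E u \<and> P E v}) \<le> b"
    and b: "b \<ge> 0"
  shows "real (card {E \<in> \<Omega>. \<forall>v\<in>V. \<not> P E v})
    \<le> (real (card \<Omega>) / (real (card V) * a) + b * real (card \<Omega>) / a\<^sup>2 - 1) * real (card \<Omega>)"
proof -
  define n where "n = real (card V)"
  define W where "W = real (card \<Omega>)"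
  have n0: "n > 0" using assms by (simp add: n_def card_gt_0_iff)
  have W0: "W > 0"
  proof -
    obtain v where "v \<in> V" using assms(3) by auto
    then have "\<Omega> \<noteq> {}" using one[of v] assms(4) by auto
    then show ?thesis using assms(1) by (simp add: W_def card_gt_0_iff)
  qed
  define X where "X E = (\<Sum>v\<in>V. of_bool (P E v) :: real)" for E
  define \<mu> where "\<mu> = n * a / W"
  have \<mu>0: "\<mu> > 0" using n0 W0 assms(4) by (simp add: \<mu>_def)
  have ind: "(\<Sum>E\<in>\<Omega>. of_bool (Q E) :: real) = real (card {E \<in> \<Omega>. Q E})" for Q
    using assms(1) by (simp add: sum_of_bool_eq Int_def)
  have EX: "(\<Sum>E\<in>\<Omega>. X E) = n * a"
  proof -
    have "(\<Sum>E\<in>\<Omega>. X E) = (\<Sum>v\<in>V. \<Sum>E\<in>\<Omega>. of_bool (P E v))" unfolding X_def by (rule sum.swap)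
    also have "\<dots> = (\<Sum>v\<in>V. a)" by (rule sum.cong) (auto simp: ind one)
    finally show ?thesis by (simp add: n_def)
  qed
  have EX2: "(\<Sum>E\<in>\<Omega>. (X E)\<^sup>2) \<le> n * a + n\<^sup>2 * b"
  proof -
    have "(\<Sum>E\<in>\<Omega>. (X E)\<^sup>2) = (\<Sum>E\<in>\<Omega>. \<Sum>u\<in>V. \<Sum>v\<in>V. of_bool (P E u \<and> P E v))"
      unfolding X_def power2_eq_square sum_product by (simp only: of_bool_conj)
    also have "\<dots> = (\<Sum>u\<in>V. \<Sum>E\<in>\<Omega>. \<Sum>v\<in>V. of_bool (P E u \<and> P E v))" by (rule sum.swap)
    also have "\<dots> = (\<Sum>u\<in>V. \<Sum>v\<in>V. \<Sum>E\<in>\<Omega>. of_bool (P E u \<and> P E v))"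
      by (intro sum.cong refl sum.swap)
    also have "\<dots> = (\<Sum>u\<in>V. \<Sum>v\<in>V. real (card {E \<in> \<Omega>. P E u \<and> P E v}))" by (simp only: ind)
    also have "\<dots> \<le> (\<Sum>u\<in>V. \<Sum>v\<in>V. (if u = v then a else 0) + b)"
    proof (intro sum_mono)
      fix u v assume "u \<in> V" "v \<in> V"
      then show "real (card {E \<in> \<Omega>. P E u \<and> P E v}) \<le> (if u = v then a else 0) + b"
        using one[of u] two[of u v] b by auto
    qed
    also have "\<dots> = n * a + n\<^sup>2 * b"
      using assms(2) by (simp add: sum.distrib n_def power2_eq_square algebra_simps)
    finally show ?thesis .
  qed
  let ?Z = "{E \<in> \<Omega>. \<forall>v\<in>V. \<not> P E v}"
  have "real (card ?Z) * \<mu>\<^sup>2 = (\<Sum>E\<in>?Z. (X E - \<mu>)\<^sup>2)"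
  proof -
    have "X E = 0" if "E \<in> ?Z" for E using that by (auto simp: X_def)
    then show ?thesis by simp
  qed
  also have "\<dots> \<le> (\<Sum>E\<in>\<Omega>. (X E - \<mu>)\<^sup>2)" using assms(1) by (intro sum_mono2) auto
  also have "\<dots> = (\<Sum>E\<in>\<Omega>. (X E)\<^sup>2) - 2 * \<mu> * (\<Sum>E\<in>\<Omega>. X E) + W * \<mu>\<^sup>2"
  proof -
    have "(\<Sum>E\<in>\<Omega>. (X E - \<mu>)\<^sup>2) = (\<Sum>E\<in>\<Omega>. (X E)\<^sup>2 - 2 * \<mu> * X E + \<mu>\<^sup>2)"
      by (rule sum.cong) (auto simp: power2_diff)
    then show ?thesis by (simp add: sum.distrib sum_subtractf W_def flip: sum_distrib_left)
  qed
  also have "\<dots> \<le> n * a + n\<^sup>2 * b - 2 * \<mu> * (n * a) + W * \<mu>\<^sup>2" using EX2 unfolding EX by simp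
  also have "\<dots> = n * a + n\<^sup>2 * b - W * \<mu>\<^sup>2"
    using W0 by (simp add: \<mu>_def power2_eq_square)
  finally have "real (card ?Z) \<le> (n * a + n\<^sup>2 * b - W * \<mu>\<^sup>2) / \<mu>\<^sup>2" using \<mu>0 by (simp add: pos_le_divide_eq)
  also have "\<dots> = (W / (n * a) + b * W / a\<^sup>2 - 1) * W"
    using n0 W0 assms(4) by (simp add: \<mu>_def field_simps power2_eq_square)
  finally show ?thesis by (simp add: n_def W_def)
qed

text \<open>Near independence of two degrees. In the falling factorials the factors satisfy
  \<open>(B - i) (N - i) \<le> (A - i)^2\<close>, so only the \<open>2 d\<close> surplus factors of \<open>N choose m\<close> are lost.\<close>

lemma binomial_pair_le:
  fixes N A B m d g :: nat
  assumes B: "real B = real N - 2 * real g + 1" and A: "real A = real N - real g"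
    and g: "real N \<le> real g ^ 2" and m: "2 * d \<le> m" "m \<le> B" "m < A"
  shows "real (B choose (m - 2 * d)) * real (N choose m)
    \<le> real (A choose (m - d)) ^ 2 * (real N / (real A - real m)) ^ (2 * d)"
proof -
  define q where "q = m - 2 * d"
  define \<alpha> where "\<alpha> = (\<Prod>i=0..<q. real A - real i)"
  define \<delta> where "\<delta> = real A - real m"
  have d0: "\<delta> > 0" using m by (simp add: \<delta>_def)
  have mN: "m \<le> N" using m A by linarith
  have \<alpha>0: "\<alpha> > 0" unfolding \<alpha>_def using m by (intro prod_pos) (auto simp: q_def)
  have split: "prod f {0..<k} = prod f {0..<q} * prod f {q..<k}" if "q \<le> k" for f :: "nat \<Rightarrow> real" and k
    using that by (simp add: prod.atLeastLessThan_concat)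
  have 1: "real (N choose m) * fact m \<le> (\<Prod>i=0..<q. real N - real i) * real N ^ (2 * d)"
  proof -
    have "(\<Prod>i=q..<m. real N - real i) \<le> (\<Prod>i=q..<m. real N)" using mN by (intro prod_mono) auto
    also have "\<dots> = real N ^ (2 * d)" using m by (simp add: q_def)
    finally show ?thesis unfolding binomial_prod using split[of m "\<lambda>i. real N - real i"] mN
      by (auto simp: q_def intro!: mult_left_mono prod_nonneg)
  qed
  have 2: "real (A choose (m - d)) * fact (m - d) \<ge> \<alpha> * \<delta> ^ d"
  proof -
    have "(\<Prod>i=q..<m - d. \<delta>) \<le> (\<Prod>i=q..<m - d. real A - real i)"
      using d0 by (intro prod_mono) (auto simp: \<delta>_def)
    moreover have "(\<Prod>i=q..<m - d. \<delta>) = \<delta> ^ d" using m by (simp add: q_def)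
    ultimately show ?thesis unfolding binomial_prod using split[of "m - d" "\<lambda>i. real A - real i"] \<alpha>0 m
      by (auto simp: q_def \<alpha>_def intro!: mult_left_mono)
  qed
  have 3: "real (B choose q) * fact q * (\<Prod>i=0..<q. real N - real i) \<le> \<alpha> ^ 2"
  proof -
    have "real (B choose q) * fact q * (\<Prod>i=0..<q. real N - real i)
        = (\<Prod>i=0..<q. (real B - real i) * (real N - real i))"
      unfolding binomial_prod prod.distrib by simp
    also have "\<dots> \<le> (\<Prod>i=0..<q. (real A - real i) * (real A - real i))"
    proof (rule prod_mono)
      fix i assume "i \<in> {0..<q}"
      then have i: "i < m" by (simp add: q_def)
      define z where "z = real N - real i"
      \<comment> \<open>The difference of the two sides is \<open>g^2 - z\<close>, and
        \<open>z \<le> N \<le> g^2\<close>.\<close>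
      have "(z - 2 * real g + 1) * z \<le> (z - real g) * (z - real g)"
        using g by (simp add: z_def power2_eq_square algebra_simps)
      moreover have e: "real B - real i = z - 2 * real g + 1" "real A - real i = z - real g" "real N - real i = z"
        using A B by (auto simp: z_def)
      moreover have "0 \<le> (real B - real i) * (real N - real i)" using i m mN by simp
      ultimately show "0 \<le> (real B - real i) * (real N - real i) \<and>
         (real B - real i) * (real N - real i) \<le> (real A - real i) * (real A - real i)"
        unfolding e by simp
    qed
    also have "\<dots> = \<alpha> ^ 2" by (simp add: \<alpha>_def prod.distrib power2_eq_square)
    finally show ?thesis .
  qed
  \<comment> \<open>\<open>q\<close> and \<open>m\<close> have the same sum as two copies of
    \<open>m - d\<close>, so this is the maximality of the central binomial coefficient.\<close>
  have 4: "fact (m - d) * fact (m - d) \<le> (fact q * fact m :: real)"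
  proof -
    have "(2 * (m - d)) choose q \<le> (2 * (m - d)) choose (m - d)" by (rule binomial_maximum')
    then have "real ((2 * (m - d)) choose q) \<le> real ((2 * (m - d)) choose (m - d))" by (rule of_nat_mono)
    moreover have "2 * (m - d) - q = m" "2 * (m - d) - (m - d) = m - d" "q \<le> 2 * (m - d)" using m by (auto simp: q_def)
    ultimately have "fact (2 * (m - d)) / (fact q * fact m) \<le> (fact (2 * (m - d)) / (fact (m - d) * fact (m - d)) :: real)"
      by (simp add: binomial_fact)
    then show ?thesis by (simp add: divide_le_cancel frac_le_eq divide_simps)
  qed
  have "real (B choose q) * real (N choose m) * (fact q * fact m) * \<delta> ^ (2 * d)
     = (real (B choose q) * fact q) * (real (N choose m) * fact m) * \<delta> ^ (2 * d)" by (simp only: mult_ac)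
  also have "\<dots> \<le> (real (B choose q) * fact q) * ((\<Prod>i=0..<q. real N - real i) * real N ^ (2 * d)) * \<delta> ^ (2 * d)"
    using 1 d0 by (intro mult_right_mono mult_left_mono) auto
  also have "\<dots> = (real (B choose q) * fact q * (\<Prod>i=0..<q. real N - real i)) * (real N ^ (2 * d) * \<delta> ^ (2 * d))"
    by (simp only: mult_ac)
  also have "\<dots> \<le> \<alpha> ^ 2 * (real N ^ (2 * d) * \<delta> ^ (2 * d))" using 3 d0 by (intro mult_right_mono) auto
  also have "\<dots> = (\<alpha> * \<delta> ^ d) ^ 2 * real N ^ (2 * d)"
    by (simp add: power_mult_distrib power_mult[symmetric] mult_ac)
  also have "\<dots> \<le> (real (A choose (m - d)) * fact (m - d)) ^ 2 * real N ^ (2 * d)"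
    using 2 \<alpha>0 d0 by (intro mult_right_mono power_mono) auto
  also have "\<dots> = real (A choose (m - d)) ^ 2 * real N ^ (2 * d) * (fact (m - d) * fact (m - d))"
    by (simp add: power_mult_distrib power2_eq_square)
  also have "\<dots> \<le> real (A choose (m - d)) ^ 2 * real N ^ (2 * d) * (fact q * fact m)"
    using 4 by (intro mult_left_mono) auto
  finally have "real (B choose q) * real (N choose m) * \<delta> ^ (2 * d) * (fact q * fact m)
    \<le> real (A choose (m - d)) ^ 2 * real N ^ (2 * d) * (fact q * fact m)" by (simp only: mult_ac)
  then have "real (B choose q) * real (N choose m) * \<delta> ^ (2 * d)
    \<le> real (A choose (m - d)) ^ 2 * real N ^ (2 * d)"
    by (rule mult_right_le_imp_le) simp
  then show ?thesis using d0 by (simp add: power_divide q_def \<delta>_def pos_le_divide_eq)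
qed

text \<open>Second moment for vertices of degree exactly \<open>d\<close>. The \<open>4\<close>
  comes from two falling factorials, each at least half of the full power; \<open>9 = 8 + 1\<close>
  from the edges outside the star and from Stirling. In the pair term, \<open>13 d / n\<close>
  accounts for the surplus factors of \<open>binomial_pair_le\<close> and \<open>2 d^2 / m\<close>
  for adjacent pairs.\<close>

lemma card_low_degree_le:
  fixes n m d :: nat
  assumes n: "n \<ge> 100" and m: "1 \<le> m" "real m \<le> 3/5 * real n" and d: "2 \<le> d"
    "4 * real d ^ 2 \<le> real m"
  shows "real (card {E \<in> all_graphs n m. max_degree {1..n} E < d})
    \<le> (4 * exp (9 - nu_fun n (2 * m) (real d))
       + (exp (13 * real d / real n) * (1 + 2 * real d ^ 2 / real m) - 1)) * real (card (all_graphs n m))"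
proof -
  define N where "N = n choose 2"
  define g where "g = n - 1"
  define A where "A = N - g"
  define B where "B = N - 1 - 2 * (n - 2)"
  define q where "q = m - 2 * d"
  define W where "W = real (N choose m)"
  define a where "a = real (g choose d) * real (A choose (m - d))"
  define b where "b = real ((n - 2) choose d) ^ 2 * real (B choose q)
      + real ((n - 2) choose (d - 1)) ^ 2 * real (B choose (q + 1))"
  have rg: "real g = real n - 1" using n by (simp add: g_def of_nat_diff)
  have N: "real N = real n * (real n - 1) / 2"
    using real_choose_two[of n] n by (simp add: N_def)
  have Nbig: "real N \<ge> real n ^ 2 / 4 + 3 * real n"
  proof -
    have "real n * 100 \<le> real n * real n" using n by (intro mult_left_mono) auto
    then show ?thesis unfolding N by (simp add: power2_eq_square algebra_simps)
  qed
  have n2: "real n ^ 2 \<ge> 0" by simp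
  have Ng: "real N \<le> real g ^ 2"
  proof -
    have "real n / 2 * (real n - 1) \<le> (real n - 1) * (real n - 1)" using n by (intro mult_right_mono) auto
    then show ?thesis unfolding N rg power2_eq_square by simp
  qed
  have "real g \<le> real N" using Nbig rg n2 n by linarith
  then have rA: "real A = real N - real g" by (simp add: A_def of_nat_diff)
  have gN: "1 + 2 * (n - 2) \<le> N" 
  proof -
    have "real (1 + 2 * (n - 2)) = 2 * real n - 3" using n by (simp add: of_nat_diff)
    then have "real (1 + 2 * (n - 2)) \<le> real N" using Nbig n n2 by linarith
    then show ?thesis by (simp only: of_nat_le_iff)
  qed
  have rB: "real B = real N - 2 * real g + 1" using gN n by (simp add: B_def rg of_nat_diff)
  have mB: "m \<le> B" using m rB rg Nbig n2 n by linarith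
  have mA: "m < A" using m rA rg Nbig n2 n by linarith
  have mN: "m \<le> N" using mA rA by linarith
  have Am: "real A - real m \<ge> real n ^ 2 / 4" using m rA rg Nbig by linarith
  have dd: "real d \<le> real d ^ 2" using d by (simp add: power2_eq_square)
  have d4: "4 * real d \<le> real m" using dd d by linarith
  have d2m: "2 * d \<le> m" "d \<le> m" using d4 by linarith+
  have qm: "real q \<ge> real m / 2" using d4 d2m by (simp add: q_def of_nat_diff)
  have gd: "d \<le> g" using d4 m rg n by linarith
  have W0: "W > 0" using mN by (simp add: W_def)
  have a0: "a > 0" using gd mA by (simp add: a_def)
  have b0: "b \<ge> 0" by (simp add: b_def)
  have rho: "(real N / (real A - real m)) ^ (2 * d) \<le> exp (13 * real d / real n)"
  proof -
    have Am0: "real A - real m > 0" using mA by simp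
    have "real N / (real A - real m) = 1 + (real g + real m) / (real A - real m)"
      using Am0 rA by (simp add: field_simps)
    also have "\<dots> \<le> 1 + (8/5 * real n) / (real n ^ 2 / 4)"
      using rg m Am n by (intro add_left_mono frac_le) auto
    also have "\<dots> = 1 + (32/5) / real n" using n by (simp add: power2_eq_square)
    also have "\<dots> \<le> exp ((32/5) / real n)" by (rule exp_ge_add_one_self)
    finally have "(real N / (real A - real m)) ^ (2 * d) \<le> exp ((32/5) / real n) ^ (2 * d)"
      using Am0 by (intro power_mono) auto
    also have "\<dots> = exp (real (2 * d) * ((32/5) / real n))" by (rule exp_of_nat_mult[symmetric])
    \<comment> \<open>\<open>2 * 32/5 = 12.8\<close> is rounded up.\<close>
    also have "\<dots> \<le> exp (13 * real d / real n)" using n by (simp add: field_simps)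
    finally show ?thesis .
  qed
  have bb: "b \<le> real (g choose d) ^ 2 * real (B choose q) * (1 + 2 * real d ^ 2 / real m)"
  proof -
    have 1: "real ((n - 2) choose d) ^ 2 \<le> real (g choose d) ^ 2"
    proof -
      have "(n - 2) choose d \<le> g choose d" by (rule binomial_right_mono) (simp add: g_def)
      then show ?thesis by (intro power_mono of_nat_mono) auto
    qed
    have "real ((n - 2) choose (d - 1)) * real g = real d * real (g choose d)"
    proof -
      have "Suc (d - 1) * (g choose Suc (d - 1)) = g * ((g - 1) choose (d - 1))" by (rule binomial_absorption)
      moreover have "Suc (d - 1) = d" "g - 1 = n - 2" using d by (auto simp: g_def)
      ultimately have "d * (g choose d) = g * ((n - 2) choose (d - 1))" by simp
      then show ?thesis by (metis mult.commute of_nat_mult)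
    qed
    then have 2: "real ((n - 2) choose (d - 1)) ^ 2 * real g ^ 2 = real d ^ 2 * real (g choose d) ^ 2"
      by (metis power_mult_distrib)
    have 3: "real (B choose (q + 1)) * real (q + 1) \<le> real (B choose q) * real N"
    proof -
      have "(B choose Suc q) * Suc q = (B choose q) * (B - q)"
        using binomial_absorb_comp[of B q] binomial_absorption[of q B] by (simp add: mult.commute)
      also have "\<dots> \<le> (B choose q) * N" by (intro mult_left_mono) (auto simp: B_def)
      finally have "real ((B choose Suc q) * Suc q) \<le> real ((B choose q) * N)" by (rule of_nat_mono)
      then show ?thesis by (simp add: algebra_simps)
    qed
    \<comment> \<open>Relative to nonadjacent pairs, the adjacent ones cost \<open>(d / g)^2\<close>
      in the stars and gain at most \<open>N / (q + 1)\<close> outside; with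
      \<open>N \<le> g^2\<close> and \<open>q + 1 \<ge> m / 2\<close> this is at most
      \<open>2 d^2 / m\<close>.\<close>
    have "real ((n - 2) choose (d - 1)) ^ 2 * real (B choose (q + 1)) * (real g ^ 2 * real (q + 1))
      = (real ((n - 2) choose (d - 1)) ^ 2 * real g ^ 2) * (real (B choose (q + 1)) * real (q + 1))"
      by (simp only: mult_ac)
    also have "\<dots> \<le> (real d ^ 2 * real (g choose d) ^ 2) * (real (B choose q) * real N)"
      unfolding 2 by (intro mult_left_mono 3) auto
    also have "\<dots> \<le> (real d ^ 2 * real (g choose d) ^ 2) * (real (B choose q) * real g ^ 2)"
      by (intro mult_left_mono Ng) auto
    finally have "(real ((n - 2) choose (d - 1)) ^ 2 * real (B choose (q + 1)) * real (q + 1)) * real g ^ 2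
      \<le> (real d ^ 2 * real (g choose d) ^ 2 * real (B choose q)) * real g ^ 2" by (simp only: mult_ac)
    then have 4: "real ((n - 2) choose (d - 1)) ^ 2 * real (B choose (q + 1)) * real (q + 1)
      \<le> real d ^ 2 * real (g choose d) ^ 2 * real (B choose q)"
      by (rule mult_right_le_imp_le) (use rg n in simp)
    have q1: "real (q + 1) \<ge> real m / 2" using qm by simp
    have "real ((n - 2) choose (d - 1)) ^ 2 * real (B choose (q + 1)) * (real m / 2)
      \<le> real ((n - 2) choose (d - 1)) ^ 2 * real (B choose (q + 1)) * real (q + 1)"
      by (intro mult_left_mono q1) auto
    then have "real ((n - 2) choose (d - 1)) ^ 2 * real (B choose (q + 1)) * (real m / 2)
      \<le> real d ^ 2 * real (g choose d) ^ 2 * real (B choose q)" using 4 by linarith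
    then have "real ((n - 2) choose (d - 1)) ^ 2 * real (B choose (q + 1))
      \<le> real (g choose d) ^ 2 * real (B choose q) * (2 * real d ^ 2 / real m)"
      using m by (simp add: field_simps)
    moreover have "real ((n - 2) choose d) ^ 2 * real (B choose q) \<le> real (g choose d) ^ 2 * real (B choose q)"
      by (intro mult_right_mono 1) auto
    ultimately show ?thesis unfolding b_def by (simp add: algebra_simps)
  qed
  have second: "b * W / a\<^sup>2 \<le> exp (13 * real d / real n) * (1 + 2 * real d ^ 2 / real m)"
  proof -
    have pair: "real (B choose q) * W \<le> real (A choose (m - d)) ^ 2 * (real N / (real A - real m)) ^ (2 * d)"
      unfolding q_def W_def
      by (rule binomial_pair_le[OF rB rA Ng d2m(1) mB mA])
    have "b * W \<le> real (g choose d) ^ 2 * real (B choose q) * (1 + 2 * real d ^ 2 / real m) * W"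
      using bb W0 by (intro mult_right_mono) auto
    also have "\<dots> = real (g choose d) ^ 2 * (1 + 2 * real d ^ 2 / real m) * (real (B choose q) * W)"
      by (simp only: mult_ac)
    also have "\<dots> \<le> real (g choose d) ^ 2 * (1 + 2 * real d ^ 2 / real m) *
        (real (A choose (m - d)) ^ 2 * exp (13 * real d / real n))"
    proof (rule mult_left_mono)
      have "real (A choose (m - d)) ^ 2 * (real N / (real A - real m)) ^ (2 * d)
        \<le> real (A choose (m - d)) ^ 2 * exp (13 * real d / real n)" by (intro mult_left_mono rho) auto
      then show "real (B choose q) * W \<le> real (A choose (m - d)) ^ 2 * exp (13 * real d / real n)"
        using pair by linarith
    qed auto
    also have "\<dots> = exp (13 * real d / real n) * (1 + 2 * real d ^ 2 / real m) * a\<^sup>2"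
      by (simp add: a_def power_mult_distrib mult_ac)
    finally show ?thesis using a0 by (simp add: pos_divide_le_eq)
  qed
  have first: "W / (real n * a) \<le> 4 * exp (9 - nu_fun n (2 * m) (real d))"
  proof -
    define \<tau> where "\<tau> = real n * (2 * real m / real n) ^ d / fact d"
    have \<tau>: "\<tau> \<ge> exp (nu_fun n (2 * m) (real d) - 1)"
    proof -
      have "ln \<tau> = ln (real n) + real d * (ln (real (2 * m)) - ln (real n)) - ln (fact d)"
        using n m by (simp add: \<tau>_def ln_mult ln_div ln_realpow)
      moreover have "ln (fact d) \<le> (real d + 1/2) * ln (real d) - real d + 1"
        using ln_fact_bounds(2)[of d] d by simp
      ultimately have "nu_fun n (2 * m) (real d) - 1 \<le> ln \<tau>" by (simp add: nu_fun_def algebra_simps)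
      then show ?thesis using n m by (subst (asm) ln_ge_iff) (auto simp: \<tau>_def)
    qed
    have i: "(real g - real d) ^ d \<ge> real n ^ d / 2"
    proof -
      have "real d * (real d + 1) \<le> 2 * real d ^ 2" using dd by (simp add: power2_eq_square algebra_simps)
      also have "\<dots> \<le> real n / 2" using d m by linarith
      finally have "1/2 \<le> 1 + real d * (- ((real d + 1) / real n))" using n by (simp add: field_simps)
      also have "\<dots> \<le> (1 + - ((real d + 1) / real n)) ^ d"
        using gd rg n by (intro Bernoulli_inequality) (simp add: field_simps)
      finally have "real n ^ d * (1/2) \<le> real n ^ d * (1 + - ((real d + 1) / real n)) ^ d"
        by (intro mult_left_mono) auto
      also have "\<dots> = (real g - real d) ^ d"
      proof -
        have "real n * (1 + - ((real d + 1) / real n)) = real g - real d"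
          unfolding rg using n by (simp add: field_simps)
        then show ?thesis by (simp only: power_mult_distrib[symmetric])
      qed
      finally show ?thesis by simp
    qed
    have ii: "(real m - real d) ^ d \<ge> real m ^ d / 2"
    proof -
      have "1/2 \<le> 1 + real d * (- (real d / real m))" using d m by (simp add: field_simps power2_eq_square)
      also have "\<dots> \<le> (1 + - (real d / real m)) ^ d"
        using d2m m by (intro Bernoulli_inequality) simp
      finally have "real m ^ d * (1/2) \<le> real m ^ d * (1 + - (real d / real m)) ^ d"
        by (intro mult_left_mono) auto
      also have "\<dots> = (real m - real d) ^ d"
      proof -
        have "real m * (1 + - (real d / real m)) = real m - real d" using m by (simp add: field_simps)
        then show ?thesis by (simp only: power_mult_distrib[symmetric])
      qed
      finally show ?thesis by simp
    qed
    have N0: "real N > 0" using Nbig n n2 by linarith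
    \<comment> \<open>Each of the at most \<open>m \<le> (3/5) n\<close> factors loses
      \<open>1 - y\<close> with \<open>y\<close> of order \<open>1 / n\<close>, and
      \<open>2 * (32/5) * (3/5) < 8\<close>.\<close>
    have iii: "(real A - real m) ^ (m - d) \<ge> real N ^ (m - d) * exp (- 8)"
    proof -
      define y where "y = (real g + real m) / real N"
      have y: "0 \<le> y" "y \<le> (32/5) / real n"
      proof -
        show "0 \<le> y" by (simp add: y_def)
        have "y \<le> (8/5 * real n) / (real n ^ 2 / 4)"
          unfolding y_def using rg m Nbig n by (intro frac_le) auto
        also have "\<dots> = (32/5) / real n" using n by (simp add: power2_eq_square)
        finally show "y \<le> (32/5) / real n" .
      qed
      have "(32/5) / real n \<le> (32/5) / 100" using n by (intro divide_left_mono) auto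
      then have y2: "y \<le> 1/2" using y by linarith
      have "real (m - d) * (2 * y) \<le> real m * (2 * ((32/5) / real n))"
        using y by (intro mult_mono) auto
      also have "\<dots> \<le> (3/5 * real n) * (2 * ((32/5) / real n))" using m by (intro mult_right_mono) auto
      also have "\<dots> \<le> 8" using n by simp
      finally have "exp (- 8) \<le> exp (real (m - d) * (- 2 * y))" by simp
      also have "\<dots> = exp (- 2 * y) ^ (m - d)" by (rule exp_of_nat_mult)
      also have "\<dots> \<le> (1 - y) ^ (m - d)" by (intro power_mono exp_le_one_minus y y2) auto
      finally have "real N ^ (m - d) * exp (- 8) \<le> real N ^ (m - d) * (1 - y) ^ (m - d)"
        by (intro mult_left_mono) auto
      also have "\<dots> = (real A - real m) ^ (m - d)"
      proof -
        have "real N * (1 - y) = real A - real m" unfolding rA using N0 by (simp add: y_def field_simps)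
        then show ?thesis by (simp only: power_mult_distrib[symmetric])
      qed
      finally show ?thesis .
    qed
    have gch: "real (g choose d) \<ge> real n ^ d / 2 / fact d"
      using binomial_mult_fact_ge[OF gd] i by (simp add: divide_le_eq)
    have Ach: "real (A choose (m - d)) * fact (m - d) \<ge> real N ^ (m - d) * exp (- 8)"
    proof -
      have "(real A - real m) ^ (m - d) \<le> (real A - real (m - d)) ^ (m - d)"
        using mA by (intro power_mono) auto
      also have "\<dots> \<le> real (A choose (m - d)) * fact (m - d)" using mA by (intro binomial_mult_fact_ge) auto
      finally show ?thesis using iii by linarith
    qed
    have fm: "fact m \<ge> (real m ^ d / 2) * fact (m - d)"
    proof -
      have "real (m choose d) * fact d = fact m / fact (m - d)" using d2m by (simp add: binomial_fact)
      then have "real m ^ d / 2 \<le> fact m / fact (m - d)"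
        using binomial_mult_fact_ge[OF d2m(2)] ii by linarith
      then show ?thesis by (simp add: le_divide_eq)
    qed
    have Wm: "W * fact m \<le> real N ^ m"
      unfolding W_def using binomial_le_pow_div_fact[of N m] by (simp add: le_divide_eq)
    have Nn: "real N \<le> real n ^ 2 / 2" unfolding N by (simp add: power2_eq_square algebra_simps)
    have key: "\<tau> * (exp (-8) / 4) * W \<le> real n * a"
    proof -
      have "\<tau> * (exp (-8) / 4) * W * (fact (m - d) * real N ^ d)
          = real n * 2 ^ d * real m ^ d / real n ^ d / fact d * (exp (-8) / 4) * W * fact (m - d) * real N ^ d"
        by (simp add: \<tau>_def power_divide power_mult_distrib)
      also have "\<dots> = real n / real n ^ d / fact d * (exp (-8) / 2) * (W * ((real m ^ d / 2) * fact (m - d))) * (2 * real N) ^ d"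
        by (simp add: power_mult_distrib mult_ac)
      also have "\<dots> \<le> real n / real n ^ d / fact d * (exp (-8) / 2) * (W * fact m) * (2 * real N) ^ d"
        using W0 fm by (intro mult_right_mono mult_left_mono) auto
      also have "\<dots> \<le> real n / real n ^ d / fact d * (exp (-8) / 2) * real N ^ m * (2 * real N) ^ d"
        using Wm by (intro mult_right_mono mult_left_mono) auto
      also have "\<dots> \<le> real n / real n ^ d / fact d * (exp (-8) / 2) * real N ^ m * (real n ^ 2) ^ d"
        using Nn by (intro mult_left_mono power_mono) auto
      also have "\<dots> = real n * (real n ^ d / 2 / fact d) * (real N ^ (m - d) * exp (-8)) * real N ^ d"
      proof -
        have "real N ^ m = real N ^ (m - d) * real N ^ d" using d2m by (simp flip: power_add)
        moreover have "(real n ^ 2) ^ d = real n ^ d * real n ^ d"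
          by (simp add: power2_eq_square power_mult_distrib)
        ultimately show ?thesis using n by (simp add: mult_ac)
      qed
      also have "\<dots> \<le> real n * real (g choose d) * (real (A choose (m - d)) * fact (m - d)) * real N ^ d"
        by (rule mult_right_mono[OF mult_mono[OF mult_left_mono[OF gch] Ach]]) auto
      also have "\<dots> = real n * a * (fact (m - d) * real N ^ d)" by (simp add: a_def mult_ac)
      finally have "\<tau> * (exp (-8) / 4) * W * (fact (m - d) * real N ^ d) \<le> real n * a * (fact (m - d) * real N ^ d)" .
      then show ?thesis by (rule mult_right_le_imp_le) (use N0 in simp)
    qed
    have "exp (nu_fun n (2 * m) (real d) - 9) / 4 * W \<le> \<tau> * (exp (-8) / 4) * W"
    proof -
      have "exp (nu_fun n (2 * m) (real d) - 9) = exp (nu_fun n (2 * m) (real d) - 1) * exp (-8)"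
        by (simp flip: exp_add)
      also have "\<dots> \<le> \<tau> * exp (-8)" using \<tau> by (intro mult_right_mono) auto
      finally show ?thesis using W0 by simp
    qed
    then have "exp (nu_fun n (2 * m) (real d) - 9) / 4 * W \<le> real n * a" using key by linarith
    then have "W / (real n * a) \<le> 4 / exp (nu_fun n (2 * m) (real d) - 9)"
      using a0 n by (simp add: divide_simps mult_ac)
    also have "\<dots> = 4 * exp (9 - nu_fun n (2 * m) (real d))"
      by (simp add: exp_diff)
    finally show ?thesis .
  qed
  have cW: "real (card (all_graphs n m)) = W" by (simp add: card_all_graphs W_def N_def)
  have "{E \<in> all_graphs n m. max_degree {1..n} E < d} \<subseteq> {E \<in> all_graphs n m. \<forall>v\<in>{1..n}. \<not> degree E v = d}"
  proof
    fix E assume E: "E \<in> {E \<in> all_graphs n m. max_degree {1..n} E < d}"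
    have "degree E v < d" if "v \<in> {1..n}" for v
      using E max_degree_ge_iff[of n "degree E v" E] that n by force
    then show "E \<in> {E \<in> all_graphs n m. \<forall>v\<in>{1..n}. \<not> degree E v = d}" using E by fastforce
  qed
  then have "real (card {E \<in> all_graphs n m. max_degree {1..n} E < d})
      \<le> real (card {E \<in> all_graphs n m. \<forall>v\<in>{1..n}. \<not> degree E v = d})"
    using finite_all_graphs by (intro of_nat_mono card_mono) auto
  also have "\<dots> \<le> (real (card (all_graphs n m)) / (real (card {1..n}) * a)
      + b * real (card (all_graphs n m)) / a\<^sup>2 - 1) * real (card (all_graphs n m))"
  proof (rule chebyshev_count_zero[OF finite_all_graphs _ _ a0 _ _ b0])
    show "real (card {E \<in> all_graphs n m. degree E v = d}) = a" if "v \<in> {1..n}" for v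
      using card_degree_eq[OF that d2m(2)] by (simp add: a_def g_def A_def N_def)
    show "real (card {E \<in> all_graphs n m. degree E u = d \<and> degree E v = d}) \<le> b"
      if "u \<in> {1..n}" "v \<in> {1..n}" "u \<noteq> v" for u v
    proof -
      have "card {E \<in> all_graphs n m. degree E u = d \<and> degree E v = d}
        \<le> ((n - 2) choose d) ^ 2 * (B choose q) + ((n - 2) choose (d - 1)) ^ 2 * (B choose (q + 1))"
        using card_two_degrees_le[OF that _ d2m(1)] d by (simp add: B_def q_def N_def)
      then have "real (card {E \<in> all_graphs n m. degree E u = d \<and> degree E v = d})
        \<le> real (((n - 2) choose d) ^ 2 * (B choose q) + ((n - 2) choose (d - 1)) ^ 2 * (B choose (q + 1)))"
        by (rule of_nat_mono)
      then show ?thesis by (simp add: b_def)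
    qed
  qed (use n in auto)
  also have "\<dots> = (W / (real n * a) + b * W / a\<^sup>2 - 1) * W" unfolding cW by simp
  also have "\<dots> \<le> (4 * exp (9 - nu_fun n (2 * m) (real d))
       + (exp (13 * real d / real n) * (1 + 2 * real d ^ 2 / real m) - 1)) * W"
    using first second W0 by (intro mult_right_mono) auto
  finally show ?thesis by (simp add: cW)
qed

section \<open>Concentration of the maximum degree\<close>

text \<open>\<open>\<eta>\<close> is split into thirds: one for the upper end by the first moment,
  and two for the lower end by the two terms of the second moment.\<close>

lemma bad_degree_fraction:
  fixes m :: "nat \<Rightarrow> nat" and C \<epsilon> \<eta> :: real
  assumes C: "C > 0" and m: "\<And>n. n \<ge> 1 \<Longrightarrow> real (m n) \<le> real n / 2 + C * real n powr (2/3)"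
    and \<epsilon>: "\<epsilon> > 0" and \<eta>: "\<eta> > 0"
  shows "\<forall>\<^sub>F n in sequentially.
    real (card {E \<in> all_graphs n (m n). \<not> (\<lfloor>nu n (2 * m n) - \<epsilon>\<rfloor> \<le> int (max_degree {1..n} E) \<and>
                int (max_degree {1..n} E) \<le> \<lfloor>nu n (2 * m n) + \<epsilon>\<rfloor>)})
      \<le> \<eta> * real (card (all_graphs n (m n))) \<and> m n \<le> n choose 2"
proof -
  define \<Lambda> where "\<Lambda> = max 0 (9 + ln (12 / \<eta>))"
  have \<Lambda>0: "\<Lambda> \<ge> 0" by (simp add: \<Lambda>_def)
  have \<Lambda>: "4 * exp (9 - \<Lambda>) \<le> \<eta> / 3" "exp (- \<Lambda>) \<le> \<eta> / 3"
  proof -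
    have "exp (9 - \<Lambda>) \<le> exp (- ln (12 / \<eta>))" by (simp add: \<Lambda>_def)
    also have "\<dots> = \<eta> / 12" using \<eta> by (simp add: exp_minus)
    finally show 1: "4 * exp (9 - \<Lambda>) \<le> \<eta> / 3" by simp
    have "exp (- \<Lambda>) \<le> exp (9 - \<Lambda>)" by simp
    then have "exp (- \<Lambda>) \<le> 4 * exp (9 - \<Lambda>)" using exp_gt_zero[of "9 - \<Lambda>"] by linarith
    then show "exp (- \<Lambda>) \<le> \<eta> / 3" using 1 by linarith
  qed
  \<comment> \<open>The pair error after inserting \<open>d \<le> 27 + ln n\<close> and
    \<open>m \<ge> sqrt n / 6\<close>; the 12 is \<open>2 * 6\<close>.\<close>
  define g where "g n = exp (13 * (27 + ln (real n)) / real n) * (1 + 12 * (27 + ln (real n)) ^ 2 / sqrt (real n)) - 1" for n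
  have "(\<lambda>n. g n) \<longlonglongrightarrow> 0" unfolding g_def by real_asymp
  then have ev_g: "\<forall>\<^sub>F n in sequentially. g n < \<eta> / 3" using \<eta> by (intro order_tendstoD) auto
  have ev_k: "\<forall>\<^sub>F n in sequentially. real n + 2 * C * real n powr (2/3) \<le> 6/5 * real n"
    using C by real_asymp
  have ev_d: "\<forall>\<^sub>F n in sequentially. 4 * (27 + ln (real n)) ^ 2 \<le> sqrt (real n) / 6" by real_asymp
  show ?thesis
    using nu_fun_window[OF \<epsilon>, of \<Lambda>] ev_g ev_k ev_d eventually_ge_at_top[of 100]
  proof eventually_elim
    case (elim n)
    have n: "n \<ge> 100" using elim by simp
    define M where "M = m n"
    define k where "k = 2 * M"
    define \<nu> where "\<nu> = nu n k"
    define W where "W = real (card (all_graphs n M))"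
    define bad where "bad = {E \<in> all_graphs n M. \<not> (\<lfloor>\<nu> - \<epsilon>\<rfloor> \<le> int (max_degree {1..n} E) \<and>
                int (max_degree {1..n} E) \<le> \<lfloor>\<nu> + \<epsilon>\<rfloor>)}"
    have k65: "real k \<le> 6/5 * real n" using m[of n] elim(3) n by (simp add: k_def M_def)
    then have M35: "real M \<le> 3/5 * real n" by (simp add: k_def)
    have "M \<le> n" using M35 by linarith
    then have MN: "M \<le> n choose 2" using le_choose_two[of n] n by linarith
    have "real (card bad) \<le> \<eta> * W"
    \<comment> \<open>Without edges the maximum degree is 0, and the convention
      \<open>nu n 0 = 0\<close> puts it into the interval.\<close>
    proof (cases "M = 0")
      case True
      have "E = {}" if "E \<in> all_graphs n M" for E
        using that True finite_subset[OF _ finite_vertex_pairs] by (auto simp: all_graphs_eq)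
      moreover have "max_degree {1..n} ({} :: nat set set) = 0"
        using n by (simp add: max_degree_def degree_def image_constant_conv)
      moreover have "\<nu> = 0" using True by (simp add: \<nu>_def k_def nu_def)
      ultimately have "bad = {}" using \<epsilon> by (fastforce simp: bad_def)
      then show ?thesis using \<eta> by (simp add: W_def)
    next
      case False
      then have M1: "M \<ge> 1" and k1: "k \<ge> 1" by (auto simp: k_def)
      have n1: "n \<ge> 1" using n by simp
      have nu1: "\<nu> > 1" using nu_root[OF n1 k1 k65] by (simp add: \<nu>_def)
      have win_up: "nu_fun n k y \<le> - \<Lambda>" if "\<nu> + \<epsilon> \<le> y" for y
        using elim(1) k1 k65 that by (simp add: \<nu>_def)
      have win_lo: "nu_fun n k y \<ge> \<Lambda>" if "1 \<le> y" "y \<le> \<nu> - \<epsilon>" for y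
        using elim(1) k1 k65 that by (simp add: \<nu>_def)
      \<comment> \<open>The least integer beyond the allowed range; it is at least
        \<open>\<nu> + \<epsilon>\<close>, where the exponent is already below
        \<open>- \<Lambda>\<close>.\<close>
      define U where "U = nat (\<lfloor>\<nu> + \<epsilon>\<rfloor> + 1)"
      have U: "U \<ge> 1" "real U \<ge> \<nu> + \<epsilon>" "int U = \<lfloor>\<nu> + \<epsilon>\<rfloor> + 1" using nu1 \<epsilon> unfolding U_def by linarith+
      define D where "D = \<lfloor>\<nu> - \<epsilon>\<rfloor>"
      have up: "real (card {E \<in> all_graphs n M. U \<le> max_degree {1..n} E}) \<le> \<eta> / 3 * W"
      proof -
        have "real (card {E \<in> all_graphs n M. U \<le> max_degree {1..n} E}) \<le> exp (nu_fun n k (real U)) * W"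
          unfolding k_def W_def by (rule card_high_degree_le) (use n M1 MN U in auto)
        also have "\<dots> \<le> \<eta> / 3 * W"
        proof (rule mult_right_mono)
          have "exp (nu_fun n k (real U)) \<le> exp (- \<Lambda>)" using win_up[OF U(2)] by simp
          then show "exp (nu_fun n k (real U)) \<le> \<eta> / 3" using \<Lambda>(2) by linarith
        qed (simp add: W_def)
        finally show ?thesis .
      qed
      have lo: "real (card {E \<in> all_graphs n M. int (max_degree {1..n} E) < D}) \<le> 2 * (\<eta> / 3) * W"
      proof -
        \<comment> \<open>Only \<open>D \<ge> 2\<close> forces enough edges for the second moment. A
          lower end of 1 just asks for an edge, and one of at most 0 for nothing.\<close>
        consider "D \<le> 0" | "D = 1" | "D \<ge> 2" by linarith
        then show ?thesis
        proof cases
          case 1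
          then have none: "{E \<in> all_graphs n M. int (max_degree {1..n} E) < D} = {}" by auto
          show ?thesis unfolding none using \<eta> by (simp add: W_def)
        next
          case 2
          have "1 \<le> max_degree {1..n} E" if E: "E \<in> all_graphs n M" for E
          proof -
            have "E \<noteq> {}" using E M1 by (auto simp: all_graphs_eq)
            then obtain e where e: "e \<in> E" "e \<subseteq> {1..n}" "card e = 2"
              using E by (auto simp: all_graphs_def simple_graph_def)
            then obtain v where v: "v \<in> e" by fastforce
            have "finite E" using E finite_subset[OF _ finite_vertex_pairs] by (auto simp: all_graphs_eq)
            then have "degree E v > 0" unfolding degree_def using e v by (auto simp: card_gt_0_iff)
            then show ?thesis using max_degree_ge_iff[OF n1, of 1 E] e v by force
          qed
          then have none: "{E \<in> all_graphs n M. int (max_degree {1..n} E) < D} = {}" using 2 by fastforce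
          show ?thesis unfolding none using \<eta> by (simp add: W_def)
        next
          case 3
          define d where "d = nat D"
          have d: "d \<ge> 2" "int d = D" using 3 by (auto simp: d_def)
          have "real d = real_of_int D" using d(2) by (metis of_int_of_nat_eq)
          then have dle: "real d \<le> \<nu> - \<epsilon>" unfolding D_def by linarith
          have fd: "nu_fun n k (real d) \<ge> \<Lambda>" using win_lo[of "real d"] d dle by simp
          note bounds = nu_fun_nonneg_bounds[OF n1 k1 k65 d(1)]
          have kb: "real k \<ge> exp (-1) * sqrt (real n)" and db: "real d \<le> 27 + ln (real n)"
            using bounds fd \<Lambda>0 by auto
          have "exp (-1 :: real) \<ge> 1/3"
            using exp_le by (simp add: exp_minus field_simps)
          then have "1/3 * sqrt (real n) \<le> exp (-1) * sqrt (real n)" by (intro mult_right_mono) auto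
          then have Mb: "real M \<ge> sqrt (real n) / 6" using kb by (simp add: k_def)
          have d2: "real d ^ 2 \<le> (27 + ln (real n)) ^ 2" using db by (intro power_mono) auto
          have sn: "sqrt (real n) > 0" using n by simp
          have "real (card {E \<in> all_graphs n M. max_degree {1..n} E < d})
            \<le> (4 * exp (9 - nu_fun n k (real d))
               + (exp (13 * real d / real n) * (1 + 2 * real d ^ 2 / real M) - 1)) * W"
            unfolding k_def W_def
          proof (rule card_low_degree_le)
            show "4 * real d ^ 2 \<le> real M" using d2 elim(4) Mb by linarith
          qed (use n M1 M35 d in auto)
          also have "\<dots> \<le> (\<eta> / 3 + \<eta> / 3) * W"
          proof (intro mult_right_mono add_mono)
            have "exp (9 - nu_fun n k (real d)) \<le> exp (9 - \<Lambda>)" using fd by simp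
            then show "4 * exp (9 - nu_fun n k (real d)) \<le> \<eta> / 3" using \<Lambda>(1) by linarith
            have "exp (13 * real d / real n) \<le> exp (13 * (27 + ln (real n)) / real n)"
              using db by (simp add: divide_right_mono)
            moreover have "2 * real d ^ 2 / real M \<le> 2 * (27 + ln (real n)) ^ 2 / (sqrt (real n) / 6)"
              using d2 Mb sn by (intro frac_le) auto
            ultimately have "exp (13 * real d / real n) * (1 + 2 * real d ^ 2 / real M)
              \<le> exp (13 * (27 + ln (real n)) / real n) * (1 + 12 * (27 + ln (real n)) ^ 2 / sqrt (real n))"
              by (intro mult_mono) auto
            then show "exp (13 * real d / real n) * (1 + 2 * real d ^ 2 / real M) - 1 \<le> \<eta> / 3"
              using elim(2) unfolding g_def by linarith
          qed (simp add: W_def)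
          finally show ?thesis unfolding d(2)[symmetric] by simp
        qed
      qed
      have "bad \<subseteq> {E \<in> all_graphs n M. U \<le> max_degree {1..n} E} \<union> {E \<in> all_graphs n M. int (max_degree {1..n} E) < D}"
      proof
        fix E assume "E \<in> bad"
        then have E: "E \<in> all_graphs n M" and "int (max_degree {1..n} E) < D \<or> int (max_degree {1..n} E) > \<lfloor>\<nu> + \<epsilon>\<rfloor>"
          by (auto simp: bad_def D_def)
        then have "int (max_degree {1..n} E) < D \<or> U \<le> max_degree {1..n} E" using U(3) by linarith
        then show "E \<in> {E \<in> all_graphs n M. U \<le> max_degree {1..n} E} \<union> {E \<in> all_graphs n M. int (max_degree {1..n} E) < D}"
          using E by auto
      qed
      then have "card bad \<le> card ({E \<in> all_graphs n M. U \<le> max_degree {1..n} E} \<union> {E \<in> all_graphs n M. int (max_degree {1..n} E) < D})"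
        using finite_all_graphs by (intro card_mono) auto
      also have "\<dots> \<le> card {E \<in> all_graphs n M. U \<le> max_degree {1..n} E} + card {E \<in> all_graphs n M. int (max_degree {1..n} E) < D}"
        by (rule card_Un_le)
      finally have "real (card bad) \<le> real (card {E \<in> all_graphs n M. U \<le> max_degree {1..n} E})
          + real (card {E \<in> all_graphs n M. int (max_degree {1..n} E) < D})"
        using of_nat_mono by fastforce
      then show ?thesis using up lo by (simp add: algebra_simps)
    qed
    then show ?case using MN by (simp add: bad_def W_def \<nu>_def k_def M_def)
  qed
qed

lemma max_degree_concentration:
  fixes m :: "nat \<Rightarrow> nat" and C \<epsilon> :: real
  assumes C: "C > 0" and m: "\<And>n. n \<ge> 1 \<Longrightarrow> real (m n) \<le> real n / 2 + C * real n powr (2/3)"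
    and \<epsilon>: "\<epsilon> > 0"
  shows "(\<lambda>n. measure_pmf.prob (pmf_of_set (planar_graphs n (m n)))
            {P. \<lfloor>nu n (2 * m n) - \<epsilon>\<rfloor> \<le> int (max_degree {1..n} P) \<and>
                int (max_degree {1..n} P) \<le> \<lfloor>nu n (2 * m n) + \<epsilon>\<rfloor>}) \<longlonglongrightarrow> 1"
    (is "?p \<longlonglongrightarrow> 1")
proof (rule order_tendstoI)
  fix b :: real assume "b < 1"
  obtain c where c: "c > 0"
    and ev_c: "\<forall>\<^sub>F n in sequentially. c * real (card (all_graphs n (m n))) \<le> real (card (planar_graphs n (m n)))"
    using planar_fraction_lower[of m C] m by blast
  \<comment> \<open>Bad planar graphs are bad graphs, so there are at most
    \<open>\<eta> * W \<le> (1 - b) / 2\<close> times the number of planar graphs; the factor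
    \<open>1/2\<close> makes the final inequality strict.\<close>
  define \<eta> where "\<eta> = c * (1 - b) / 2"
  have \<eta>: "\<eta> > 0" using c \<open>b < 1\<close> by (simp add: \<eta>_def)
  have ev_b: "\<forall>\<^sub>F n in sequentially.
    real (card {E \<in> all_graphs n (m n). \<not> (\<lfloor>nu n (2 * m n) - \<epsilon>\<rfloor> \<le> int (max_degree {1..n} E) \<and>
                int (max_degree {1..n} E) \<le> \<lfloor>nu n (2 * m n) + \<epsilon>\<rfloor>)})
      \<le> \<eta> * real (card (all_graphs n (m n))) \<and> m n \<le> n choose 2"
    by (rule bad_degree_fraction[OF C _ \<epsilon> \<eta>]) (rule m)
  show "\<forall>\<^sub>F n in sequentially. b < ?p n"
    using ev_c ev_b
  proof eventually_elim
    case (elim n)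
    define S where "S = planar_graphs n (m n)"
    define W where "W = real (card (all_graphs n (m n)))"
    define G where "G = {P. \<lfloor>nu n (2 * m n) - \<epsilon>\<rfloor> \<le> int (max_degree {1..n} P) \<and>
                int (max_degree {1..n} P) \<le> \<lfloor>nu n (2 * m n) + \<epsilon>\<rfloor>}"
    have W0: "W > 0" using elim(2) by (simp add: W_def card_all_graphs)
    have cS: "c * W \<le> real (card S)" using elim(1) by (simp add: W_def S_def)
    then have S0: "real (card S) > 0" using c W0 by (meson less_le_trans mult_pos_pos)
    have finS: "finite S" by (simp add: S_def finite_planar_graphs)
    have "S \<noteq> {}" using S0 by auto
    then have p: "?p n = real (card (S \<inter> G)) / real (card S)"
      using finS by (simp add: S_def G_def measure_pmf_of_set)
    have "card (S - G) \<le> card {E \<in> all_graphs n (m n). E \<notin> G}"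
      using planar_graphs_subset[of n "m n"] finite_all_graphs by (intro card_mono) (auto simp: S_def)
    then have "real (card (S - G)) \<le> \<eta> * W"
      using elim(2) by (simp add: G_def W_def)
    also have "\<dots> = (1 - b) / 2 * (c * W)" by (simp add: \<eta>_def)
    also have "\<dots> \<le> (1 - b) / 2 * real (card S)" using cS \<open>b < 1\<close> by (intro mult_left_mono) auto
    also have "\<dots> < (1 - b) * real (card S)" using S0 \<open>b < 1\<close> by simp
    finally have "real (card (S - G)) < (1 - b) * real (card S)" .
    moreover have "real (card S) = real (card (S \<inter> G)) + real (card (S - G))"
    proof -
      have "card S = card ((S \<inter> G) \<union> (S - G))" by (simp add: Un_Diff_Int Un_commute)
      also have "\<dots> = card (S \<inter> G) + card (S - G)" using finS by (intro card_Un_disjoint) auto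
      finally show ?thesis by simp
    qed
    ultimately have "b * real (card S) < real (card (S \<inter> G))" by (simp add: algebra_simps)
    then show "b < ?p n" unfolding p using S0 by (simp add: pos_less_divide_eq)
  qed
next
  fix b :: real assume "1 < b"
  then show "\<forall>\<^sub>F n in sequentially. ?p n < b"
    by (intro always_eventually allI) (rule le_less_trans[OF measure_pmf.prob_le_1])
qed

theorem theorem1p4:
  fixes m :: "nat \<Rightarrow> nat" and C \<epsilon> :: real
  assumes "C > 0"
    and "\<And>n. n \<ge> 1 \<Longrightarrow> real (m n) \<le> real n / 2 + C * real n powr (2/3)"
    and "\<epsilon> > 0"
  shows "(\<lambda>n. measure_pmf.prob (pmf_of_set (planar_graphs n (m n)))
            {P. \<lfloor>nu n (2 * m n) - \<epsilon>\<rfloor> \<le> int (max_degree {1..n} P) \<and>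
                int (max_degree {1..n} P) \<le> \<lfloor>nu n (2 * m n) + \<epsilon>\<rfloor>}) \<longlonglongrightarrow> 1
       \<and> (\<lambda>n. measure_pmf.prob (pmf_of_set (planar_graphs n (m n)))
            {P. let D = \<lfloor>nu n (2 * m n) - 1/3\<rfloor>
                in int (max_degree {1..n} P) \<in> {D, D + 1}}) \<longlonglongrightarrow> 1"
proof
  show "(\<lambda>n. measure_pmf.prob (pmf_of_set (planar_graphs n (m n)))
            {P. \<lfloor>nu n (2 * m n) - \<epsilon>\<rfloor> \<le> int (max_degree {1..n} P) \<and>
                int (max_degree {1..n} P) \<le> \<lfloor>nu n (2 * m n) + \<epsilon>\<rfloor>}) \<longlonglongrightarrow> 1"
    by (rule max_degree_concentration[OF assms])
  have lim: "(\<lambda>n. measure_pmf.prob (pmf_of_set (planar_graphs n (m n)))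
            {P. \<lfloor>nu n (2 * m n) - 1/3\<rfloor> \<le> int (max_degree {1..n} P) \<and>
                int (max_degree {1..n} P) \<le> \<lfloor>nu n (2 * m n) + 1/3\<rfloor>}) \<longlonglongrightarrow> 1"
    by (rule max_degree_concentration[OF assms(1,2)]) auto
  show "(\<lambda>n. measure_pmf.prob (pmf_of_set (planar_graphs n (m n)))
            {P. let D = \<lfloor>nu n (2 * m n) - 1/3\<rfloor>
                in int (max_degree {1..n} P) \<in> {D, D + 1}}) \<longlonglongrightarrow> 1"
  proof (rule tendsto_sandwich[OF _ _ lim tendsto_const])
    have sub: "{P. \<lfloor>nu n (2 * m n) - 1/3\<rfloor> \<le> int (max_degree {1..n} P) \<and>
                int (max_degree {1..n} P) \<le> \<lfloor>nu n (2 * m n) + 1/3\<rfloor>}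
        \<subseteq> {P. let D = \<lfloor>nu n (2 * m n) - 1/3\<rfloor> in int (max_degree {1..n} P) \<in> {D, D + 1}}" for n
    proof -
      \<comment> \<open>The arguments differ by \<open>2/3 < 1\<close>, so the two floors differ by
        at most 1.\<close>
      have "\<lfloor>nu n (2 * m n) + 1/3\<rfloor> \<le> \<lfloor>nu n (2 * m n) - 1/3\<rfloor> + 1" by linarith
      then show ?thesis by (auto simp: Let_def)
    qed
    show "\<forall>\<^sub>F n in sequentially. measure_pmf.prob (pmf_of_set (planar_graphs n (m n)))
            {P. \<lfloor>nu n (2 * m n) - 1/3\<rfloor> \<le> int (max_degree {1..n} P) \<and>
                int (max_degree {1..n} P) \<le> \<lfloor>nu n (2 * m n) + 1/3\<rfloor>}
        \<le> measure_pmf.prob (pmf_of_set (planar_graphs n (m n)))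
            {P. let D = \<lfloor>nu n (2 * m n) - 1/3\<rfloor> in int (max_degree {1..n} P) \<in> {D, D + 1}}"
      by (intro always_eventually allI measure_pmf.finite_measure_mono sub) simp
  qed (simp add: measure_pmf.prob_le_1)
qed

end
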